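(* Let $\mathcal L=\mathcal L^h_{N,M}$, $\mathcal L_\alpha$, $\mathcal G_\alpha$ and ${\rm Inv}(\mathcal L)$ be as in the context. Then each $\mathcal L_\alpha$ is a closed subalgebra of $\mathcal L$, each $\mathcal G_\alpha$ is a closed subgroup of ${\rm Inv}(\mathcal L)$ (closedness with respect to $\|\cdot\|_{\mathcal L}$), and for $\alpha\neq\beta$, $\mathcal L_\alpha\cap\mathcal L_\beta=\{0\}$, $\mathcal G_\alpha\cap\mathcal G_\beta=\{\mathcal I\}$. Moreover $\mathcal L_\alpha\mathcal L_\beta\subseteq\mathcal L_{\alpha\cup\beta}$, $\mathcal L=\sum_{\alpha\in I_N}\mathcal L_\alpha$, ${\rm Inv}(\mathcal L)=\prod_{\alpha\in I_N}\mathcal G_\alpha$, where in the sum the order of terms is irrelevant and in the product the factors are arranged in ascending (or descending) order of $|\alpha|$ (i.e. every element of ${\rm Inv}(\mathcal L)$ is such a product $\prod_\alpha\mathcal G_\alpha$ with $\mathcal G_\alpha\in\mathcal G_\alpha$, and every such product lies in ${\rm Inv}(\mathcal L)$). For a given operator and a given order of the terms, the representations as such a sum and as such a product are unique.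
   Context: Let $N,M,p$ be positive integers and $h=1/p$. Let $I_N$ be the set of all subsets of $\{1,\dots,N\}$; for $\alpha\in I_N$, $|\alpha|$ is its cardinality and $\bar\alpha$ its complement. For $\mathbf x=(x_i)$ write $\mathbf x_\alpha=(x_i)_{i\in\alpha}\in[0,1)^{|\alpha|}$ (increasing indices). For disjoint $\alpha,\beta$, $\mathbf y_\beta\diamond\mathbf x_\alpha=\mathbf z_{\alpha\cup\beta}$ where $z_i=x_i$ for $i\in\alpha$ and $z_i=y_i$ for $i\in\beta$. Write $\langle f\rangle_\alpha=\int_{[0,1)^{|\alpha|}}f\,d\mathbf x_\alpha$, $\langle f\rangle_\emptyset=f$. Let $\chi^h_i$ be the indicator of $[i/p,(i+1)/p)$; a function on $[0,1)^R$ is $h$-staircase if it is a finite linear combination of $\prod_{j=1}^R\chi^h_{i_j}(y_j)$, and a matrix-valued function is $h$-staircase if all entries are. For an $h$-staircase $M\times M$ matrix function $\mathbf A(\mathbf k,\mathbf x_\alpha)$, $(\mathbf k,\mathbf x_\alpha)\in[0,1)^N\times[0,1)^{|\alpha|}$, let $\langle\mathbf A(\mathbf k,\mathbf x_\alpha)\cdot\rangle_\alpha$ denote the operator on $L^2([0,1)^N,\mathbb C^M)$ given by $\mathbf u\mapsto\langle\mathbf A(\mathbf k,\mathbf x_\alpha)\mathbf u(\mathbf k_{\bar\alpha}\diamond\mathbf x_\alpha)\rangle_\alpha$ (for $\alpha=\emptyset$ it is multiplication by $\mathbf A(\mathbf k)$). $\mathcal L=\mathcal L^h_{N,M}$ is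 the set of all finite sums $\sum_{\alpha\in I_N}\langle\mathbf A_\alpha(\mathbf k,\mathbf x_\alpha)\cdot\rangle_\alpha$ with $h$-staircase $\mathbf A_\alpha=(a_{i,j,\alpha})$, normed by $\|\mathcal A\|_{\mathcal L}=\sum_{\alpha}\max_{(\mathbf k,\mathbf x_\alpha),i}\sum_{j}|a_{i,j,\alpha}(\mathbf k,\mathbf x_\alpha)|$. Let $\mathcal L_\alpha=\{\langle\mathbf A(\mathbf k,\mathbf x_\alpha)\cdot\rangle_\alpha:\ \mathbf A\ h\text{-staircase}\}$. $\mathcal I$ denotes the identity operator. ${\rm Inv}(\mathcal L)$ denotes the set of operators in $\mathcal L$ that are invertible as bounded operators on $L^2([0,1)^N,\mathbb C^M)$. $\mathcal G_\emptyset$ is the set of invertible elements of $\mathcal L_\emptyset$, and for $\alpha\neq\emptyset$, $\mathcal G_\alpha$ is the set of invertible (as bounded operators) elements of $\mathcal I+\mathcal L_\alpha$. *)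

theory Defs
  imports "HOL-Analysis.Analysis"
begin

text \<open>Conventions: coordinates are indexed by 0..N-1 (instead of 1..N), so I_N = Pow {..<N};
 points of [0,1)^N are functions nat \<Rightarrow> real (only coordinates < N matter);
 a vector of C^M is a function nat \<Rightarrow> complex (only components < M matter);
 x_alpha is a function nat \<Rightarrow> real of which only the coordinates in alpha matter.\<close>

type_synonym pt = "nat \<Rightarrow> real"
type_synonym vfun = "pt \<Rightarrow> nat \<Rightarrow> complex"
type_synonym oper = "vfun \<Rightarrow> vfun"
type_synonym mfun = "pt \<Rightarrow> pt \<Rightarrow> nat \<Rightarrow> nat \<Rightarrow> complex"

definition unitI :: "real measure" where
  "unitI = restrict_space lborel {0..<1}"

definition Qm :: "nat set \<Rightarrow> pt measure" where
  "Qm I = PiM I (\<lambda>_. unitI)"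

definition box :: "nat set \<Rightarrow> pt set" where
  "box I = {x. \<forall>i\<in>I. 0 \<le> x i \<and> x i < 1}"

definition chi :: "nat \<Rightarrow> nat \<Rightarrow> real \<Rightarrow> real" where
  "chi p i t = (if real i / real p \<le> t \<and> t < (real i + 1) / real p then 1 else 0)"

text \<open>h-staircase (h = 1/p) scalar function of (k, x_alpha) in [0,1)^N x [0,1)^|alpha|:
  a finite linear combination of products of indicators in all coordinates.\<close>
definition staircase_fn :: "nat \<Rightarrow> nat \<Rightarrow> nat set \<Rightarrow> (pt \<Rightarrow> pt \<Rightarrow> complex) \<Rightarrow> bool" where
  "staircase_fn p N \<alpha> f \<longleftrightarrow>
     (\<exists>(S :: ((nat \<Rightarrow> nat) \<times> (nat \<Rightarrow> nat)) set) c. finite S \<and>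
       (\<forall>k\<in>box {..<N}. \<forall>x\<in>box \<alpha>.
          f k x = (\<Sum>(\<iota>,\<kappa>)\<in>S. c (\<iota>,\<kappa>) *
             complex_of_real ((\<Prod>i<N. chi p (\<iota> i) (k i)) * (\<Prod>i\<in>\<alpha>. chi p (\<kappa> i) (x i))))))"

definition staircase_mat :: "nat \<Rightarrow> nat \<Rightarrow> nat \<Rightarrow> nat set \<Rightarrow> mfun \<Rightarrow> bool" where
  "staircase_mat p N M \<alpha> A \<longleftrightarrow> (\<forall>i<M. \<forall>j<M. staircase_fn p N \<alpha> (\<lambda>k x. A k x i j))"

definition merge :: "nat set \<Rightarrow> pt \<Rightarrow> pt \<Rightarrow> pt" where
  "merge \<alpha> k x = (\<lambda>i. if i \<in> \<alpha> then x i else k i)"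

definition opA :: "nat \<Rightarrow> nat \<Rightarrow> nat set \<Rightarrow> mfun \<Rightarrow> oper" where
  "opA N M \<alpha> A u = (\<lambda>k i. if i < M then
      (\<integral>x. (\<Sum>j<M. A k x i j * u (merge \<alpha> k x) j) \<partial>(Qm \<alpha>)) else 0)"

definition L2 :: "nat \<Rightarrow> nat \<Rightarrow> vfun set" where
  "L2 N M = {u. \<forall>j<M. (\<lambda>k. u k j) \<in> borel_measurable (Qm {..<N}) \<and>
                        integrable (Qm {..<N}) (\<lambda>k. (cmod (u k j))\<^sup>2)}"

definition norm2 :: "nat \<Rightarrow> nat \<Rightarrow> vfun \<Rightarrow> real" where
  "norm2 N M u = sqrt (\<Sum>j<M. \<integral>k. (cmod (u k j))\<^sup>2 \<partial>(Qm {..<N}))"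

definition ae_eq :: "nat \<Rightarrow> nat \<Rightarrow> vfun \<Rightarrow> vfun \<Rightarrow> bool" where
  "ae_eq N M u v \<longleftrightarrow> (AE k in Qm {..<N}. \<forall>j<M. u k j = v k j)"

definition op_eq :: "nat \<Rightarrow> nat \<Rightarrow> oper \<Rightarrow> oper \<Rightarrow> bool" where
  "op_eq N M F G \<longleftrightarrow> (\<forall>u\<in>L2 N M. ae_eq N M (F u) (G u))"

definition bounded_op :: "nat \<Rightarrow> nat \<Rightarrow> oper \<Rightarrow> bool" where
  "bounded_op N M G \<longleftrightarrow>
     (\<forall>u\<in>L2 N M. G u \<in> L2 N M) \<and>
     (\<forall>u\<in>L2 N M. \<forall>v\<in>L2 N M. ae_eq N M u v \<longrightarrow> ae_eq N M (G u) (G v)) \<and>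
     (\<forall>u\<in>L2 N M. \<forall>v\<in>L2 N M. \<forall>c::complex.
        ae_eq N M (G (\<lambda>k j. u k j + c * v k j)) (\<lambda>k j. G u k j + c * G v k j)) \<and>
     (\<exists>C. \<forall>u\<in>L2 N M. norm2 N M (G u) \<le> C * norm2 N M u)"

definition invertible_op :: "nat \<Rightarrow> nat \<Rightarrow> oper \<Rightarrow> bool" where
  "invertible_op N M F \<longleftrightarrow> bounded_op N M F \<and>
     (\<exists>G. bounded_op N M G \<and> (\<forall>u\<in>L2 N M. ae_eq N M (F (G u)) u \<and> ae_eq N M (G (F u)) u))"

definition Iop :: oper where "Iop = (\<lambda>u. u)"
definition zero_op :: oper where "zero_op = (\<lambda>u k i. 0)"
definition op_add :: "oper \<Rightarrow> oper \<Rightarrow> oper" where "op_add F G = (\<lambda>u k i. F u k i + G u k i)"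
definition op_sub :: "oper \<Rightarrow> oper \<Rightarrow> oper" where "op_sub F G = (\<lambda>u k i. F u k i - G u k i)"
definition op_scale :: "complex \<Rightarrow> oper \<Rightarrow> oper" where "op_scale c F = (\<lambda>u k i. c * F u k i)"

definition Lset :: "nat \<Rightarrow> nat \<Rightarrow> nat \<Rightarrow> nat set \<Rightarrow> oper set" where
  "Lset N M p \<alpha> = {opA N M \<alpha> A | A. staircase_mat p N M \<alpha> A}"

definition opsum :: "nat \<Rightarrow> nat \<Rightarrow> (nat set \<Rightarrow> mfun) \<Rightarrow> oper" where
  "opsum N M A = (\<lambda>u k i. \<Sum>\<alpha>\<in>Pow {..<N}. opA N M \<alpha> (A \<alpha>) u k i)"

definition Lall :: "nat \<Rightarrow> nat \<Rightarrow> nat \<Rightarrow> oper set" where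
  "Lall N M p = {opsum N M A | A. \<forall>\<alpha>\<in>Pow {..<N}. staircase_mat p N M \<alpha> (A \<alpha>)}"

definition coef_norm :: "nat \<Rightarrow> nat \<Rightarrow> (nat set \<Rightarrow> mfun) \<Rightarrow> real" where
  "coef_norm N M A = (\<Sum>\<alpha>\<in>Pow {..<N}.
      Sup {\<Sum>j<M. cmod (A \<alpha> k x i j) | k x i. k \<in> box {..<N} \<and> x \<in> box \<alpha> \<and> i < M})"

text \<open>The norm of L, computed from a representation (unique by the theorem).\<close>
definition normL :: "nat \<Rightarrow> nat \<Rightarrow> nat \<Rightarrow> oper \<Rightarrow> real" where
  "normL N M p F = Inf {coef_norm N M A | A. (\<forall>\<alpha>\<in>Pow {..<N}. staircase_mat p N M \<alpha> (A \<alpha>)) \<and>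
                                             op_eq N M F (opsum N M A)}"

definition InvL :: "nat \<Rightarrow> nat \<Rightarrow> nat \<Rightarrow> oper set" where
  "InvL N M p = {F \<in> Lall N M p. invertible_op N M F}"

definition Gset :: "nat \<Rightarrow> nat \<Rightarrow> nat \<Rightarrow> nat set \<Rightarrow> oper set" where
  "Gset N M p \<alpha> = (if \<alpha> = {} then {F \<in> Lset N M p {}. invertible_op N M F}
     else {op_add Iop F | F. F \<in> Lset N M p \<alpha> \<and> invertible_op N M (op_add Iop F)})"

definition memL :: "nat \<Rightarrow> nat \<Rightarrow> oper set \<Rightarrow> oper \<Rightarrow> bool" where
  "memL N M S F \<longleftrightarrow> (\<exists>G\<in>S. op_eq N M F G)"

definition closed_subalgebra :: "nat \<Rightarrow> nat \<Rightarrow> nat \<Rightarrow> oper set \<Rightarrow> bool" where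
  "closed_subalgebra N M p S \<longleftrightarrow>
     (\<forall>F\<in>S. memL N M (Lall N M p) F) \<and>
     memL N M S zero_op \<and>
     (\<forall>F\<in>S. \<forall>G\<in>S. memL N M S (op_add F G) \<and> memL N M S (F \<circ> G)) \<and>
     (\<forall>F\<in>S. \<forall>c. memL N M S (op_scale c F)) \<and>
     (\<forall>X F. (\<forall>n::nat. X n \<in> S) \<longrightarrow> F \<in> Lall N M p \<longrightarrow>
        (\<lambda>n. normL N M p (op_sub (X n) F)) \<longlonglongrightarrow> 0 \<longrightarrow> memL N M S F)"

definition closed_subgroup_Inv :: "nat \<Rightarrow> nat \<Rightarrow> nat \<Rightarrow> oper set \<Rightarrow> bool" where
  "closed_subgroup_Inv N M p S \<longleftrightarrow>
     (\<forall>F\<in>S. memL N M (InvL N M p) F) \<and>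
     memL N M S Iop \<and>
     (\<forall>F\<in>S. \<forall>G\<in>S. memL N M S (F \<circ> G)) \<and>
     (\<forall>F\<in>S. \<exists>H\<in>S. op_eq N M (F \<circ> H) Iop \<and> op_eq N M (H \<circ> F) Iop) \<and>
     (\<forall>X F. (\<forall>n::nat. X n \<in> S) \<longrightarrow> F \<in> InvL N M p \<longrightarrow>
        (\<lambda>n. normL N M p (op_sub (X n) F)) \<longlonglongrightarrow> 0 \<longrightarrow> memL N M S F)"

end

theory Submission
  imports Defs "HOL-Library.Function_Algebras"
begin

text \<open>
  A staircase kernel is determined by its values on the cells of the grid, so an operator of \<open>\<L>\<close> is
  encoded by a finitely supported coefficient function. Composition respects the grading by index
  sets, \<open>\<L>\<^sub>\<alpha> \<L>\<^sub>\<beta> \<subseteq> \<L>\<^sub>\<alpha>\<^sub>\<union>\<^sub>\<beta>\<close>, by Fubini: the variables in \<open>\<alpha> \<inter> \<beta>\<close> are integrated out of the product of the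
  kernels. The coefficients are unique because averaging over a coordinate and keeping it fixed act
  differently on indicators of half cells. Hence \<open>\<L>\<close> is a finite-dimensional algebra, an invertible
  element has its inverse in every unital subalgebra \<open>\<C> \<I> + \<Sum>\<^bsub>\<alpha>\<in>\<A>\<^esub> \<L>\<^sub>\<alpha>\<close> that contains it, and the norm
  dominates every single coefficient, which gives closedness.

  For the product, list the index sets by ascending cardinality. The span of the \<open>\<L>\<^sub>\<beta>\<close> with \<open>\<beta>\<close> strictly
  after \<open>\<alpha>\<close> in the list is an ideal in the span of those from \<open>\<alpha>\<close> on, so modulo this ideal an invertible
  \<open>\<I> + K\<^sub>\<alpha> + \<dots>\<close> becomes \<open>\<I> + K\<^sub>\<alpha>\<close>, which is therefore invertible and can be split off on the left.
  Reversing the multiplication gives the descending order.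
\<close>

section \<open>Product measures and staircase functions\<close>

text \<open>Two features shape the proof. Operators are compared only up to almost everywhere
  equality on \<open>L2\<close>, so the algebra is carried out on coefficient functions, where
  equality is genuine: their product is defined by transport along \<open>Phi\<close>, and its laws
  follow from the injectivity of \<open>Phi\<close>. Secondly, the inverse in
  \<open>invertible_op\<close> is merely a bounded operator, not known to lie in
  \<open>Lall\<close>. It enters through left cancellation; on a finite-dimensional space an
  injective left multiplication is onto, and this produces an inverse inside the algebra. Half cells
  are forced by the fact that functions constant on cells cannot separate the terms: for
  \<open>p = 1\<close> the identity and the average over a coordinate agree on constants. In an
  ascending list the empty set comes first, so the proper tails span subspaces without the unit.
  Therefore membership is always stated for \<open>x - e\<close> and not for \<open>x\<close>. This
  also merges the two clauses of \<open>Gset\<close>, since the unit itself belongs to the empty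
  index set.\<close>

lemma space_unitI [simp]: "space unitI = {0..<1}"
  by (simp add: unitI_def space_restrict_space)

lemma sets_unitI [measurable_cong]: "sets unitI = sets (restrict_space borel {0..<1})"
  by (simp add: unitI_def sets_restrict_space)

lemma emeasure_unitI: "A \<in> sets borel \<Longrightarrow> A \<subseteq> {0..<1} \<Longrightarrow> emeasure unitI A = emeasure lborel A"
  by (simp add: unitI_def emeasure_restrict_space)

lemma emeasure_space_unitI: "emeasure unitI {0..<1} = 1"
  by (simp add: emeasure_unitI)

interpretation unitI: finite_measure unitI
  by standard (simp add: emeasure_space_unitI)

interpretation unitI_prod: product_sigma_finite "\<lambda>_::nat. unitI"
  by standard

lemma space_Qm: "space (Qm I) = PiE I (\<lambda>_. {0..<1})"
  by (simp add: Qm_def space_PiM)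

lemma space_Qm_subset_box: "x \<in> space (Qm I) \<Longrightarrow> x \<in> box I"
  by (auto simp: space_Qm box_def PiE_iff)

lemma emeasure_space_Qm:
  assumes "finite I" shows "emeasure (Qm I) (space (Qm I)) = 1"
proof -
  have "emeasure (Qm I) (PiE I (\<lambda>_. {0..<1})) = (\<Prod>i\<in>I. emeasure unitI {0..<1})"
    unfolding Qm_def using assms sets.top[of unitI] by (intro unitI_prod.emeasure_PiM) auto
  then show ?thesis by (simp add: space_Qm emeasure_space_unitI)
qed

lemma finite_measure_Qm: "finite I \<Longrightarrow> finite_measure (Qm I)"
  by standard (simp add: emeasure_space_Qm)

lemma measure_space_Qm: "finite I \<Longrightarrow> measure (Qm I) (space (Qm I)) = 1"
  by (simp add: measure_def emeasure_space_Qm)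

lemma pair_sigma_finite_Qm:
  assumes "finite I" "finite J" shows "pair_sigma_finite (Qm I) (Qm J)"
proof -
  interpret I: finite_measure "Qm I" by (rule finite_measure_Qm[OF assms(1)])
  interpret J: finite_measure "Qm J" by (rule finite_measure_Qm[OF assms(2)])
  show ?thesis ..
qed

lemma merge_in_space:
  "x \<in> space (Qm I) \<Longrightarrow> y \<in> space (Qm J) \<Longrightarrow> merge J x y \<in> space (Qm (I \<union> J))"
  by (auto simp: space_Qm merge_def PiE_iff extensional_def)

lemma merge_in_space_subset:
  "x \<in> space (Qm I) \<Longrightarrow> y \<in> space (Qm J) \<Longrightarrow> J \<subseteq> I \<Longrightarrow> merge J x y \<in> space (Qm I)"
  using merge_in_space[of x I y J] by (simp add: Un_absorb2)

lemma measurable_coord [measurable]: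
  assumes "i \<in> I" shows "(\<lambda>x. x i) \<in> borel_measurable (Qm I)"
proof -
  have "(\<lambda>x. x i) \<in> Qm I \<rightarrow>\<^sub>M unitI"
    unfolding Qm_def using assms by (rule measurable_component_singleton)
  then have "(\<lambda>x. x i) \<in> Qm I \<rightarrow>\<^sub>M restrict_space borel {0..<1}"
    using sets_unitI by (simp cong: measurable_cong_sets)
  then show ?thesis by (rule measurable_restrict_space2_iff[THEN iffD1, THEN conjunct1])
qed

lemma measurable_merge_Qm:
  "(\<lambda>(x, y). merge J x y) \<in> Qm I \<Otimes>\<^sub>M Qm J \<rightarrow>\<^sub>M Qm (I \<union> J)"
proof -
  have c: "(\<lambda>x. x i) \<in> Qm K \<rightarrow>\<^sub>M unitI" if "i \<in> K" for i K
    unfolding Qm_def using that by (rule measurable_component_singleton)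
  have "(\<lambda>z i. merge J (fst z) (snd z) i) \<in> Qm I \<Otimes>\<^sub>M Qm J \<rightarrow>\<^sub>M PiM (I \<union> J) (\<lambda>_. unitI)"
  proof (rule measurable_PiM_single')
    fix i assume i: "i \<in> I \<union> J"
    show "(\<lambda>z. merge J (fst z) (snd z) i) \<in> Qm I \<Otimes>\<^sub>M Qm J \<rightarrow>\<^sub>M unitI"
    proof (cases "i \<in> J")
      case True
      then show ?thesis
        using measurable_compose[OF measurable_snd c[OF True]] by (simp add: merge_def)
    next
      case False
      with i have "i \<in> I" by simp
      with False show ?thesis
        using measurable_compose[OF measurable_fst c[OF \<open>i \<in> I\<close>]] by (simp add: merge_def)
    qed
  next
    show "(\<lambda>z. merge J (fst z) (snd z)) \<in> space (Qm I \<Otimes>\<^sub>M Qm J) \<rightarrow> (\<Pi>\<^sub>E i\<in>I \<union> J. space unitI)"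
      by (auto simp: space_pair_measure space_Qm merge_def PiE_iff extensional_def)
  qed
  then show ?thesis by (simp add: Qm_def split_def)
qed

text \<open>\<open>I\<close> and \<open>J\<close> may overlap. The coordinates of \<open>x\<close>
  in \<open>J\<close> are overwritten by \<open>y\<close>, and integrating them out costs nothing
  because \<open>unitI\<close> has total mass one.\<close>

lemma distr_merge_Qm:
  assumes I: "finite I" and J: "finite J"
  shows "distr (Qm I \<Otimes>\<^sub>M Qm J) (Qm (I \<union> J)) (\<lambda>(x, y). merge J x y) = Qm (I \<union> J)"
proof -
  interpret pair_sigma_finite "Qm I" "Qm J" by (rule pair_sigma_finite_Qm[OF I J])
  have "distr (Qm I \<Otimes>\<^sub>M Qm J) (Qm (I \<union> J)) (\<lambda>(x, y). merge J x y) = PiM (I \<union> J) (\<lambda>_. unitI)"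
  proof (rule unitI_prod.PiM_eqI)
    show "finite (I \<union> J)" using I J by simp
    show "sets (distr (Qm I \<Otimes>\<^sub>M Qm J) (Qm (I \<union> J)) (\<lambda>(x, y). merge J x y)) = sets (PiM (I \<union> J) (\<lambda>_. unitI))"
      by (simp add: Qm_def)
    fix A :: "nat \<Rightarrow> real set"
    assume A: "\<And>i. i \<in> I \<union> J \<Longrightarrow> A i \<in> sets unitI"
    \<comment> \<open>Overwritten coordinates of \<open>x\<close> are unconstrained, hence the full
      interval on \<open>J\<close>.\<close>
    define B where "B i = (if i \<in> J then {0..<1} else A i)" for i
    have B: "B i \<in> sets unitI" if "i \<in> I" for i
      using A that sets.top[of unitI] by (auto simp: B_def)
    have Asub: "A i \<subseteq> {0..<1}" if "i \<in> I \<union> J" for i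
      using sets.sets_into_space[OF A[OF that]] by simp
    have sA: "PiE (I \<union> J) A \<in> sets (Qm (I \<union> J))"
      unfolding Qm_def using I J A by (intro sets_PiM_I_finite) auto
    have "(\<lambda>(x, y). merge J x y) -` (PiE (I \<union> J) A) \<inter> space (Qm I \<Otimes>\<^sub>M Qm J) = PiE I B \<times> PiE J A"
      using Asub
      by (auto simp: space_pair_measure space_Qm merge_def B_def PiE_iff extensional_def subset_iff
          split: if_splits) (metis)+
    then have "emeasure (distr (Qm I \<Otimes>\<^sub>M Qm J) (Qm (I \<union> J)) (\<lambda>(x, y). merge J x y)) (PiE (I \<union> J) A) =
       emeasure (Qm I \<Otimes>\<^sub>M Qm J) (PiE I B \<times> PiE J A)"
      by (subst emeasure_distr[OF measurable_merge_Qm sA]) simp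
    also have "\<dots> = emeasure (Qm I) (PiE I B) * emeasure (Qm J) (PiE J A)"
      unfolding Qm_def using I J A B
      by (intro M2.emeasure_pair_measure_Times[unfolded Qm_def] sets_PiM_I_finite) auto
    also have "\<dots> = (\<Prod>i\<in>I. emeasure unitI (B i)) * (\<Prod>i\<in>J. emeasure unitI (A i))"
      unfolding Qm_def using I J A B by (simp add: unitI_prod.emeasure_PiM)
    also have "(\<Prod>i\<in>I. emeasure unitI (B i)) = (\<Prod>i\<in>I - J. emeasure unitI (A i))"
      using I by (intro prod.mono_neutral_cong_right) (auto simp: B_def emeasure_space_unitI)
    also have "(\<Prod>i\<in>I - J. emeasure unitI (A i)) * (\<Prod>i\<in>J. emeasure unitI (A i)) = (\<Prod>i\<in>I \<union> J. emeasure unitI (A i))"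
      using I J by (subst prod.union_disjoint[symmetric]) auto
    finally show "emeasure (distr (Qm I \<Otimes>\<^sub>M Qm J) (Qm (I \<union> J)) (\<lambda>(x, y). merge J x y)) (PiE (I \<union> J) A) =
      (\<Prod>i\<in>I \<union> J. emeasure unitI (A i))" .
  qed
  then show ?thesis by (simp add: Qm_def)
qed

section \<open>Grid cells and the cell-wise description of staircase functions\<close>

definition cell :: "nat \<Rightarrow> real \<Rightarrow> nat" where
  "cell p t = nat \<lfloor>real p * t\<rfloor>"

text \<open>Restricting to \<open>I\<close> makes the tuple extensional, so that it ranges over a
  finite \<open>PiE\<close> and equality of tuples means equality on \<open>I\<close>.\<close>

definition cells :: "nat \<Rightarrow> nat set \<Rightarrow> pt \<Rightarrow> nat \<Rightarrow> nat" where
  "cells p I x = restrict (\<lambda>i. cell p (x i)) I"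

definition corner :: "nat \<Rightarrow> (nat \<Rightarrow> nat) \<Rightarrow> pt" where
  "corner p \<kappa> = (\<lambda>i. real (\<kappa> i) / real p)"

lemma chi_eq_cell:
  assumes "p > 0" "0 \<le> t" shows "chi p i t = (if cell p t = i then 1 else 0)"
proof -
  have "cell p t = i \<longleftrightarrow> \<lfloor>real p * t\<rfloor> = int i"
    using assms by (auto simp: cell_def)
  also have "\<dots> \<longleftrightarrow> real i \<le> real p * t \<and> real p * t < real i + 1"
    by (simp add: floor_eq_iff)
  also have "\<dots> \<longleftrightarrow> real i / real p \<le> t \<and> t < (real i + 1) / real p"
    using assms by (simp add: field_simps)
  finally show ?thesis by (simp add: chi_def)
qed

lemma cell_less: "p > 0 \<Longrightarrow> 0 \<le> t \<Longrightarrow> t < 1 \<Longrightarrow> cell p t < p"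
  unfolding cell_def by (subst nat_less_iff) (auto simp: floor_less_iff)

lemma cell_corner: "p > 0 \<Longrightarrow> cell p (real i / real p) = i"
  by (simp add: cell_def)

lemma cells_in: "p > 0 \<Longrightarrow> x \<in> box I \<Longrightarrow> cells p I x \<in> PiE I (\<lambda>_. {..<p})"
  by (auto simp: cells_def box_def cell_less)

lemma cells_corner: "p > 0 \<Longrightarrow> \<kappa> \<in> PiE I (\<lambda>_. {..<p}) \<Longrightarrow> cells p I (corner p \<kappa>) = \<kappa>"
  by (auto simp: cells_def corner_def cell_corner fun_eq_iff PiE_iff extensional_def restrict_def)

lemma corner_in_box: "p > 0 \<Longrightarrow> \<kappa> \<in> PiE I (\<lambda>_. {..<p}) \<Longrightarrow> corner p \<kappa> \<in> box I"
  by (auto simp: corner_def box_def PiE_iff)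

lemma cells_eq_iff: "cells p I x = cells p I y \<longleftrightarrow> (\<forall>i\<in>I. cell p (x i) = cell p (y i))"
  by (auto simp: cells_def fun_eq_iff restrict_def)

lemma prod_chi_eq_cells:
  assumes "p > 0" "finite I" "x \<in> box I"
  shows "(\<Prod>i\<in>I. chi p (\<kappa> i) (x i)) = (if cells p I x = restrict \<kappa> I then 1 else 0)"
proof -
  have "(\<Prod>i\<in>I. chi p (\<kappa> i) (x i)) = (\<Prod>i\<in>I. if cell p (x i) = \<kappa> i then 1 else 0)"
    using assms by (intro prod.cong) (auto simp: chi_eq_cell box_def)
  also have "\<dots> = (if \<forall>i\<in>I. cell p (x i) = \<kappa> i then 1 else 0)"
    using assms(2) by (induction I rule: finite_induct) auto
  finally show ?thesis by (auto simp: cells_def fun_eq_iff restrict_def)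
qed

text \<open>On the box, a product of \<open>chi\<close> factors is the indicator of a single grid
  cell or zero, and there are only finitely many cells. So the linear combinations are exactly the
  functions of the two tuples of cell numbers.\<close>

lemma staircase_fn_iff:
  assumes p: "p > 0" and \<alpha>: "finite \<alpha>"
  shows "staircase_fn p N \<alpha> f \<longleftrightarrow>
    (\<exists>c. \<forall>k\<in>box {..<N}. \<forall>x\<in>box \<alpha>. f k x = c (cells p {..<N} k) (cells p \<alpha> x))"
proof
  assume "staircase_fn p N \<alpha> f"
  then obtain S c where S: "finite S" and
    f: "\<And>k x. k \<in> box {..<N} \<Longrightarrow> x \<in> box \<alpha> \<Longrightarrow>
          f k x = (\<Sum>(\<iota>,\<kappa>)\<in>S. c (\<iota>,\<kappa>) *
             complex_of_real ((\<Prod>i<N. chi p (\<iota> i) (k i)) * (\<Prod>i\<in>\<alpha>. chi p (\<kappa> i) (x i))))"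
    unfolding staircase_fn_def by blast
  show "\<exists>c. \<forall>k\<in>box {..<N}. \<forall>x\<in>box \<alpha>. f k x = c (cells p {..<N} k) (cells p \<alpha> x)"
    by (rule exI[of _ "\<lambda>a b. \<Sum>(\<iota>,\<kappa>)\<in>S. c (\<iota>,\<kappa>) *
             complex_of_real ((if a = restrict \<iota> {..<N} then 1 else 0) * (if b = restrict \<kappa> \<alpha> then 1 else 0))"])
      (simp add: f prod_chi_eq_cells p \<alpha>)
next
  assume "\<exists>c. \<forall>k\<in>box {..<N}. \<forall>x\<in>box \<alpha>. f k x = c (cells p {..<N} k) (cells p \<alpha> x)"
  then obtain c where c: "\<And>k x. k \<in> box {..<N} \<Longrightarrow> x \<in> box \<alpha> \<Longrightarrow> f k x = c (cells p {..<N} k) (cells p \<alpha> x)"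
    by blast
  \<comment> \<open>One term per pair of cells, with the value on that pair as its
    coefficient.\<close>
  let ?S = "PiE {..<N} (\<lambda>_. {..<p}) \<times> PiE \<alpha> (\<lambda>_. {..<p})"
  have fin: "finite ?S" using \<alpha> by (intro finite_cartesian_product finite_PiE) auto
  have "f k x = (\<Sum>(\<iota>,\<kappa>)\<in>?S. c \<iota> \<kappa> *
             complex_of_real ((\<Prod>i<N. chi p (\<iota> i) (k i)) * (\<Prod>i\<in>\<alpha>. chi p (\<kappa> i) (x i))))"
    if k: "k \<in> box {..<N}" and x: "x \<in> box \<alpha>" for k x
  proof -
    have "(\<Sum>(\<iota>,\<kappa>)\<in>?S. c \<iota> \<kappa> *
             complex_of_real ((\<Prod>i<N. chi p (\<iota> i) (k i)) * (\<Prod>i\<in>\<alpha>. chi p (\<kappa> i) (x i)))) =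
          (\<Sum>z\<in>?S. if z = (cells p {..<N} k, cells p \<alpha> x) then c (fst z) (snd z) else 0)"
    proof (intro sum.cong refl)
      fix z assume z: "z \<in> ?S"
      obtain \<iota> \<kappa> where [simp]: "z = (\<iota>, \<kappa>)" by (cases z)
      have "restrict \<iota> {..<N} = \<iota>" "restrict \<kappa> \<alpha> = \<kappa>"
        using z by (auto intro!: extensional_restrict simp: PiE_iff)
      then show "(case z of (\<iota>,\<kappa>) \<Rightarrow> c \<iota> \<kappa> *
             complex_of_real ((\<Prod>i<N. chi p (\<iota> i) (k i)) * (\<Prod>i\<in>\<alpha>. chi p (\<kappa> i) (x i)))) =
         (if z = (cells p {..<N} k, cells p \<alpha> x) then c (fst z) (snd z) else 0)"
        using k x p \<alpha> by (auto simp: prod_chi_eq_cells)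
    qed
    also have "\<dots> = c (cells p {..<N} k) (cells p \<alpha> x)"
      using cells_in[OF p k] cells_in[OF p x] fin by (simp add: sum.delta')
    finally show ?thesis using c[OF k x] by simp
  qed
  then show "staircase_fn p N \<alpha> f"
    unfolding staircase_fn_def
    by (intro exI[of _ ?S] exI[of _ "\<lambda>(\<iota>,\<kappa>). c \<iota> \<kappa>"]) (use fin in auto)
qed

lemma staircase_fn_cong:
  assumes "staircase_fn p N \<alpha> f" "p > 0" "finite \<alpha>"
    "k \<in> box {..<N}" "k' \<in> box {..<N}" "x \<in> box \<alpha>" "x' \<in> box \<alpha>"
    "\<And>i. i < N \<Longrightarrow> cell p (k i) = cell p (k' i)" "\<And>i. i \<in> \<alpha> \<Longrightarrow> cell p (x i) = cell p (x' i)"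
  shows "f k x = f k' x'"
proof -
  have "cells p {..<N} k = cells p {..<N} k'" "cells p \<alpha> x = cells p \<alpha> x'"
    using assms by (auto simp: cells_eq_iff)
  then show ?thesis using assms(1-7) by (auto simp: staircase_fn_iff)
qed

lemma staircase_fnI:
  assumes "p > 0" "finite \<alpha>"
    and cong: "\<And>k k' x x'. k \<in> box {..<N} \<Longrightarrow> k' \<in> box {..<N} \<Longrightarrow> x \<in> box \<alpha> \<Longrightarrow> x' \<in> box \<alpha> \<Longrightarrow>
    (\<And>i. i < N \<Longrightarrow> cell p (k i) = cell p (k' i)) \<Longrightarrow> (\<And>i. i \<in> \<alpha> \<Longrightarrow> cell p (x i) = cell p (x' i)) \<Longrightarrow>
    f k x = f k' x'"
  shows "staircase_fn p N \<alpha> f"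
  unfolding staircase_fn_iff[OF assms(1,2)]
\<comment> \<open>The value on a cell is sampled at its lower corner, which has the same cell
  numbers.\<close>
proof (intro exI[of _ "\<lambda>a b. f (corner p a) (corner p b)"] ballI)
  fix k x assume k: "k \<in> box {..<N}" and x: "x \<in> box \<alpha>"
  note a = cells_in[OF assms(1) k] cells_in[OF assms(1) x]
  have "cell p (corner p (cells p I y) i) = cell p (y i)" if "i \<in> I" for i I y
    using that assms(1) by (simp add: corner_def cells_def cell_corner)
  then show "f k x = f (corner p (cells p {..<N} k)) (corner p (cells p \<alpha> x))"
    using a assms(1) k x by (intro cong corner_in_box) auto
qed

lemma staircase_fn_bounded:
  assumes "staircase_fn p N \<alpha> f" "p > 0" "finite \<alpha>"
  shows "\<exists>C\<ge>0. \<forall>k\<in>box {..<N}. \<forall>x\<in>box \<alpha>. cmod (f k x) \<le> C"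
proof -
  obtain c where c: "\<And>k x. k \<in> box {..<N} \<Longrightarrow> x \<in> box \<alpha> \<Longrightarrow> f k x = c (cells p {..<N} k) (cells p \<alpha> x)"
    using assms by (auto simp: staircase_fn_iff)
  let ?S = "PiE {..<N} (\<lambda>_. {..<p}) \<times> PiE \<alpha> (\<lambda>_. {..<p})"
  have fin: "finite ?S" using assms by (intro finite_cartesian_product finite_PiE) auto
  let ?C = "\<Sum>(a, b)\<in>?S. cmod (c a b)"
  have "cmod (f k x) \<le> ?C" if "k \<in> box {..<N}" "x \<in> box \<alpha>" for k x
    using member_le_sum[of "(cells p {..<N} k, cells p \<alpha> x)" ?S "\<lambda>(a,b). cmod (c a b)"]
      cells_in[OF assms(2) that(1)] cells_in[OF assms(2) that(2)] fin c[OF that] by auto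
  moreover have "?C \<ge> 0" by (intro sum_nonneg) auto
  ultimately show ?thesis by blast
qed

lemma measurable_chi [measurable]: "chi p i \<in> borel_measurable borel"
  unfolding chi_def by measurable

lemma staircase_fn_measurable:
  assumes "staircase_fn p N \<alpha> f"
  shows "(\<lambda>(k, x). f k x) \<in> borel_measurable (Qm {..<N} \<Otimes>\<^sub>M Qm \<alpha>)"
proof -
  obtain S c where S: "finite S" and
    f: "\<And>k x. k \<in> box {..<N} \<Longrightarrow> x \<in> box \<alpha> \<Longrightarrow>
          f k x = (\<Sum>(\<iota>,\<kappa>)\<in>S. c (\<iota>,\<kappa>) *
             complex_of_real ((\<Prod>i<N. chi p (\<iota> i) (k i)) * (\<Prod>i\<in>\<alpha>. chi p (\<kappa> i) (x i))))"
    using assms unfolding staircase_fn_def by blast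
  have m: "(\<lambda>z. chi p n (fst z i)) \<in> borel_measurable (Qm {..<N} \<Otimes>\<^sub>M Qm \<alpha>)" if "i < N" for i n
    using that measurable_compose[OF measurable_compose[OF measurable_fst measurable_coord] measurable_chi, of i "{..<N}"] by simp
  have m2: "(\<lambda>z. chi p n (snd z i)) \<in> borel_measurable (Qm {..<N} \<Otimes>\<^sub>M Qm \<alpha>)" if "i \<in> \<alpha>" for i n
    using that measurable_compose[OF measurable_compose[OF measurable_snd measurable_coord] measurable_chi, of i \<alpha>] by simp
  have "(\<lambda>z. \<Sum>w\<in>S. c w *
             complex_of_real ((\<Prod>i<N. chi p (fst w i) (fst z i)) * (\<Prod>i\<in>\<alpha>. chi p (snd w i) (snd z i))))
     \<in> borel_measurable (Qm {..<N} \<Otimes>\<^sub>M Qm \<alpha>)"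
    using m m2 by (intro borel_measurable_sum borel_measurable_times borel_measurable_const
        borel_measurable_of_real borel_measurable_prod) auto
  then show ?thesis
    by (subst measurable_cong[where g = "\<lambda>z. \<Sum>w\<in>S. c w *
             complex_of_real ((\<Prod>i<N. chi p (fst w i) (fst z i)) * (\<Prod>i\<in>\<alpha>. chi p (snd w i) (snd z i)))"])
      (auto simp: space_pair_measure f space_Qm_subset_box split_def)
qed

section \<open>Integral operators with staircase kernels\<close>

text \<open>Cauchy-Schwarz on a probability space. Integrability comes from
  \<open>cmod z \<le> 1 + (cmod z)\<^sup>2\<close>, the inequality from the nonnegative variance of
  \<open>cmod (f x)\<close>.\<close>

lemma norm_integral_squared_le:
  fixes f :: "'a \<Rightarrow> complex"
  assumes "finite_measure \<mu>" and one: "measure \<mu> (space \<mu>) = 1"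
    and f: "f \<in> borel_measurable \<mu>" and f2: "integrable \<mu> (\<lambda>x. (cmod (f x))\<^sup>2)"
  shows "integrable \<mu> f" "(cmod (\<integral>x. f x \<partial>\<mu>))\<^sup>2 \<le> (\<integral>x. (cmod (f x))\<^sup>2 \<partial>\<mu>)"
proof -
  interpret finite_measure \<mu> by fact
  show fi: "integrable \<mu> f"
  proof (rule Bochner_Integration.integrable_bound)
    show "integrable \<mu> (\<lambda>x. 1 + (cmod (f x))\<^sup>2)" using f2 by simp
    have "cmod z \<le> 1 + (cmod z)\<^sup>2" for z
      using sum_power2_ge_zero[of "cmod z - 1" 0] norm_ge_zero[of z]
      by (simp add: power2_eq_square algebra_simps)
        (smt (verit, best) mult_nonneg_nonneg mult_le_cancel_right1 norm_ge_zero)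
    then show "AE x in \<mu>. norm (f x) \<le> norm (1 + (cmod (f x))\<^sup>2)"
      by (intro AE_I2) (auto intro!: order_trans[OF _ abs_ge_self])
  qed fact
  let ?c = "\<integral>x. cmod (f x) \<partial>\<mu>"
  have "0 \<le> (\<integral>x. (cmod (f x) - ?c)\<^sup>2 \<partial>\<mu>)" by simp
  also have "\<dots> = (\<integral>x. (cmod (f x))\<^sup>2 - 2 * ?c * cmod (f x) + ?c\<^sup>2 \<partial>\<mu>)"
    by (simp add: power2_diff algebra_simps)
  also have "\<dots> = (\<integral>x. (cmod (f x))\<^sup>2 \<partial>\<mu>) - 2 * ?c * ?c + ?c\<^sup>2"
    using f2 fi one by simp
  finally have "?c\<^sup>2 \<le> (\<integral>x. (cmod (f x))\<^sup>2 \<partial>\<mu>)" by (simp add: power2_eq_square)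
  moreover have "(cmod (\<integral>x. f x \<partial>\<mu>))\<^sup>2 \<le> ?c\<^sup>2"
    using integral_norm_bound[of \<mu> f] by (intro power_mono) auto
  ultimately show "(cmod (\<integral>x. f x \<partial>\<mu>))\<^sup>2 \<le> (\<integral>x. (cmod (f x))\<^sup>2 \<partial>\<mu>)" by linarith
qed

lemma integrable_bounded_times:
  fixes f g :: "'a \<Rightarrow> complex"
  assumes "integrable \<mu> g" "f \<in> borel_measurable \<mu>" "\<And>x. x \<in> space \<mu> \<Longrightarrow> cmod (f x) \<le> C"
  shows "integrable \<mu> (\<lambda>x. f x * g x)"
proof (rule Bochner_Integration.integrable_bound)
  show "integrable \<mu> (\<lambda>x. complex_of_real C * g x)" using assms by simp
  show "(\<lambda>x. f x * g x) \<in> borel_measurable \<mu>" using assms by simp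
  have "C \<ge> 0 \<or> space \<mu> = {}" using assms(3) norm_ge_zero order_trans by blast
  then show "AE x in \<mu>. norm (f x * g x) \<le> norm (complex_of_real C * g x)"
    using assms(3) by (intro AE_I2) (auto simp: norm_mult intro!: mult_right_mono)
qed

locale staircase_params =
  fixes N M p :: nat
  assumes M_pos: "M > 0" and p_pos: "p > 0"
begin

abbreviation Q :: "pt measure" where "Q \<equiv> Qm {..<N}"
abbreviation stair :: "nat set \<Rightarrow> mfun \<Rightarrow> bool" where "stair \<equiv> staircase_mat p N M"
abbreviation op_equiv :: "oper \<Rightarrow> oper \<Rightarrow> bool" (infix "\<triangleq>" 50) where "F \<triangleq> G \<equiv> op_eq N M F G"
abbreviation ae_equiv :: "vfun \<Rightarrow> vfun \<Rightarrow> bool" (infix "\<doteq>" 50) where "u \<doteq> v \<equiv> ae_eq N M u v"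

section \<open>Merged points, kernels and boundedness on L2\<close>

lemma fin_sub: "\<alpha> \<subseteq> {..<N} \<Longrightarrow> finite \<alpha>"
  by (rule finite_subset) auto

lemma merge_measurable:
  assumes "\<alpha> \<subseteq> {..<N}" "f \<in> borel_measurable Q"
  shows "(\<lambda>(k, x). f (merge \<alpha> k x)) \<in> borel_measurable (Q \<Otimes>\<^sub>M Qm \<alpha>)"
  using measurable_compose[OF measurable_merge_Qm[of \<alpha> "{..<N}"], of f borel] assms
  by (simp add: Un_absorb2 split_def)

lemma distr_merge_Q:
  assumes "\<alpha> \<subseteq> {..<N}"
  shows "distr (Q \<Otimes>\<^sub>M Qm \<alpha>) Q (\<lambda>(k, x). merge \<alpha> k x) = Q"
  using distr_merge_Qm[of "{..<N}" \<alpha>] assms by (simp add: Un_absorb2 fin_sub)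

lemma measurable_merge_Q:
  assumes "\<alpha> \<subseteq> {..<N}"
  shows "(\<lambda>(k, x). merge \<alpha> k x) \<in> Q \<Otimes>\<^sub>M Qm \<alpha> \<rightarrow>\<^sub>M Q"
  using measurable_merge_Qm[of \<alpha> "{..<N}"] assms by (simp add: Un_absorb2)

text \<open>\<open>merge\<close> transports the product measure to \<open>Q\<close>, so preimages of
  null sets are null. This is why the integral operators respect almost everywhere equality.\<close>

lemma AE_merge:
  assumes "\<alpha> \<subseteq> {..<N}" "AE k in Q. P k"
  shows "AE k in Q. AE x in Qm \<alpha>. P (merge \<alpha> k x)"
proof -
  interpret pair_sigma_finite Q "Qm \<alpha>" using assms by (intro pair_sigma_finite_Qm fin_sub) auto
  have "AE z in Q \<Otimes>\<^sub>M Qm \<alpha>. P ((\<lambda>(k, x). merge \<alpha> k x) z)"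
    using assms by (intro AE_distrD[OF measurable_merge_Q]) (simp_all only: distr_merge_Q)
  from AE_pair[OF this] show ?thesis by simp
qed

text \<open>Fubini on the product, combined with the fact that \<open>merge\<close> transports the
  product measure to \<open>Q\<close>.\<close>

lemma integral_merge:
  fixes f :: "pt \<Rightarrow> 'b::{banach, second_countable_topology}"
  assumes \<alpha>: "\<alpha> \<subseteq> {..<N}" and f: "integrable Q f"
  shows "AE k in Q. integrable (Qm \<alpha>) (\<lambda>x. f (merge \<alpha> k x))"
    "integrable Q (\<lambda>k. \<integral>x. f (merge \<alpha> k x) \<partial>Qm \<alpha>)"
    "(\<integral>k. (\<integral>x. f (merge \<alpha> k x) \<partial>Qm \<alpha>) \<partial>Q) = (\<integral>k. f k \<partial>Q)"
proof -
  interpret pair_sigma_finite Q "Qm \<alpha>" using \<alpha> by (intro pair_sigma_finite_Qm fin_sub) auto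
  have int: "integrable (Q \<Otimes>\<^sub>M Qm \<alpha>) (\<lambda>z. f ((\<lambda>(k, x). merge \<alpha> k x) z))"
    using f \<alpha> by (subst integrable_distr_eq[symmetric, OF measurable_merge_Q]) (auto simp: distr_merge_Q)
  have eq: "(\<integral>z. f ((\<lambda>(k, x). merge \<alpha> k x) z) \<partial>(Q \<Otimes>\<^sub>M Qm \<alpha>)) = (\<integral>k. f k \<partial>Q)"
    using f \<alpha> by (subst integral_distr[symmetric, OF measurable_merge_Q]) (auto simp: distr_merge_Q)
  show "AE k in Q. integrable (Qm \<alpha>) (\<lambda>x. f (merge \<alpha> k x))" using AE_integrable_fst'[OF int] by simp
  show "integrable Q (\<lambda>k. \<integral>x. f (merge \<alpha> k x) \<partial>Qm \<alpha>)" using integrable_fst'[OF int] by simp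
  show "(\<integral>k. (\<integral>x. f (merge \<alpha> k x) \<partial>Qm \<alpha>) \<partial>Q) = (\<integral>k. f k \<partial>Q)"
    using integral_fst'[OF int] eq by simp
qed

lemma L2_measurable: "u \<in> L2 N M \<Longrightarrow> j < M \<Longrightarrow> (\<lambda>k. u k j) \<in> borel_measurable Q"
  by (simp add: L2_def)

lemma L2_square_integrable: "u \<in> L2 N M \<Longrightarrow> j < M \<Longrightarrow> integrable Q (\<lambda>k. (cmod (u k j))\<^sup>2)"
  by (simp add: L2_def)

lemma L2_integrable: "u \<in> L2 N M \<Longrightarrow> j < M \<Longrightarrow> integrable Q (\<lambda>k. u k j)"
  by (intro norm_integral_squared_le finite_measure_Qm measure_space_Qm L2_measurable L2_square_integrable) auto

lemma stair_bounded:
  assumes "stair \<alpha> A" "finite \<alpha>"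
  obtains C where "C \<ge> 0" "\<And>k x i j. k \<in> box {..<N} \<Longrightarrow> x \<in> box \<alpha> \<Longrightarrow> i < M \<Longrightarrow> j < M \<Longrightarrow> cmod (A k x i j) \<le> C"
proof -
  have "\<exists>C\<ge>0. \<forall>k\<in>box {..<N}. \<forall>x\<in>box \<alpha>. cmod (A k x i j) \<le> C" if "i < M" "j < M" for i j
    using assms p_pos that by (intro staircase_fn_bounded) (auto simp: staircase_mat_def)
  then obtain C where C: "\<And>i j. i < M \<Longrightarrow> j < M \<Longrightarrow> C i j \<ge> 0 \<and> (\<forall>k\<in>box {..<N}. \<forall>x\<in>box \<alpha>. cmod (A k x i j) \<le> C i j)"
    by metis
  let ?C = "\<Sum>(i, j)\<in>{..<M} \<times> {..<M}. C i j"
  have le: "C i j \<le> ?C" if "i < M" "j < M" for i j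
    using member_le_sum[of "(i, j)" "{..<M} \<times> {..<M}" "\<lambda>(i, j). C i j"] that C by auto
  show ?thesis
  proof (rule that)
    show "?C \<ge> 0" using C by (intro sum_nonneg) auto
    show "cmod (A k x i j) \<le> ?C" if "k \<in> box {..<N}" "x \<in> box \<alpha>" "i < M" "j < M" for k x i j
      using le[OF that(3,4)] C[OF that(3,4)] that(1,2) by force
  qed
qed

lemma stair_measurable:
  assumes "stair \<alpha> A" "i < M" "j < M"
  shows "(\<lambda>(k, x). A k x i j) \<in> borel_measurable (Q \<Otimes>\<^sub>M Qm \<alpha>)"
  using assms by (intro staircase_fn_measurable) (auto simp: staircase_mat_def)

lemma stair_measurable2:
  assumes "stair \<alpha> A" "i < M" "j < M" "k \<in> space Q"
  shows "(\<lambda>x. A k x i j) \<in> borel_measurable (Qm \<alpha>)"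
  using measurable_compose[OF measurable_Pair1'[OF assms(4)] stair_measurable[OF assms(1-3)]] by simp

lemma merge_measurable2:
  assumes "\<alpha> \<subseteq> {..<N}" "f \<in> borel_measurable Q" "k \<in> space Q"
  shows "(\<lambda>x. f (merge \<alpha> k x)) \<in> borel_measurable (Qm \<alpha>)"
  using measurable_compose[OF measurable_Pair1'[OF assms(3)] merge_measurable[OF assms(1,2)]] by simp

lemma opA_integrable:
  assumes "\<alpha> \<subseteq> {..<N}" "stair \<alpha> A" "u \<in> L2 N M"
  shows "AE k in Q. \<forall>i<M. \<forall>j<M. integrable (Qm \<alpha>) (\<lambda>x. A k x i j * u (merge \<alpha> k x) j)"
proof -
  obtain C where C: "\<And>k x i j. k \<in> box {..<N} \<Longrightarrow> x \<in> box \<alpha> \<Longrightarrow> i < M \<Longrightarrow> j < M \<Longrightarrow> cmod (A k x i j) \<le> C"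
    using stair_bounded assms fin_sub by metis
  have "AE k in Q. \<forall>j\<in>{..<M}. integrable (Qm \<alpha>) (\<lambda>x. u (merge \<alpha> k x) j)"
    using assms by (intro AE_finite_allI integral_merge(1)[of \<alpha> "\<lambda>k. u k j" for j] L2_integrable) auto
  with AE_space show ?thesis
  proof eventually_elim
    case (elim k)
    then show ?case
      using assms C space_Qm_subset_box[of k "{..<N}"] space_Qm_subset_box[of _ \<alpha>]
      by (intro allI impI integrable_bounded_times[where C = C] stair_measurable2) auto
  qed
qed

lemma opA_measurable:
  assumes "\<alpha> \<subseteq> {..<N}" "stair \<alpha> A" "u \<in> L2 N M"
  shows "(\<lambda>k. opA N M \<alpha> A u k i) \<in> borel_measurable Q"
proof -
  interpret finite_measure "Qm \<alpha>" using assms by (intro finite_measure_Qm fin_sub)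
  have "(\<lambda>z. A (fst z) (snd z) i j * u (merge \<alpha> (fst z) (snd z)) j) \<in> borel_measurable (Q \<Otimes>\<^sub>M Qm \<alpha>)"
    if "i < M" "j < M" for j
    using stair_measurable[OF assms(2) that] merge_measurable[OF assms(1) L2_measurable[OF assms(3) that(2)]]
    by (intro borel_measurable_times) (simp_all add: split_def)
  then have "(\<lambda>z. \<Sum>j<M. A (fst z) (snd z) i j * u (merge \<alpha> (fst z) (snd z)) j) \<in> borel_measurable (Q \<Otimes>\<^sub>M Qm \<alpha>)"
    if "i < M" using that by (intro borel_measurable_sum) auto
  then show ?thesis
    unfolding opA_def
    by (cases "i < M") (auto intro!: borel_measurable_lebesgue_integral simp: split_def)
qed

lemma norm2_squared: "(norm2 N M u)\<^sup>2 = (\<Sum>j<M. \<integral>k. (cmod (u k j))\<^sup>2 \<partial>Q)"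
  unfolding norm2_def by (rule real_sqrt_pow2) (auto intro: sum_nonneg)

lemma norm2_nonneg: "norm2 N M u \<ge> 0"
  unfolding norm2_def by (auto intro: sum_nonneg)

text \<open>Cauchy-Schwarz is applied twice, over the \<open>M\<close> vector components and over
  the integration variables. The remaining double integral of the squared length of \<open>u\<close>
  is its integral over \<open>Q\<close> by \<open>integral_merge\<close>.\<close>

lemma opA_square_bound:
  assumes "\<alpha> \<subseteq> {..<N}" "stair \<alpha> A"
  obtains K where "K \<ge> 0" "\<And>u i. u \<in> L2 N M \<Longrightarrow> i < M \<Longrightarrow> integrable Q (\<lambda>k. (cmod (opA N M \<alpha> A u k i))\<^sup>2)"
    "\<And>u i. u \<in> L2 N M \<Longrightarrow> i < M \<Longrightarrow> (\<integral>k. (cmod (opA N M \<alpha> A u k i))\<^sup>2 \<partial>Q) \<le> K * (norm2 N M u)\<^sup>2"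
proof -
  have fin\<alpha>: "finite \<alpha>" using assms by (intro fin_sub)
  obtain C where C0: "C \<ge> 0" and C: "\<And>k x i j. k \<in> box {..<N} \<Longrightarrow> x \<in> box \<alpha> \<Longrightarrow> i < M \<Longrightarrow> j < M \<Longrightarrow> cmod (A k x i j) \<le> C"
    using stair_bounded assms fin\<alpha> by metis
  \<comment> \<open>\<open>C\<close> bounds the entries of the kernel; the factor \<open>M\<close>
    is the price of squaring a sum of \<open>M\<close> terms.\<close>
  define K where "K = C\<^sup>2 * M"
  have main: "integrable Q (\<lambda>k. (cmod (opA N M \<alpha> A u k i))\<^sup>2) \<and>
    (\<integral>k. (cmod (opA N M \<alpha> A u k i))\<^sup>2 \<partial>Q) \<le> K * (norm2 N M u)\<^sup>2" if u: "u \<in> L2 N M" and i: "i < M" for u i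
  proof -
    define s where "s k = (\<Sum>j<M. (cmod (u k j))\<^sup>2)" for k
    have s: "integrable Q s" unfolding s_def using u by (intro Bochner_Integration.integrable_sum L2_square_integrable) auto
    have sn: "(\<integral>k. s k \<partial>Q) = (norm2 N M u)\<^sup>2"
      unfolding s_def norm2_squared using u by (intro Bochner_Integration.integral_sum L2_square_integrable) auto
    define g where "g k x = (\<Sum>j<M. A k x i j * u (merge \<alpha> k x) j)" for k x
    have gs: "(cmod (g k x))\<^sup>2 \<le> K * s (merge \<alpha> k x)" if "k \<in> space Q" "x \<in> space (Qm \<alpha>)" for k x
    proof -
      have "cmod (g k x) \<le> (\<Sum>j<M. cmod (A k x i j * u (merge \<alpha> k x) j))"
        unfolding g_def by (rule norm_sum)
      also have "\<dots> \<le> (\<Sum>j<M. C * cmod (u (merge \<alpha> k x) j))"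
        using C i that space_Qm_subset_box by (intro sum_mono) (auto simp: norm_mult intro!: mult_right_mono)
      finally have "(cmod (g k x))\<^sup>2 \<le> (\<Sum>j<M. C * cmod (u (merge \<alpha> k x) j))\<^sup>2"
        by (intro power_mono) auto
      also have "\<dots> \<le> (\<Sum>j<M. (C * cmod (u (merge \<alpha> k x) j))\<^sup>2) * card {..<M}"
        by (rule sum_squared_le_sum_of_squares)
      also have "\<dots> = K * s (merge \<alpha> k x)"
        by (simp add: K_def s_def power_mult_distrib sum_distrib_left sum_distrib_right algebra_simps)
      finally show ?thesis .
    qed
    have gm: "g k \<in> borel_measurable (Qm \<alpha>)" if "k \<in> space Q" for k
      unfolding g_def using that assms u i
      by (intro borel_measurable_sum borel_measurable_times stair_measurable2
            merge_measurable2[of \<alpha> "\<lambda>k. u k j" for j] L2_measurable) auto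
    have opg: "opA N M \<alpha> A u k i = (\<integral>x. g k x \<partial>Qm \<alpha>)" for k
      using i by (simp add: opA_def g_def)
    note S = integral_merge[OF assms(1) s]
    have le: "AE k in Q. (cmod (opA N M \<alpha> A u k i))\<^sup>2 \<le> K * (\<integral>x. s (merge \<alpha> k x) \<partial>Qm \<alpha>)"
      using AE_space S(1)
    proof eventually_elim
      case (elim k)
      have int: "integrable (Qm \<alpha>) (\<lambda>x. (cmod (g k x))\<^sup>2)"
      proof (rule Bochner_Integration.integrable_bound)
        show "integrable (Qm \<alpha>) (\<lambda>x. K * s (merge \<alpha> k x))" using elim by simp
        show "(\<lambda>x. (cmod (g k x))\<^sup>2) \<in> borel_measurable (Qm \<alpha>)" using gm[OF elim(1)] by simp
        show "AE x in Qm \<alpha>. norm ((cmod (g k x))\<^sup>2) \<le> norm (K * s (merge \<alpha> k x))"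
          using gs[OF elim(1)] by (intro AE_I2) (auto intro!: order_trans[OF _ abs_ge_self])
      qed
      have "(cmod (\<integral>x. g k x \<partial>Qm \<alpha>))\<^sup>2 \<le> (\<integral>x. (cmod (g k x))\<^sup>2 \<partial>Qm \<alpha>)"
        by (intro norm_integral_squared_le finite_measure_Qm measure_space_Qm fin\<alpha> gm elim int)
      also have "\<dots> \<le> (\<integral>x. K * s (merge \<alpha> k x) \<partial>Qm \<alpha>)"
        using int elim gs by (intro integral_mono) auto
      finally show ?case by (simp add: opg)
    qed
    have int: "integrable Q (\<lambda>k. (cmod (opA N M \<alpha> A u k i))\<^sup>2)"
    proof (rule Bochner_Integration.integrable_bound)
      show "integrable Q (\<lambda>k. K * (\<integral>x. s (merge \<alpha> k x) \<partial>Qm \<alpha>))" using S(2) by simp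
      show "(\<lambda>k. (cmod (opA N M \<alpha> A u k i))\<^sup>2) \<in> borel_measurable Q"
        using opA_measurable[OF assms u] by simp
      show "AE k in Q. norm ((cmod (opA N M \<alpha> A u k i))\<^sup>2) \<le> norm (K * (\<integral>x. s (merge \<alpha> k x) \<partial>Qm \<alpha>))"
        using le by eventually_elim auto
    qed
    have "(\<integral>k. (cmod (opA N M \<alpha> A u k i))\<^sup>2 \<partial>Q) \<le> (\<integral>k. K * (\<integral>x. s (merge \<alpha> k x) \<partial>Qm \<alpha>) \<partial>Q)"
      using int S(2) le by (intro integral_mono_AE) auto
    then show ?thesis using int S(3) sn by simp
  qed
  show ?thesis by (rule that[of K]) (use main C0 in \<open>auto simp: K_def\<close>)
qed

lemma opA_L2:
  assumes "\<alpha> \<subseteq> {..<N}" "stair \<alpha> A" "u \<in> L2 N M"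
  shows "opA N M \<alpha> A u \<in> L2 N M"
proof -
  obtain K where "\<And>i. i < M \<Longrightarrow> integrable Q (\<lambda>k. (cmod (opA N M \<alpha> A u k i))\<^sup>2)"
    using opA_square_bound[OF assms(1,2)] assms(3) by metis
  then show ?thesis using opA_measurable[OF assms] by (simp add: L2_def)
qed

lemma opA_cong_AE:
  assumes "\<alpha> \<subseteq> {..<N}" "stair \<alpha> A" "u \<in> L2 N M" "v \<in> L2 N M" "u \<doteq> v"
  shows "opA N M \<alpha> A u \<doteq> opA N M \<alpha> A v"
proof -
  have "AE k in Q. AE x in Qm \<alpha>. \<forall>j<M. u (merge \<alpha> k x) j = v (merge \<alpha> k x) j"
    using AE_merge[OF assms(1)] assms(5) unfolding ae_eq_def by blast
  with AE_space show ?thesis unfolding ae_eq_def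
  proof eventually_elim
    case (elim k)
    have m: "(\<lambda>x. \<Sum>j<M. A k x i j * w (merge \<alpha> k x) j) \<in> borel_measurable (Qm \<alpha>)" if "w \<in> L2 N M" "i < M" for w i
      using that assms elim
      by (intro borel_measurable_sum borel_measurable_times stair_measurable2
            merge_measurable2[of \<alpha> "\<lambda>k. w k j" for j] L2_measurable) auto
    have "(\<integral>x. (\<Sum>j<M. A k x i j * u (merge \<alpha> k x) j) \<partial>Qm \<alpha>) = (\<integral>x. (\<Sum>j<M. A k x i j * v (merge \<alpha> k x) j) \<partial>Qm \<alpha>)"
      if "i < M" for i
      using elim(2) by (intro integral_cong_AE m assms that) auto
    then show ?case by (auto simp: opA_def)
  qed
qed

lemma integral_sum_add_scaled:
  fixes f g :: "nat \<Rightarrow> 'a \<Rightarrow> complex"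
  assumes "\<And>j. j < M \<Longrightarrow> integrable \<mu> (f j)" "\<And>j. j < M \<Longrightarrow> integrable \<mu> (g j)"
  shows "(\<integral>x. (\<Sum>j<M. f j x + c * g j x) \<partial>\<mu>) = (\<integral>x. (\<Sum>j<M. f j x) \<partial>\<mu>) + c * (\<integral>x. (\<Sum>j<M. g j x) \<partial>\<mu>)"
proof -
  have "(\<integral>x. (\<Sum>j<M. f j x) + c * (\<Sum>j<M. g j x) \<partial>\<mu>) = (\<integral>x. (\<Sum>j<M. f j x) \<partial>\<mu>) + (\<integral>x. c * (\<Sum>j<M. g j x) \<partial>\<mu>)"
    using assms by (intro Bochner_Integration.integral_add integrable_mult_right Bochner_Integration.integrable_sum) auto
  then show ?thesis by (simp add: sum.distrib sum_distrib_left[symmetric])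
qed

lemma opA_linear:
  assumes "\<alpha> \<subseteq> {..<N}" "stair \<alpha> A" "u \<in> L2 N M" "v \<in> L2 N M"
  shows "opA N M \<alpha> A (\<lambda>k j. u k j + c * v k j) \<doteq> (\<lambda>k j. opA N M \<alpha> A u k j + c * opA N M \<alpha> A v k j)"
  using opA_integrable[OF assms(1,2,3)] opA_integrable[OF assms(1,2,4)] unfolding ae_eq_def
proof eventually_elim
  case (elim k)
  show ?case
    using integral_sum_add_scaled[of "Qm \<alpha>" "\<lambda>j x. A k x i j * u (merge \<alpha> k x) j" "\<lambda>j x. A k x i j * v (merge \<alpha> k x) j" c for i] elim
    by (simp add: opA_def distrib_left mult.left_commute)
qed

lemma opA_coeff_linear:
  assumes "\<alpha> \<subseteq> {..<N}" "stair \<alpha> A" "stair \<alpha> B" "u \<in> L2 N M"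
  shows "opA N M \<alpha> (\<lambda>k x i j. A k x i j + c * B k x i j) u \<doteq> (\<lambda>k j. opA N M \<alpha> A u k j + c * opA N M \<alpha> B u k j)"
  using opA_integrable[OF assms(1,2,4)] opA_integrable[OF assms(1,3,4)] unfolding ae_eq_def
proof eventually_elim
  case (elim k)
  show ?case
    using integral_sum_add_scaled[of "Qm \<alpha>" "\<lambda>j x. A k x i j * u (merge \<alpha> k x) j" "\<lambda>j x. B k x i j * u (merge \<alpha> k x) j" c for i] elim
    by (simp add: opA_def distrib_right mult.assoc)
qed

lemma opA_cong_box:
  assumes "\<And>k x i j. k \<in> box {..<N} \<Longrightarrow> x \<in> box \<alpha> \<Longrightarrow> i < M \<Longrightarrow> j < M \<Longrightarrow> A k x i j = B k x i j" "k \<in> space Q"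
  shows "opA N M \<alpha> A u k i = opA N M \<alpha> B u k i"
  unfolding opA_def using assms space_Qm_subset_box
  by (auto intro!: Bochner_Integration.integral_cong sum.cong)

end

section \<open>Composition of integral operators\<close>

text \<open>The factor \<open>g\<close> sees \<open>x\<close> only through
  \<open>merge \<beta> x y\<close>, where its coordinates in
  \<open>\<alpha> \<inter> \<beta>\<close> have been overwritten by \<open>y\<close>. These
  coordinates can therefore be averaged out of \<open>D\<close> alone. In \<open>E\<close> they are
  the variable \<open>w\<close>, while \<open>z\<close> carries the surviving coordinates of
  \<open>x\<close> and all of \<open>y\<close>.\<close>

lemma integral_collapse:
  fixes D :: "pt \<Rightarrow> pt \<Rightarrow> complex" and g :: "pt \<Rightarrow> complex"
  assumes fin: "finite \<alpha>" "finite \<beta>"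
    and D: "(\<lambda>(x, y). D x y) \<in> borel_measurable (Qm \<alpha> \<Otimes>\<^sub>M Qm \<beta>)"
    and bnd: "\<And>x y. x \<in> space (Qm \<alpha>) \<Longrightarrow> y \<in> space (Qm \<beta>) \<Longrightarrow> cmod (D x y) \<le> C"
    and g: "integrable (Qm (\<alpha> \<union> \<beta>)) g"
  defines "E \<equiv> \<lambda>z. \<integral>w. D (restrict (merge (\<alpha> \<inter> \<beta>) z w) \<alpha>) (restrict z \<beta>) \<partial>Qm (\<alpha> \<inter> \<beta>)"
  shows "integrable (Qm \<alpha> \<Otimes>\<^sub>M Qm \<beta>) (\<lambda>(x, y). D x y * g (merge \<beta> x y))"
    and "integrable (Qm (\<alpha> \<union> \<beta>)) (\<lambda>z. E z * g z)"
    and "(\<integral>x. (\<integral>y. D x y * g (merge \<beta> x y) \<partial>Qm \<beta>) \<partial>Qm \<alpha>) = (\<integral>z. E z * g z \<partial>Qm (\<alpha> \<union> \<beta>))"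
proof -
  let ?\<gamma> = "\<alpha> \<union> \<beta>" and ?\<delta> = "\<alpha> \<inter> \<beta>"
  interpret AB: pair_sigma_finite "Qm \<alpha>" "Qm \<beta>" using fin by (rule pair_sigma_finite_Qm)
  interpret AD: pair_sigma_finite "Qm \<alpha>" "Qm ?\<delta>" using fin by (intro pair_sigma_finite_Qm) auto
  interpret fD: finite_measure "Qm ?\<delta>" using fin by (intro finite_measure_Qm) auto
  note m\<beta> = measurable_merge_Qm[of \<beta> \<alpha>] and d\<beta> = distr_merge_Qm[OF fin]
  have Un: "\<alpha> \<union> ?\<delta> = \<alpha>" "?\<gamma> \<union> ?\<delta> = ?\<gamma>" by auto
  have m\<delta>: "(\<lambda>(x, y). merge ?\<delta> x y) \<in> Qm \<alpha> \<Otimes>\<^sub>M Qm ?\<delta> \<rightarrow>\<^sub>M Qm \<alpha>"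
    using measurable_merge_Qm[of ?\<delta> \<alpha>] unfolding Un .
  have d\<delta>: "distr (Qm \<alpha> \<Otimes>\<^sub>M Qm ?\<delta>) (Qm \<alpha>) (\<lambda>(x, y). merge ?\<delta> x y) = Qm \<alpha>"
    using distr_merge_Qm[of \<alpha> ?\<delta>] fin unfolding Un by simp
  have pull: "integrable (Qm \<alpha> \<Otimes>\<^sub>M Qm \<beta>) (\<lambda>(x, y). f (merge \<beta> x y)) \<and>
     (\<integral>y. (\<integral>x. f (merge \<beta> x y) \<partial>Qm \<alpha>) \<partial>Qm \<beta>) = (\<integral>z. f z \<partial>Qm ?\<gamma>)"
    if f: "integrable (Qm ?\<gamma>) f" for f :: "pt \<Rightarrow> complex"
  proof -
    have int: "integrable (Qm \<alpha> \<Otimes>\<^sub>M Qm \<beta>) (\<lambda>z. f ((\<lambda>(x, y). merge \<beta> x y) z))"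
      using f by (subst integrable_distr_eq[symmetric, OF m\<beta>]) (auto simp: d\<beta>)
    have "(\<integral>z. f ((\<lambda>(x, y). merge \<beta> x y) z) \<partial>(Qm \<alpha> \<Otimes>\<^sub>M Qm \<beta>)) = (\<integral>z. f z \<partial>Qm ?\<gamma>)"
      using f by (subst integral_distr[symmetric, OF m\<beta>]) (auto simp: d\<beta>)
    with int AB.integral_snd[of "\<lambda>x y. f (merge \<beta> x y)"] show ?thesis by (simp add: split_def)
  qed
  have "integrable (Qm \<alpha> \<Otimes>\<^sub>M Qm \<beta>) (\<lambda>z. (case z of (x, y) \<Rightarrow> D x y) * (case z of (x, y) \<Rightarrow> g (merge \<beta> x y)))"
    using pull[OF g] D bnd by (intro integrable_bounded_times[where C = C]) (auto simp: space_pair_measure)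
  then show int: "integrable (Qm \<alpha> \<Otimes>\<^sub>M Qm \<beta>) (\<lambda>(x, y). D x y * g (merge \<beta> x y))"
    by (simp add: split_def)
  have inS: "restrict (merge ?\<delta> z w) \<alpha> \<in> space (Qm \<alpha>)" "restrict z \<beta> \<in> space (Qm \<beta>)"
    if "z \<in> space (Qm ?\<gamma>)" "w \<in> space (Qm ?\<delta>)" for z w
    using that by (auto simp: space_Qm merge_def PiE_iff)
  have E: "E \<in> borel_measurable (Qm ?\<gamma>)"
  proof -
    have "(\<lambda>(z, w). merge ?\<delta> z w) \<in> Qm ?\<gamma> \<Otimes>\<^sub>M Qm ?\<delta> \<rightarrow>\<^sub>M Qm ?\<gamma>"
      using measurable_merge_Qm[of ?\<delta> ?\<gamma>] unfolding Un .
    then have "(\<lambda>z. restrict ((\<lambda>(z, w). merge ?\<delta> z w) z) \<alpha>) \<in> Qm ?\<gamma> \<Otimes>\<^sub>M Qm ?\<delta> \<rightarrow>\<^sub>M Qm \<alpha>"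
      by (rule measurable_compose) (unfold Qm_def, rule measurable_restrict_subset, auto)
    moreover have "(\<lambda>z. restrict (fst z) \<beta>) \<in> Qm ?\<gamma> \<Otimes>\<^sub>M Qm ?\<delta> \<rightarrow>\<^sub>M Qm \<beta>"
      by (rule measurable_compose[OF measurable_fst]) (unfold Qm_def, rule measurable_restrict_subset, auto)
    ultimately have "(\<lambda>z. (restrict ((\<lambda>(z, w). merge ?\<delta> z w) z) \<alpha>, restrict (fst z) \<beta>)) \<in>
        Qm ?\<gamma> \<Otimes>\<^sub>M Qm ?\<delta> \<rightarrow>\<^sub>M Qm \<alpha> \<Otimes>\<^sub>M Qm \<beta>" by (rule measurable_Pair)
    from measurable_compose[OF this D] show ?thesis
      unfolding E_def by (intro AD.M2.borel_measurable_lebesgue_integral) (simp add: split_def)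
  qed
  have Eb: "cmod (E z) \<le> C" if "z \<in> space (Qm ?\<gamma>)" for z
  proof -
    have "cmod (E z) \<le> (\<integral>w. cmod (D (restrict (merge ?\<delta> z w) \<alpha>) (restrict z \<beta>)) \<partial>Qm ?\<delta>)"
      unfolding E_def by (rule integral_norm_bound)
    also have "\<dots> \<le> (\<integral>w. C \<partial>Qm ?\<delta>)"
    proof (cases "integrable (Qm ?\<delta>) (\<lambda>w. cmod (D (restrict (merge ?\<delta> z w) \<alpha>) (restrict z \<beta>)))")
      case True
      then show ?thesis using inS that bnd by (intro integral_mono) auto
    next
      \<comment> \<open>A non-integrable function has Bochner integral 0, so it remains to see
        \<open>0 \<le> C\<close>. A bounded value exists because a space of total mass one is
        nonempty.\<close>
      case False
      obtain w where w: "w \<in> space (Qm ?\<delta>)" using emeasure_space_Qm[of ?\<delta>] fin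
        by (metis all_not_in_conv emeasure_empty finite_Int zero_neq_one)
      have "0 \<le> C" using bnd[OF inS[OF that w]] norm_ge_zero order_trans by blast
      then show ?thesis using False by (simp add: not_integrable_integral_eq)
    qed
    also have "\<dots> = C" using measure_space_Qm[of ?\<delta>] fin by simp
    finally show ?thesis .
  qed
  show intE: "integrable (Qm ?\<gamma>) (\<lambda>z. E z * g z)"
    by (rule integrable_bounded_times[OF g E Eb])
  have "(\<integral>x. (\<integral>y. D x y * g (merge \<beta> x y) \<partial>Qm \<beta>) \<partial>Qm \<alpha>) = (\<integral>y. (\<integral>x. D x y * g (merge \<beta> x y) \<partial>Qm \<alpha>) \<partial>Qm \<beta>)"
    using AB.Fubini_integral[OF int] by simp
  also have "\<dots> = (\<integral>y. (\<integral>x. E (merge \<beta> x y) * g (merge \<beta> x y) \<partial>Qm \<alpha>) \<partial>Qm \<beta>)"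
  proof (rule integral_cong_AE)
    show "(\<lambda>y. \<integral>x. D x y * g (merge \<beta> x y) \<partial>Qm \<alpha>) \<in> borel_measurable (Qm \<beta>)"
      using AB.integrable_snd[OF int] by auto
    show "(\<lambda>y. \<integral>x. E (merge \<beta> x y) * g (merge \<beta> x y) \<partial>Qm \<alpha>) \<in> borel_measurable (Qm \<beta>)"
      using AB.integrable_snd[of "\<lambda>x y. E (merge \<beta> x y) * g (merge \<beta> x y)"] pull[OF intE] by auto
    show "AE y in Qm \<beta>. (\<integral>x. D x y * g (merge \<beta> x y) \<partial>Qm \<alpha>) = (\<integral>x. E (merge \<beta> x y) * g (merge \<beta> x y) \<partial>Qm \<alpha>)"
      using AB.AE_integrable_snd[OF int] AE_space
    proof eventually_elim
      case (elim y)
      \<comment> \<open>With \<open>y\<close> fixed, redrawing the coordinates of \<open>x\<close>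
        in the intersection from an independent \<open>w\<close> preserves the measure of
        \<open>Qm \<alpha>\<close> and leaves the factor \<open>g\<close> unchanged.\<close>
      define \<phi> where "\<phi> x = D x y * g (merge \<beta> x y)" for x
      have \<phi>: "integrable (Qm \<alpha>) \<phi>" using elim by (simp add: \<phi>_def[abs_def])
      have i2: "integrable (Qm \<alpha> \<Otimes>\<^sub>M Qm ?\<delta>) (\<lambda>z. \<phi> ((\<lambda>(x, w). merge ?\<delta> x w) z))"
        using \<phi> by (subst integrable_distr_eq[symmetric, OF m\<delta>]) (auto simp: d\<delta>)
      have "(\<integral>x. \<phi> x \<partial>Qm \<alpha>) = (\<integral>z. \<phi> ((\<lambda>(x, w). merge ?\<delta> x w) z) \<partial>(Qm \<alpha> \<Otimes>\<^sub>M Qm ?\<delta>))"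
        using \<phi> by (subst integral_distr[symmetric, OF m\<delta>]) (auto simp: d\<delta>)
      also have "\<dots> = (\<integral>x. (\<integral>w. \<phi> (merge ?\<delta> x w) \<partial>Qm ?\<delta>) \<partial>Qm \<alpha>)"
        using AD.integral_fst'[OF i2] by simp
      also have "\<dots> = (\<integral>x. E (merge \<beta> x y) * g (merge \<beta> x y) \<partial>Qm \<alpha>)"
      proof (rule Bochner_Integration.integral_cong[OF refl])
        fix x assume x: "x \<in> space (Qm \<alpha>)"
        have "merge \<beta> (merge ?\<delta> x w) y = merge \<beta> x y" for w by (auto simp: merge_def fun_eq_iff)
        moreover have "restrict (merge ?\<delta> (merge \<beta> x y) w) \<alpha> = merge ?\<delta> x w" for w
          using x by (auto simp: merge_def fun_eq_iff space_Qm PiE_iff extensional_def)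
        moreover have "restrict (merge \<beta> x y) \<beta> = y"
          using elim by (auto simp: merge_def fun_eq_iff space_Qm PiE_iff extensional_def)
        ultimately show "(\<integral>w. \<phi> (merge ?\<delta> x w) \<partial>Qm ?\<delta>) = E (merge \<beta> x y) * g (merge \<beta> x y)"
          by (simp add: \<phi>_def E_def)
      qed
      finally show ?case by (simp add: \<phi>_def)
    qed
  qed
  also have "\<dots> = (\<integral>z. E z * g z \<partial>Qm ?\<gamma>)" using pull[OF intE] by simp
  finally show "(\<integral>x. (\<integral>y. D x y * g (merge \<beta> x y) \<partial>Qm \<beta>) \<partial>Qm \<alpha>) = (\<integral>z. E z * g z \<partial>Qm ?\<gamma>)" .
qed

context staircase_params
begin

text \<open>Kernel of the composite. Here \<open>z\<close> holds the variables that reach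
  \<open>u\<close>, and \<open>w\<close> the outer variables in
  \<open>\<alpha> \<inter> \<beta>\<close> that the inner operator replaces. The outer variable is
  thus \<open>merge (\<alpha> \<inter> \<beta>) z w\<close>, and the inner kernel sees it as part of
  its first argument.\<close>

definition comp_coeff :: "nat set \<Rightarrow> nat set \<Rightarrow> mfun \<Rightarrow> mfun \<Rightarrow> mfun" where
  "comp_coeff \<alpha> \<beta> A B k z i l = (\<integral>w. (\<Sum>j<M. A k (merge (\<alpha> \<inter> \<beta>) z w) i j *
      B (merge \<alpha> k (merge (\<alpha> \<inter> \<beta>) z w)) z j l) \<partial>Qm (\<alpha> \<inter> \<beta>))"

lemma stairD: "stair \<alpha> A \<Longrightarrow> i < M \<Longrightarrow> j < M \<Longrightarrow> staircase_fn p N \<alpha> (\<lambda>k x. A k x i j)"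
  by (simp add: staircase_mat_def)

lemma stair_cong:
  assumes "stair \<alpha> A" "finite \<alpha>" "i < M" "j < M"
    "k \<in> box {..<N}" "k' \<in> box {..<N}" "x \<in> box \<alpha>" "x' \<in> box \<alpha>"
    "\<And>i. i < N \<Longrightarrow> cell p (k i) = cell p (k' i)" "\<And>i. i \<in> \<alpha> \<Longrightarrow> cell p (x i) = cell p (x' i)"
  shows "A k x i j = A k' x' i j"
  using staircase_fn_cong[OF stairD[OF assms(1,3,4)] p_pos assms(2,5-)] .

lemma stair_comp_coeff:
  assumes "\<alpha> \<subseteq> {..<N}" "\<beta> \<subseteq> {..<N}" "stair \<alpha> A" "stair \<beta> B"
  shows "stair (\<alpha> \<union> \<beta>) (comp_coeff \<alpha> \<beta> A B)"
  unfolding staircase_mat_def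
proof (intro allI impI staircase_fnI)
  show "p > 0" by (rule p_pos)
  show "finite (\<alpha> \<union> \<beta>)" using assms by (auto simp: fin_sub)
  fix i l k k' x x' assume il: "i < M" "l < M"
    and b: "k \<in> box {..<N}" "k' \<in> box {..<N}" "x \<in> box (\<alpha> \<union> \<beta>)" "x' \<in> box (\<alpha> \<union> \<beta>)"
    and c: "\<And>i. i < N \<Longrightarrow> cell p (k i) = cell p (k' i)" "\<And>i. i \<in> \<alpha> \<union> \<beta> \<Longrightarrow> cell p (x i) = cell p (x' i)"
  show "comp_coeff \<alpha> \<beta> A B k x i l = comp_coeff \<alpha> \<beta> A B k' x' i l"
    unfolding comp_coeff_def
  proof (intro Bochner_Integration.integral_cong refl sum.cong arg_cong2[where f = "(*)"])
    fix w j assume "w \<in> space (Qm (\<alpha> \<inter> \<beta>))" and j: "j \<in> {..<M}"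
    then have w: "w \<in> box (\<alpha> \<inter> \<beta>)" by (simp add: space_Qm_subset_box)
    show "A k (merge (\<alpha> \<inter> \<beta>) x w) i j = A k' (merge (\<alpha> \<inter> \<beta>) x' w) i j"
      by (rule stair_cong[OF assms(3)]) (use assms(1) il j b c w in \<open>auto simp: fin_sub box_def merge_def\<close>)
    show "B (merge \<alpha> k (merge (\<alpha> \<inter> \<beta>) x w)) x j l = B (merge \<alpha> k' (merge (\<alpha> \<inter> \<beta>) x' w)) x' j l"
      by (rule stair_cong[OF assms(4)]) (use assms(1,2) il j b c w in \<open>auto simp: fin_sub box_def merge_def\<close>)
  qed
qed

text \<open>For almost every \<open>k\<close> the values of \<open>u\<close> are integrable in the
  merged variables, and then each component of \<open>u\<close> is one scalar instance of
  \<open>integral_collapse\<close>.\<close>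

lemma opA_comp:
  assumes \<alpha>: "\<alpha> \<subseteq> {..<N}" and \<beta>: "\<beta> \<subseteq> {..<N}" and A: "stair \<alpha> A" and B: "stair \<beta> B" and u: "u \<in> L2 N M"
  shows "opA N M \<alpha> A (opA N M \<beta> B u) \<doteq> opA N M (\<alpha> \<union> \<beta>) (comp_coeff \<alpha> \<beta> A B) u"
proof -
  let ?\<gamma> = "\<alpha> \<union> \<beta>"
  have \<gamma>: "?\<gamma> \<subseteq> {..<N}" using \<alpha> \<beta> by simp
  have fin: "finite \<alpha>" "finite \<beta>" using \<alpha> \<beta> by (auto simp: fin_sub)
  interpret AB: pair_sigma_finite "Qm \<alpha>" "Qm \<beta>" using fin by (rule pair_sigma_finite_Qm)
  obtain CA where CA: "CA \<ge> 0" "\<And>k x i j. k \<in> box {..<N} \<Longrightarrow> x \<in> box \<alpha> \<Longrightarrow> i < M \<Longrightarrow> j < M \<Longrightarrow> cmod (A k x i j) \<le> CA"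
    using stair_bounded[OF A fin(1)] by metis
  obtain CB where CB: "CB \<ge> 0" "\<And>k x i j. k \<in> box {..<N} \<Longrightarrow> x \<in> box \<beta> \<Longrightarrow> i < M \<Longrightarrow> j < M \<Longrightarrow> cmod (B k x i j) \<le> CB"
    using stair_bounded[OF B fin(2)] by metis
  have "AE k in Q. \<forall>j\<in>{..<M}. integrable (Qm ?\<gamma>) (\<lambda>x. u (merge ?\<gamma> k x) j)"
    using \<gamma> u by (intro AE_finite_allI integral_merge(1)[of ?\<gamma> "\<lambda>k. u k j" for j] L2_integrable) auto
  with AE_space show ?thesis unfolding ae_eq_def
  proof eventually_elim
    case (elim k)
    have kb: "k \<in> box {..<N}" using elim by (simp add: space_Qm_subset_box)
    define g where "g l z = u (merge ?\<gamma> k z) l" for l z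
    have g: "integrable (Qm ?\<gamma>) (g l)" if "l < M" for l using elim that by (simp add: g_def[abs_def])
    have mk: "(\<lambda>x. merge \<alpha> k x) \<in> Qm \<alpha> \<rightarrow>\<^sub>M Q"
      using measurable_compose[OF measurable_Pair1'[OF elim(1)] measurable_merge_Q[OF \<alpha>]] by simp
    have mkb: "merge \<alpha> k x \<in> box {..<N}" if "x \<in> space (Qm \<alpha>)" for x
      using that elim \<alpha> by (intro space_Qm_subset_box merge_in_space_subset)
    have Bm: "(\<lambda>z. B (merge \<alpha> k (fst z)) (snd z) j l) \<in> borel_measurable (Qm \<alpha> \<Otimes>\<^sub>M Qm \<beta>)"
      if "j < M" "l < M" for j l
    proof -
      have "(\<lambda>z. (merge \<alpha> k (fst z), snd z)) \<in> Qm \<alpha> \<Otimes>\<^sub>M Qm \<beta> \<rightarrow>\<^sub>M Q \<Otimes>\<^sub>M Qm \<beta>"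
        by (intro measurable_Pair measurable_compose[OF measurable_fst mk] measurable_snd)
      from measurable_compose[OF this stair_measurable[OF B that]] show ?thesis by simp
    qed
    have Am: "(\<lambda>z. A k (fst z) i j) \<in> borel_measurable (Qm \<alpha> \<Otimes>\<^sub>M Qm \<beta>)" if "i < M" "j < M" for i j
      by (rule measurable_compose[OF measurable_fst stair_measurable2[OF A that elim(1)]])
    have "opA N M \<alpha> A (opA N M \<beta> B u) k i = opA N M ?\<gamma> (comp_coeff \<alpha> \<beta> A B) u k i" if i: "i < M" for i
    proof -
      define Bg where "Bg j l x y = B (merge \<alpha> k x) y j l * g l (merge \<beta> x y)" for j l x y
      have Bgi: "integrable (Qm \<alpha> \<Otimes>\<^sub>M Qm \<beta>) (\<lambda>(x, y). Bg j l x y)" if "j < M" "l < M" for j l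
        unfolding Bg_def using Bm[OF that] CB that mkb space_Qm_subset_box
        by (intro integral_collapse(1)[OF fin _ _ g, of "\<lambda>x y. B (merge \<alpha> k x) y j l" CB])
          (auto simp: split_def)
      \<comment> \<open>The product of the kernels before integration, summed over the intermediate
        component \<open>j\<close>; \<open>l\<close> is the component of \<open>u\<close> that it
        multiplies.\<close>
      define D where "D l x y = (\<Sum>j<M. A k x i j * B (merge \<alpha> k x) y j l)" for l x y
      have Dm: "(\<lambda>(x, y). D l x y) \<in> borel_measurable (Qm \<alpha> \<Otimes>\<^sub>M Qm \<beta>)" if "l < M" for l
        unfolding D_def split_def using that i Am Bm by (intro borel_measurable_sum borel_measurable_times) auto
      have Db: "cmod (D l x y) \<le> M * (CA * CB)" if "l < M" "x \<in> space (Qm \<alpha>)" "y \<in> space (Qm \<beta>)" for l x y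
      proof -
        have "cmod (D l x y) \<le> (\<Sum>j<M. CA * CB)"
          unfolding D_def using that i kb mkb space_Qm_subset_box
          by (intro sum_norm_le) (auto simp: norm_mult intro!: mult_mono CA CB)
        then show ?thesis by simp
      qed
      define E where "E l z = (\<integral>w. D l (restrict (merge (\<alpha> \<inter> \<beta>) z w) \<alpha>) (restrict z \<beta>) \<partial>Qm (\<alpha> \<inter> \<beta>))" for l z
      note col = integral_collapse[OF fin Dm Db g, folded E_def]
      have E: "E l z = comp_coeff \<alpha> \<beta> A B k z i l" if l: "l < M" and "z \<in> space (Qm ?\<gamma>)" for l z
        unfolding E_def comp_coeff_def D_def
      proof (intro Bochner_Integration.integral_cong refl sum.cong arg_cong2[where f = "(*)"])
        fix w j assume "w \<in> space (Qm (\<alpha> \<inter> \<beta>))" and j: "j \<in> {..<M}"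
        then have w: "w \<in> box (\<alpha> \<inter> \<beta>)" by (simp add: space_Qm_subset_box)
        have z: "z \<in> box ?\<gamma>" using that by (simp add: space_Qm_subset_box)
        show "A k (restrict (merge (\<alpha> \<inter> \<beta>) z w) \<alpha>) i j = A k (merge (\<alpha> \<inter> \<beta>) z w) i j"
          by (rule stair_cong[OF A fin(1)]) (use i j kb z w in \<open>auto simp: box_def merge_def\<close>)
        show "B (merge \<alpha> k (restrict (merge (\<alpha> \<inter> \<beta>) z w) \<alpha>)) (restrict z \<beta>) j l =
            B (merge \<alpha> k (merge (\<alpha> \<inter> \<beta>) z w)) z j l"
          by (rule stair_cong[OF B fin(2)]) (use \<alpha> l j kb z w in \<open>auto simp: box_def merge_def\<close>)
      qed
      \<comment> \<open>Two successive substitutions amount to one on the union, in which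
        \<open>y\<close> has priority; this makes \<open>u\<close> a function of
        \<open>merge \<beta> x y\<close>.\<close>
      have mm: "merge \<beta> (merge \<alpha> k x) y = merge ?\<gamma> k (merge \<beta> x y)" for x y
        by (auto simp: merge_def fun_eq_iff)
      have inner: "opA N M \<beta> B u (merge \<alpha> k x) j = (\<integral>y. (\<Sum>l<M. Bg j l x y) \<partial>Qm \<beta>)" if "j < M" for x j
        using that by (simp add: opA_def mm Bg_def g_def)
      have "opA N M \<alpha> A (opA N M \<beta> B u) k i = (\<integral>x. (\<Sum>j<M. A k x i j * (\<integral>y. (\<Sum>l<M. Bg j l x y) \<partial>Qm \<beta>)) \<partial>Qm \<alpha>)"
        using i by (simp add: opA_def[of N M \<alpha>] inner)
      also have "\<dots> = (\<integral>x. (\<Sum>l<M. \<integral>y. D l x y * g l (merge \<beta> x y) \<partial>Qm \<beta>) \<partial>Qm \<alpha>)"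
      proof (rule integral_cong_AE)
        have B1: "(\<lambda>x. \<integral>y. (\<Sum>l<M. Bg j l x y) \<partial>Qm \<beta>) \<in> borel_measurable (Qm \<alpha>)" if "j < M" for j
        proof -
          have "integrable (Qm \<alpha> \<Otimes>\<^sub>M Qm \<beta>) (\<lambda>z. \<Sum>l<M. case z of (x, y) \<Rightarrow> Bg j l x y)"
            using Bgi that by (intro Bochner_Integration.integrable_sum) auto
          from AB.integrable_fst'[OF this] show ?thesis by auto
        qed
        then show "(\<lambda>x. \<Sum>j<M. A k x i j * (\<integral>y. (\<Sum>l<M. Bg j l x y) \<partial>Qm \<beta>)) \<in> borel_measurable (Qm \<alpha>)"
          using i stair_measurable2[OF A _ _ elim(1)] by (intro borel_measurable_sum borel_measurable_times) auto
        show "(\<lambda>x. \<Sum>l<M. \<integral>y. D l x y * g l (merge \<beta> x y) \<partial>Qm \<beta>) \<in> borel_measurable (Qm \<alpha>)"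
          using AB.integrable_fst'[OF col(1)] by (intro borel_measurable_sum) auto
        have ae: "AE x in Qm \<alpha>. \<forall>j\<in>{..<M}. \<forall>l\<in>{..<M}. integrable (Qm \<beta>) (\<lambda>y. Bg j l x y)"
          using AB.AE_integrable_fst'[OF Bgi] by (intro AE_finite_allI) auto
        show "AE x in Qm \<alpha>. (\<Sum>j<M. A k x i j * (\<integral>y. (\<Sum>l<M. Bg j l x y) \<partial>Qm \<beta>)) =
              (\<Sum>l<M. \<integral>y. D l x y * g l (merge \<beta> x y) \<partial>Qm \<beta>)"
          using ae
        proof eventually_elim
          case (elim x)
          have "(\<Sum>j<M. A k x i j * (\<integral>y. (\<Sum>l<M. Bg j l x y) \<partial>Qm \<beta>)) =
                (\<Sum>j<M. \<Sum>l<M. \<integral>y. A k x i j * Bg j l x y \<partial>Qm \<beta>)"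
            using elim by (intro sum.cong refl) (simp add: sum_distrib_left)
          also have "\<dots> = (\<Sum>l<M. \<Sum>j<M. \<integral>y. A k x i j * Bg j l x y \<partial>Qm \<beta>)" by (rule sum.swap)
          also have "\<dots> = (\<Sum>l<M. \<integral>y. (\<Sum>j<M. A k x i j * Bg j l x y) \<partial>Qm \<beta>)"
            using elim by (intro sum.cong refl Bochner_Integration.integral_sum[symmetric] integrable_mult_right) auto
          also have "\<dots> = (\<Sum>l<M. \<integral>y. D l x y * g l (merge \<beta> x y) \<partial>Qm \<beta>)"
            by (simp add: D_def Bg_def sum_distrib_right mult.assoc)
          finally show ?case .
        qed
      qed
      also have "\<dots> = (\<Sum>l<M. \<integral>x. (\<integral>y. D l x y * g l (merge \<beta> x y) \<partial>Qm \<beta>) \<partial>Qm \<alpha>)"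
        using AB.integrable_fst'[OF col(1)] by (intro Bochner_Integration.integral_sum) auto
      also have "\<dots> = (\<Sum>l<M. \<integral>z. E l z * g l z \<partial>Qm ?\<gamma>)"
        using col(3) by (intro sum.cong) auto
      also have "\<dots> = (\<integral>z. (\<Sum>l<M. E l z * g l z) \<partial>Qm ?\<gamma>)"
        using col(2) by (intro Bochner_Integration.integral_sum[symmetric]) auto
      also have "\<dots> = (\<integral>z. (\<Sum>l<M. comp_coeff \<alpha> \<beta> A B k z i l * g l z) \<partial>Qm ?\<gamma>)"
        using E by (intro Bochner_Integration.integral_cong sum.cong refl) auto
      also have "\<dots> = opA N M ?\<gamma> (comp_coeff \<alpha> \<beta> A B) u k i"
        using i by (simp add: opA_def g_def)
      finally show ?thesis .
    qed
    then show ?case by blast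
  qed
qed

end

section \<open>Uniqueness of the kernels\<close>

text \<open>\<open>b\<close> is the offset in units of the cell width: 0 selects the lower and 1/2
  the upper half of cell \<open>c\<close>. Each half has length
  \<open>1 / (2 * real p)\<close>.\<close>

definition half_cell :: "nat \<Rightarrow> real \<Rightarrow> nat \<Rightarrow> real set" where
  "half_cell p b c = {(real c + b) / real p ..< (real c + b + 1/2) / real p}"

lemma half_cell_facts:
  assumes "p > 0" "b = 0 \<or> b = 1/2" "t \<in> half_cell p b c"
  shows "cell p t = c" "real p * t - real c < 1/2 \<longleftrightarrow> b = 0"
proof -
  have t: "real c + b \<le> real p * t" "real p * t < real c + b + 1/2"
    using assms by (auto simp: half_cell_def field_simps)
  then have "\<lfloor>real p * t\<rfloor> = int c" using assms(2) by (subst floor_eq_iff) auto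
  then show "cell p t = c" by (simp add: cell_def)
  show "real p * t - real c < 1/2 \<longleftrightarrow> b = 0" using t assms(2) by auto
qed

lemma half_cell_subset:
  assumes "p > 0" "b = 0 \<or> b = 1/2" "c < p"
  shows "half_cell p b c \<subseteq> {0..<1}"
proof
  fix t assume "t \<in> half_cell p b c"
  then have "real c + b \<le> real p * t" "real p * t < real c + b + 1/2"
    using assms by (auto simp: half_cell_def field_simps)
  moreover have "real c + 1 \<le> real p" using assms by simp
  ultimately have "0 \<le> real p * t" "real p * t < real p * 1" using assms(2) by linarith+
  then have "0 \<le> t" "t < 1" using assms(1) by (auto simp: zero_le_mult_iff)
  then show "t \<in> {0..<1}" by simp
qed

lemma half_cell_sets:
  assumes "p > 0" "b = 0 \<or> b = 1/2" "c < p"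
  shows "half_cell p b c \<in> sets unitI"
  using half_cell_subset[OF assms]
  unfolding sets_unitI by (subst sets_restrict_space_iff) (auto simp: half_cell_def)

lemma emeasure_half_cell:
  assumes "p > 0" "b = 0 \<or> b = 1/2" "c < p"
  shows "emeasure unitI (half_cell p b c) = ennreal (1 / (2 * real p))"
proof -
  have "emeasure unitI (half_cell p b c) = emeasure lborel (half_cell p b c)"
    using half_cell_subset[OF assms] by (intro emeasure_unitI) (auto simp: half_cell_def)
  also have "\<dots> = ennreal ((real c + b + 1/2) / real p - (real c + b) / real p)"
    unfolding half_cell_def using assms(1) by (simp add: field_simps)
  also have "(real c + b + 1/2) / real p - (real c + b) / real p = 1 / (2 * real p)"
    using assms(1) by (simp add: field_simps)
  finally show ?thesis .
qed

lemma half_box: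
  assumes "p > 0" "finite I" "\<And>n. n \<in> I \<Longrightarrow> b n = 0 \<or> b n = 1/2" "\<And>n. n \<in> I \<Longrightarrow> c n < p"
  shows "PiE I (\<lambda>n. half_cell p (b n) (c n)) \<in> sets (Qm I)"
    "emeasure (Qm I) (PiE I (\<lambda>n. half_cell p (b n) (c n))) = ennreal ((1 / (2 * real p)) ^ card I)"
proof -
  note h = half_cell_sets[OF assms(1)] emeasure_half_cell[OF assms(1)]
  show "PiE I (\<lambda>n. half_cell p (b n) (c n)) \<in> sets (Qm I)"
    unfolding Qm_def using assms h by (intro sets_PiM_I_finite) auto
  have "emeasure (Qm I) (PiE I (\<lambda>n. half_cell p (b n) (c n))) = (\<Prod>n\<in>I. emeasure unitI (half_cell p (b n) (c n)))"
    unfolding Qm_def using assms h by (intro unitI_prod.emeasure_PiM) auto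
  also have "\<dots> = (\<Prod>n\<in>I. ennreal (1 / (2 * real p)))" using assms h by (intro prod.cong) auto
  also have "\<dots> = ennreal ((1 / (2 * real p)) ^ card I)" by (simp add: ennreal_power)
  finally show "emeasure (Qm I) (PiE I (\<lambda>n. half_cell p (b n) (c n))) = ennreal ((1 / (2 * real p)) ^ card I)" .
qed

context staircase_params
begin

text \<open>Tested on the indicator of a box of lower half cells, at points lying in upper half cells
  in the directions of \<open>\<gamma>\<close>, only the terms with \<open>\<alpha> \<supseteq> \<gamma>\<close> survive. Choosing \<open>\<gamma>\<close> maximal among the indices
  with nonzero coefficient leaves the single term \<open>\<alpha> = \<gamma>\<close>.\<close>

lemma opsum_eq_zero_imp:
  assumes st: "\<And>\<alpha>. \<alpha> \<subseteq> {..<N} \<Longrightarrow> stair \<alpha> (A \<alpha>)" and zero: "opsum N M A \<triangleq> zero_op"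
    and "\<gamma> \<subseteq> {..<N}" "k \<in> box {..<N}" "x \<in> box \<gamma>" "i < M" "j < M"
  shows "A \<gamma> k x i j = 0"
proof -
  define S where "S = {\<gamma> \<in> Pow {..<N}. \<exists>k\<in>box {..<N}. \<exists>x\<in>box \<gamma>. \<exists>i<M. \<exists>j<M. A \<gamma> k x i j \<noteq> 0}"
  have "S = {}"
  proof (rule ccontr)
    assume "S \<noteq> {}"
    moreover have "finite S" unfolding S_def by auto
    ultimately obtain \<gamma> where "\<gamma> \<in> S" and max: "\<And>\<alpha>. \<alpha> \<in> S \<Longrightarrow> \<gamma> \<subseteq> \<alpha> \<Longrightarrow> \<gamma> = \<alpha>"
      using finite_has_maximal[of S] by auto
    then obtain k0 x0 i j where \<gamma>: "\<gamma> \<subseteq> {..<N}" and k0: "k0 \<in> box {..<N}" and x0: "x0 \<in> box \<gamma>"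
      and i: "i < M" and j: "j < M" and nz: "A \<gamma> k0 x0 i j \<noteq> 0"
      unfolding S_def by auto
    \<comment> \<open>The cell at which \<open>u\<close> has to be probed: the
      \<open>\<gamma>\<close> term reads \<open>u\<close> near \<open>x0\<close> in the directions
      of \<open>\<gamma>\<close> and near \<open>k0\<close> in all others.\<close>
    define \<xi> where "\<xi> = merge \<gamma> k0 x0"
    have \<xi>: "\<xi> \<in> box {..<N}" using k0 x0 by (auto simp: \<xi>_def box_def merge_def)
    have cl: "cell p (y n) < p" if "y \<in> box I" "n \<in> I" for y n I
      using that p_pos by (auto simp: box_def cell_less)
    define U where "U = PiE {..<N} (\<lambda>n. half_cell p 0 (cell p (\<xi> n)))"
    have U: "U \<in> sets Q" unfolding U_def using p_pos cl[OF \<xi>] by (intro half_box) auto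
    \<comment> \<open>A term whose index set misses some direction of \<open>\<gamma>\<close> keeps
      that coordinate of \<open>k\<close> in an upper half and so stays outside \<open>U\<close>. In
      the remaining directions \<open>k\<close> lies in lower halves, so that the
      \<open>\<gamma>\<close> term does reach \<open>U\<close>.\<close>
    define b where "b n = (if n \<in> \<gamma> then 1/2 else 0 :: real)" for n
    define K where "K = PiE {..<N} (\<lambda>n. half_cell p (b n) (cell p (k0 n)))"
    have K: "K \<in> sets Q" "emeasure Q K = ennreal ((1 / (2 * real p)) ^ N)"
      unfolding K_def using p_pos cl[OF k0] half_box[of p "{..<N}" b "\<lambda>n. cell p (k0 n)"]
      by (auto simp: b_def)
    have Ksp: "k \<in> space Q" if "k \<in> K" for k using K that sets.sets_into_space by blast
    define V where "V = PiE \<gamma> (\<lambda>n. half_cell p 0 (cell p (x0 n)))"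
    have V: "V \<in> sets (Qm \<gamma>)" "emeasure (Qm \<gamma>) V = ennreal ((1 / (2 * real p)) ^ card \<gamma>)"
      unfolding V_def using p_pos cl[OF x0] half_box[of p \<gamma> "\<lambda>_. 0" "\<lambda>n. cell p (x0 n)"] fin_sub[OF \<gamma>]
      by auto
    define u :: vfun where "u k l = (if l = j then indicator U k else 0)" for k l
    interpret finite_measure Q by (rule finite_measure_Qm) simp
    have "u \<in> L2 N M"
    proof -
      have m: "(\<lambda>k. u k l) \<in> borel_measurable Q" for l
        using U by (cases "l = j") (auto simp: u_def[abs_def])
      have "integrable Q (\<lambda>k. (cmod (u k l))\<^sup>2)" for l
        by (rule integrable_const_bound[of _ 1]) (use m in \<open>auto simp: u_def indicator_def\<close>)
      then show ?thesis using m by (simp add: L2_def)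
    qed
    have val: "opA N M \<alpha> (A \<alpha>) u k i = (\<integral>x. A \<alpha> k x i j * indicator U (merge \<alpha> k x) \<partial>Qm \<alpha>)" for \<alpha> k
    proof -
      have "(\<Sum>l<M. A \<alpha> k x i l * u (merge \<alpha> k x) l) = A \<alpha> k x i j * indicator U (merge \<alpha> k x)" for x
        using j sum.delta[of "{..<M}" j "\<lambda>l. A \<alpha> k x i l * indicator U (merge \<alpha> k x)"]
        by (simp add: u_def if_distrib[of "\<lambda>t. _ * t"] cong: if_cong)
      then show ?thesis using i by (simp add: opA_def)
    qed
    have main: "opsum N M A u k i \<noteq> 0" if k: "k \<in> K" for k
    proof -
      have kc: "cell p (k n) = cell p (k0 n)" "real p * k n - real (cell p (k0 n)) < 1/2 \<longleftrightarrow> b n = 0" if "n < N" for n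
      proof -
        have "k n \<in> half_cell p (b n) (cell p (k0 n))" using k that by (auto simp: K_def PiE_iff)
        moreover have "b n = 0 \<or> b n = 1/2" by (simp add: b_def)
        ultimately show "cell p (k n) = cell p (k0 n)" "real p * k n - real (cell p (k0 n)) < 1/2 \<longleftrightarrow> b n = 0"
          using half_cell_facts[OF p_pos] by blast+
      qed
      have kb: "k \<in> box {..<N}" using Ksp[OF k] by (rule space_Qm_subset_box)
      have "opA N M \<alpha> (A \<alpha>) u k i = 0" if \<alpha>: "\<alpha> \<subseteq> {..<N}" "\<alpha> \<noteq> \<gamma>" for \<alpha>
      proof (cases "\<gamma> \<subseteq> \<alpha>")
        case True
        with \<alpha> max have "\<alpha> \<notin> S" by blast
        then have "A \<alpha> k x i j = 0" if "x \<in> space (Qm \<alpha>)" for x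
          using \<alpha> kb i j space_Qm_subset_box[OF that] unfolding S_def by blast
        then have "(\<integral>x. A \<alpha> k x i j * indicator U (merge \<alpha> k x) \<partial>Qm \<alpha>) = (\<integral>x. 0 \<partial>Qm \<alpha>)"
          by (intro Bochner_Integration.integral_cong) auto
        then show ?thesis by (simp add: val)
      next
        case False
        then obtain n where n: "n \<in> \<gamma>" "n \<notin> \<alpha>" by blast
        with \<gamma> have nN: "n < N" by auto
        have "merge \<alpha> k x \<notin> U" for x
        proof
          assume "merge \<alpha> k x \<in> U"
          then have "merge \<alpha> k x n \<in> half_cell p 0 (cell p (\<xi> n))"
            unfolding U_def by (rule PiE_mem) (simp add: nN)
          then have "k n \<in> half_cell p 0 (cell p (\<xi> n))" using n by (simp add: merge_def)
          from half_cell_facts[OF p_pos _ this] kc[OF nN] n(1) show False by (simp add: b_def)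
        qed
        then show ?thesis by (simp add: val)
      qed
      then have "opsum N M A u k i = opA N M \<gamma> (A \<gamma>) u k i"
        unfolding opsum_def using \<gamma> by (subst sum.remove[of _ \<gamma>]) (auto intro: sum.neutral)
      also have "\<dots> = (\<integral>x. A \<gamma> k0 x0 i j * indicator V x \<partial>Qm \<gamma>)"
        unfolding val
      proof (rule Bochner_Integration.integral_cong[OF refl])
        fix x assume x: "x \<in> space (Qm \<gamma>)"
        have mU: "merge \<gamma> k x \<in> U \<longleftrightarrow> x \<in> V"
        proof -
          have ext: "merge \<gamma> k x \<in> extensional {..<N}" "x \<in> extensional \<gamma>"
            using merge_in_space_subset[OF Ksp[OF k] x \<gamma>] x by (auto simp: space_Qm PiE_iff)
          have kn: "k n \<in> half_cell p 0 (cell p (k0 n))" if "n < N" "n \<notin> \<gamma>" for n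
            using PiE_mem[OF k[unfolded K_def], of n] that by (simp add: b_def)
          have "merge \<gamma> k x n \<in> half_cell p 0 (cell p (\<xi> n)) \<longleftrightarrow> (n \<in> \<gamma> \<longrightarrow> x n \<in> half_cell p 0 (cell p (x0 n)))"
            if "n < N" for n
            using kn[OF that] by (cases "n \<in> \<gamma>") (simp_all add: \<xi>_def merge_def)
          then have "(\<forall>n\<in>{..<N}. merge \<gamma> k x n \<in> half_cell p 0 (cell p (\<xi> n))) \<longleftrightarrow>
              (\<forall>n\<in>\<gamma>. x n \<in> half_cell p 0 (cell p (x0 n)))"
            using \<gamma> by (metis lessThan_iff subsetD)
          then show ?thesis using ext by (simp add: U_def V_def PiE_iff)
        qed
        show "A \<gamma> k x i j * indicator U (merge \<gamma> k x) = A \<gamma> k0 x0 i j * indicator V x"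
        proof (cases "x \<in> V")
          case True
          have "cell p (x n) = cell p (x0 n)" if "n \<in> \<gamma>" for n
            by (rule half_cell_facts(1)[OF p_pos _ PiE_mem[OF True[unfolded V_def] that]]) simp
          then have "A \<gamma> k x i j = A \<gamma> k0 x0 i j"
            using \<gamma> kb k0 x0 x kc i j by (intro stair_cong[OF st]) (auto simp: fin_sub space_Qm_subset_box)
          then show ?thesis using True mU by simp
        qed (use mU in simp)
      qed
      \<comment> \<open>The factor is the volume of \<open>V\<close>, a box with one half cell for
        each direction of \<open>\<gamma>\<close>.\<close>
      also have "\<dots> = A \<gamma> k0 x0 i j * complex_of_real ((1 / (2 * real p)) ^ card \<gamma>)"
      proof -
        have "measure (Qm \<gamma>) V = (1 / (2 * real p)) ^ card \<gamma>"
          using V by (simp add: measure_def)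
        moreover have "(\<integral>x. A \<gamma> k0 x0 i j * indicator V x \<partial>Qm \<gamma>) =
            (\<integral>x. A \<gamma> k0 x0 i j * complex_of_real (indicator V x) \<partial>Qm \<gamma>)"
          by (intro Bochner_Integration.integral_cong) (auto split: split_indicator)
        ultimately show ?thesis using V sets.sets_into_space[OF V(1)] by (simp add: Int_absorb1 Int_absorb2)
      qed
      finally show ?thesis using nz p_pos by simp
    qed
    \<comment> \<open>The sum is nonzero on all of \<open>K\<close>, a set of positive measure,
      although it should vanish almost everywhere.\<close>
    have "AE k in Q. \<forall>j<M. opsum N M A u k j = 0"
      using zero \<open>u \<in> L2 N M\<close> by (simp add: op_eq_def ae_eq_def zero_op_def)
    then have "AE k in Q. k \<notin> K" using main i by (auto elim!: eventually_mono)
    then have "emeasure Q K = 0" using K AE_iff_measurable[of K Q "\<lambda>k. k \<notin> K"] Ksp by auto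
    then show False using K p_pos by simp
  qed
  then show ?thesis using assms unfolding S_def by blast
qed

end

section \<open>Finite-dimensional and graded algebra\<close>

text \<open>Gaussian elimination. A pivot \<open>i0\<close> with \<open>v i0 z \<noteq> 0\<close>
  clears the equation \<open>z\<close> from the other vectors, giving \<open>w\<close>; a relation
  among these is lifted back by choosing the coefficient of the pivot in \<open>a'\<close>.\<close>

lemma underdetermined_system:
  fixes v :: "'i \<Rightarrow> 'z \<Rightarrow> complex"
  assumes "finite Z" "finite I" "card Z < card I"
  shows "\<exists>a. (\<exists>i\<in>I. a i \<noteq> 0) \<and> (\<forall>z\<in>Z. (\<Sum>i\<in>I. a i * v i z) = 0)"
  using assms
proof (induction Z arbitrary: I v rule: finite_induct)
  case empty
  then have "I \<noteq> {}" by auto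
  then show ?case by (intro exI[of _ "\<lambda>_. 1"]) auto
next
  case (insert z Z)
  show ?case
  proof (cases "\<forall>i\<in>I. v i z = 0")
    case True
    have "card Z < card I" using insert by simp
    from insert.IH[OF insert.prems(1) this, of v] True show ?thesis by (auto intro!: sum.neutral)
  next
    case False
    then obtain i0 where i0: "i0 \<in> I" "v i0 z \<noteq> 0" by blast
    define w where "w i y = v i y - v i z / v i0 z * v i0 y" for i y
    have "card Z < card (I - {i0})" using insert i0 by simp
    from insert.IH[OF _ this, of w] insert.prems obtain a where
      a: "\<exists>i\<in>I - {i0}. a i \<noteq> 0" "\<And>y. y \<in> Z \<Longrightarrow> (\<Sum>i\<in>I - {i0}. a i * w i y) = 0" by auto
    define a' where "a' i = (if i = i0 then - (\<Sum>i\<in>I - {i0}. a i * (v i z / v i0 z)) else a i)" for i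
    have eq: "(\<Sum>i\<in>I. a' i * v i y) = (\<Sum>i\<in>I - {i0}. a i * w i y)" for y
    proof -
      have "(\<Sum>i\<in>I. a' i * v i y) = a' i0 * v i0 y + (\<Sum>i\<in>I - {i0}. a' i * v i y)"
        using insert.prems i0 by (simp add: sum.remove)
      also have "(\<Sum>i\<in>I - {i0}. a' i * v i y) = (\<Sum>i\<in>I - {i0}. a i * v i y)"
        by (intro sum.cong) (auto simp: a'_def)
      also have "a' i0 * v i0 y = - (\<Sum>i\<in>I - {i0}. a i * (v i z / v i0 z * v i0 y))"
        by (simp add: a'_def sum_distrib_right sum_negf[symmetric] mult.assoc)
      finally show ?thesis by (simp add: w_def sum_subtractf right_diff_distrib)
    qed
    have "(\<Sum>i\<in>I - {i0}. a i * w i z) = 0" using i0 by (simp add: w_def)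
    then have "\<forall>y\<in>insert z Z. (\<Sum>i\<in>I. a' i * v i y) = 0" using a(2) eq by auto
    moreover have "\<exists>i\<in>I. a' i \<noteq> 0" using a(1) by (auto simp: a'_def)
    ultimately show ?thesis by blast
  qed
qed

text \<open>Dimension count in coordinates: \<open>y\<close> and the images of the unit vectors are
  linearly dependent, and injectivity forces \<open>y\<close> to occur in the relation, which can
  then be solved for it. Only the values on \<open>Z\<close> count.\<close>

lemma finite_support_injective_imp_surjective:
  fixes \<tau> :: "('z \<Rightarrow> complex) \<Rightarrow> 'z \<Rightarrow> complex"
  assumes Z: "finite Z"
    and lin: "\<And>a b s z. z \<in> Z \<Longrightarrow> \<tau> (\<lambda>z. a z + s * b z) z = \<tau> a z + s * \<tau> b z"
    and inj: "\<And>a. (\<And>z. z \<notin> Z \<Longrightarrow> a z = 0) \<Longrightarrow> (\<And>z. z \<in> Z \<Longrightarrow> \<tau> a z = 0) \<Longrightarrow> a = (\<lambda>_. 0)"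
  shows "\<exists>a. (\<forall>z. z \<notin> Z \<longrightarrow> a z = 0) \<and> (\<forall>z\<in>Z. \<tau> a z = y z)"
proof -
  define \<delta> :: "'z \<Rightarrow> 'z \<Rightarrow> complex" where "\<delta> w z = (if z = w then 1 else 0)" for w z
  have z0: "\<tau> (\<lambda>_. 0) z = 0" if "z \<in> Z" for z using lin[OF that, of "\<lambda>_. 0" 1 "\<lambda>_. 0"] by simp
  have expand: "\<tau> (\<lambda>z. \<Sum>w\<in>W. a w * \<delta> w z) z = (\<Sum>w\<in>W. a w * \<tau> (\<delta> w) z)" if "finite W" "z \<in> Z" for W a z
    using that(1)
  proof (induction W rule: finite_induct)
    case (insert w W)
    have "\<tau> (\<lambda>z. (\<Sum>w\<in>W. a w * \<delta> w z) + a w * \<delta> w z) z = \<tau> (\<lambda>z. \<Sum>w\<in>W. a w * \<delta> w z) z + a w * \<tau> (\<delta> w) z"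
      by (rule lin[OF that(2)])
    with insert show ?case by (simp add: add.commute)
  qed (simp add: z0 that)
  have supp: "(\<lambda>z. \<Sum>w\<in>Z. a w * \<delta> w z) = (\<lambda>z. if z \<in> Z then a z else 0)" for a
    using Z by (auto simp: fun_eq_iff \<delta>_def sum.delta' if_distrib[of "\<lambda>t. _ * t"] cong: if_cong)
  \<comment> \<open>\<open>None\<close> stands for the target \<open>y\<close> and
    \<open>Some w\<close> for the image of the unit vector at \<open>w\<close>: one vector more than
    there are equations.\<close>
  define v where "v o' = (case o' of None \<Rightarrow> y | Some w \<Rightarrow> \<tau> (\<delta> w))" for o'
  have "card Z < card (insert None (Some ` Z))" using Z by (simp add: card_image)
  from underdetermined_system[OF Z _ this, of v] Z obtain a where
    a: "\<exists>i\<in>insert None (Some ` Z). a i \<noteq> 0" "\<And>z. z \<in> Z \<Longrightarrow> (\<Sum>i\<in>insert None (Some ` Z). a i * v i z) = 0"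
    by auto
  have rel: "a None * y z + (\<Sum>w\<in>Z. a (Some w) * \<tau> (\<delta> w) z) = 0" if "z \<in> Z" for z
    using a(2)[OF that] Z by (simp add: v_def sum.reindex)
  \<comment> \<open>Otherwise the remaining coefficients form a nonzero element that
    \<open>\<tau>\<close> annihilates.\<close>
  have "a None \<noteq> 0"
  proof
    assume n: "a None = 0"
    define b where "b z = (if z \<in> Z then a (Some z) else 0)" for z
    have "\<tau> b z = 0" if "z \<in> Z" for z
      using rel[OF that] n expand[OF Z that, of "\<lambda>w. a (Some w)"] by (simp add: supp b_def[abs_def])
    then have "b = (\<lambda>_. 0)" by (intro inj) (auto simp: b_def)
    then have "a (Some z) = 0" if "z \<in> Z" for z using that by (auto simp: b_def fun_eq_iff split: if_splits)
    with a(1) n show False by auto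
  qed
  define b where "b z = (if z \<in> Z then - a (Some z) / a None else 0)" for z
  have "\<tau> b z = y z" if "z \<in> Z" for z
  proof -
    have "\<tau> b z = (\<Sum>w\<in>Z. (- a (Some w) / a None) * \<tau> (\<delta> w) z)"
      using expand[OF Z that, of "\<lambda>w. - a (Some w) / a None"] by (simp only: supp b_def[abs_def])
    also have "\<dots> = - (\<Sum>w\<in>Z. a (Some w) * \<tau> (\<delta> w) z) / a None"
      by (simp add: sum_negf sum_divide_distrib)
    also have "\<dots> = y z" using rel[OF that] \<open>a None \<noteq> 0\<close>
      by (simp add: field_simps) (metis add.commute add_eq_0_iff)
    finally show ?thesis .
  qed
  then show ?thesis by (intro exI[of _ b]) (auto simp: b_def)
qed

text \<open>The relation needed to peel off the first factor: the span of the later indices is an ideal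
  in the span of all remaining ones.\<close>

fun absorbing :: "nat set list \<Rightarrow> bool" where
  "absorbing [] = True"
| "absorbing (\<beta> # \<beta>s) = ((\<forall>\<gamma>\<in>set (\<beta> # \<beta>s). \<forall>\<delta>\<in>set \<beta>s. \<gamma> \<union> \<delta> \<in> set \<beta>s) \<and> \<beta> \<notin> set \<beta>s \<and> absorbing \<beta>s)"

text \<open>If \<open>\<gamma> \<union> \<delta>\<close> did not stand after \<open>\<beta>\<close>,
  it would precede \<open>\<delta>\<close> and have at most as many elements, hence be equal to
  \<open>\<delta>\<close>, which does stand after \<open>\<beta>\<close>. The prefix
  \<open>pre\<close> keeps the whole list in view, where every union of subsets must occur.\<close>

lemma absorbing_suffix:
  assumes "distinct (pre @ \<beta>s)" "set (pre @ \<beta>s) = Pow {..<N}" "sorted (map card (pre @ \<beta>s))"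
  shows "absorbing \<beta>s"
  using assms
proof (induction \<beta>s arbitrary: pre)
  case (Cons \<beta> \<beta>s)
  have "absorbing \<beta>s" by (rule Cons.IH[of "pre @ [\<beta>]"]) (use Cons.prems in auto)
  moreover have "\<gamma> \<union> \<delta> \<in> set \<beta>s" if "\<gamma> \<in> set (\<beta> # \<beta>s)" "\<delta> \<in> set \<beta>s" for \<gamma> \<delta>
  proof (rule ccontr)
    assume n: "\<gamma> \<union> \<delta> \<notin> set \<beta>s"
    have sub: "\<gamma> \<in> Pow {..<N}" "\<delta> \<in> Pow {..<N}" using that Cons.prems(2) by auto
    then have fin: "finite (\<gamma> \<union> \<delta>)" by (auto intro: finite_subset)
    have "\<gamma> \<union> \<delta> \<in> set (pre @ \<beta> # \<beta>s)" unfolding Cons.prems(2) using sub by auto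
    with n have "\<gamma> \<union> \<delta> \<in> set pre \<or> \<gamma> \<union> \<delta> = \<beta>" by auto
    then have "card (\<gamma> \<union> \<delta>) \<le> card \<delta>"
      using Cons.prems(3) that by (auto simp: sorted_append)
    then have "\<delta> = \<gamma> \<union> \<delta>" using fin by (intro card_seteq) auto
    with n that show False by simp
  qed
  ultimately show ?case using Cons.prems(1) by auto
qed simp

lemma absorbing_sorted:
  assumes "distinct \<alpha>s" "set \<alpha>s = Pow {..<N}" "sorted (map card \<alpha>s)"
  shows "absorbing \<alpha>s"
  using absorbing_suffix[of "[]" \<alpha>s N] assms by simp

text \<open>\<open>L \<A>\<close> models the sum of the pieces with index in \<open>\<A>\<close>.
  The multiplication is a parameter so that the opposite multiplication can instantiate the same
  locale. Finite dimension enters only through \<open>inverse_in\<close>, which speaks of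
  \<open>x - e\<close> and hence applies to families whose span does not contain the unit.\<close>

locale union_graded_algebra =
  fixes mul :: "'a::ab_group_add \<Rightarrow> 'a \<Rightarrow> 'a" (infixl "\<odot>" 70)
    and e :: 'a and L :: "nat set set \<Rightarrow> 'a set" and I :: "nat set set"
  assumes assoc: "(x \<odot> y) \<odot> z = x \<odot> (y \<odot> z)"
    and distl: "(x + y) \<odot> z = x \<odot> z + y \<odot> z"
    and distr: "z \<odot> (x + y) = z \<odot> x + z \<odot> y"
    and L_zero: "0 \<in> L \<A>"
    and L_diff: "x \<in> L \<A> \<Longrightarrow> y \<in> L \<A> \<Longrightarrow> x - y \<in> L \<A>"
    and L_mono: "\<A> \<subseteq> \<B> \<Longrightarrow> x \<in> L \<A> \<Longrightarrow> x \<in> L \<B>"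
    and L_disjoint: "\<A> \<inter> \<B> = {} \<Longrightarrow> x \<in> L \<A> \<Longrightarrow> x \<in> L \<B> \<Longrightarrow> x = 0"
    and L_split: "x \<in> L (\<A> \<union> \<B>) \<Longrightarrow> \<exists>y\<in>L \<A>. \<exists>z\<in>L \<B>. x = y + z"
    and L_mul: "\<forall>a\<in>\<A>. \<forall>b\<in>\<B>. a \<union> b \<in> \<C> \<Longrightarrow> x \<in> L \<A> \<Longrightarrow> y \<in> L \<B> \<Longrightarrow> x \<odot> y \<in> L \<C>"
    and unit_in: "e \<in> L I"
    and unit_left: "x \<in> L I \<Longrightarrow> e \<odot> x = x"
    and unit_right: "x \<in> L I \<Longrightarrow> x \<odot> e = x"
    and inverse_in: "\<forall>a\<in>\<A>. \<forall>b\<in>\<A>. a \<union> b \<in> \<A> \<Longrightarrow> \<A> \<subseteq> I \<Longrightarrow> x - e \<in> L \<A> \<Longrightarrow> y \<in> L I \<Longrightarrow>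
          x \<odot> y = e \<Longrightarrow> y \<odot> x = e \<Longrightarrow> y - e \<in> L \<A>"
begin

section \<open>Units and ordered products in a union-graded algebra\<close>

definition units :: "'a set" where
  "units = {x \<in> L I. \<exists>y\<in>L I. x \<odot> y = e \<and> y \<odot> x = e}"

definition grp :: "nat set \<Rightarrow> 'a set" where
  "grp \<alpha> = {x \<in> units. x - e \<in> L {\<alpha>}}"

definition prd :: "(nat set \<Rightarrow> 'a) \<Rightarrow> nat set list \<Rightarrow> 'a" where
  "prd b \<beta>s = foldr (\<lambda>\<beta> y. b \<beta> \<odot> y) \<beta>s e"

lemma L_minus: "x \<in> L \<A> \<Longrightarrow> - x \<in> L \<A>"
  using L_diff[OF L_zero] by fastforce

lemma L_add: "x \<in> L \<A> \<Longrightarrow> y \<in> L \<A> \<Longrightarrow> x + y \<in> L \<A>"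
  using L_diff[OF _ L_minus, of x \<A> y] by simp

lemma I_closed_mul:
  assumes "\<forall>a\<in>I. \<forall>b\<in>I. a \<union> b \<in> I" "x \<in> L I" "y \<in> L I" shows "x \<odot> y \<in> L I"
  using L_mul[OF assms] .

lemma units_mul:
  assumes "\<forall>a\<in>I. \<forall>b\<in>I. a \<union> b \<in> I" "x \<in> units" "y \<in> units" shows "x \<odot> y \<in> units"
proof -
  obtain x' y' where x': "x' \<in> L I" "x \<odot> x' = e" "x' \<odot> x = e" and y': "y' \<in> L I" "y \<odot> y' = e" "y' \<odot> y = e"
    using assms(2,3) unfolding units_def by blast
  have xy: "x \<in> L I" "y \<in> L I" using assms unfolding units_def by auto
  have "(x \<odot> y) \<odot> (y' \<odot> x') = x \<odot> (y \<odot> y') \<odot> x'" by (simp add: assoc)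
  also have "\<dots> = e" using x' y' xy by (simp add: unit_right)
  finally have 1: "(x \<odot> y) \<odot> (y' \<odot> x') = e" .
  have "(y' \<odot> x') \<odot> (x \<odot> y) = y' \<odot> (x' \<odot> x) \<odot> y" by (simp add: assoc)
  also have "\<dots> = e" using x' y' xy by (simp add: unit_right)
  finally have 2: "(y' \<odot> x') \<odot> (x \<odot> y) = e" .
  show ?thesis unfolding units_def using 1 2 xy x' y' I_closed_mul[OF assms(1)] by blast
qed

lemma unit_unit: "e \<in> units"
  unfolding units_def using unit_in unit_left by blast

lemma units_cancel:
  assumes "x \<in> units" "y \<in> L I" "z \<in> L I" "x \<odot> y = x \<odot> z" shows "y = z"
proof -
  obtain x' where "x' \<odot> x = e" using assms(1) unfolding units_def by blast
  then have "x' \<odot> (x \<odot> y) = y" "x' \<odot> (x \<odot> z) = z" using assms(2,3) by (simp_all add: assoc[symmetric] unit_left)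
  then show ?thesis using assms(4) by metis
qed

lemma prd_simps: "prd b [] = e" "prd b (\<beta> # \<beta>s) = b \<beta> \<odot> prd b \<beta>s"
  by (simp_all add: prd_def)

lemma prd_in_units:
  assumes "\<forall>a\<in>I. \<forall>b\<in>I. a \<union> b \<in> I" "\<And>\<beta>. \<beta> \<in> set \<beta>s \<Longrightarrow> b \<beta> \<in> units"
  shows "prd b \<beta>s \<in> units"
  using assms(2) by (induction \<beta>s) (auto simp: prd_simps unit_unit units_mul[OF assms(1)])

lemma prd_append:
  assumes "\<And>\<beta>. \<beta> \<in> set (\<beta>s @ \<gamma>s) \<Longrightarrow> b \<beta> \<in> L I" "\<forall>a\<in>I. \<forall>b\<in>I. a \<union> b \<in> I"
  shows "prd b (\<beta>s @ \<gamma>s) = prd b \<beta>s \<odot> prd b \<gamma>s"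
proof -
  have "prd b \<gamma>s \<in> L I" using assms(1)
    by (induction \<gamma>s) (auto simp: prd_simps unit_in I_closed_mul[OF assms(2)])
  then show ?thesis by (induction \<beta>s) (auto simp: prd_simps unit_left assoc)
qed

text \<open>In \<open>(e + k) \<odot> (e + r)\<close> the mixed term \<open>k \<odot> r\<close>
  falls into the later indices by absorption, so nothing leaves the span.\<close>

lemma prd_minus_unit:
  assumes "absorbing \<beta>s" "set \<beta>s \<subseteq> I" "\<forall>a\<in>I. \<forall>b\<in>I. a \<union> b \<in> I"
    "\<And>\<beta>. \<beta> \<in> set \<beta>s \<Longrightarrow> b \<beta> \<in> grp \<beta>"
  shows "prd b \<beta>s - e \<in> L (set \<beta>s)"
  using assms
proof (induction \<beta>s)
  case Nil
  then show ?case by (simp add: prd_simps L_zero)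
next
  case (Cons \<beta> \<beta>s)
  define k where "k = b \<beta> - e"
  define r where "r = prd b \<beta>s - e"
  have k: "k \<in> L {\<beta>}" using Cons.prems(4)[of \<beta>] by (simp add: grp_def k_def)
  have r: "r \<in> L (set \<beta>s)" unfolding r_def using Cons by auto
  have I: "k \<in> L I" "r \<in> L I" using L_mono[OF _ k] L_mono[OF _ r] Cons.prems(2) by auto
  have "prd b (\<beta> # \<beta>s) = (e + k) \<odot> (e + r)" by (simp add: prd_simps k_def r_def)
  also have "\<dots> = e + k + r + k \<odot> r"
    using I unit_in by (simp add: distl distr unit_left unit_right)
  finally have eq: "prd b (\<beta> # \<beta>s) - e = k + r + k \<odot> r" by simp
  have "k \<odot> r \<in> L (set \<beta>s)" using Cons.prems(1) by (intro L_mul[OF _ k r]) auto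
  then show ?case unfolding eq using k r
    by (intro L_add) (erule L_mono[rotated], simp add: subset_insertI)+
qed

lemma product_exists:
  assumes "absorbing \<beta>s" "set \<beta>s \<subseteq> I" "\<forall>a\<in>I. \<forall>b\<in>I. a \<union> b \<in> I" "x \<in> units" "x - e \<in> L (set \<beta>s)"
  shows "\<exists>b. (\<forall>\<beta>\<in>set \<beta>s. b \<beta> \<in> grp \<beta>) \<and> x = prd b \<beta>s"
  using assms
proof (induction \<beta>s arbitrary: x)
  case Nil
  have "x - e = 0" using Nil by (intro L_disjoint[of "{}" "{}"]) auto
  then show ?case by (simp add: prd_simps)
next
  case (Cons \<beta> \<beta>s)
  note clI = Cons.prems(3)
  have ideal1: "\<gamma> \<union> \<delta> \<in> set \<beta>s" if "\<gamma> \<in> set (\<beta> # \<beta>s)" "\<delta> \<in> set \<beta>s" for \<gamma> \<delta>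
    using Cons.prems(1) that unfolding absorbing.simps by blast
  have ideal2: "\<delta> \<union> \<gamma> \<in> set \<beta>s" if "\<gamma> \<in> set (\<beta> # \<beta>s)" "\<delta> \<in> set \<beta>s" for \<gamma> \<delta>
    using ideal1[OF that] by (subst Un_commute)
  note ideal = ideal1 ideal2
  have cl: "\<forall>a\<in>set (\<beta> # \<beta>s). \<forall>b\<in>set (\<beta> # \<beta>s). a \<union> b \<in> set (\<beta> # \<beta>s)"
    using ideal by auto
  have LI: "z \<in> L I" if "z \<in> L \<A>" "\<A> \<subseteq> set (\<beta> # \<beta>s)" for z \<A>
    using L_mono[OF _ that(1)] that(2) Cons.prems(2) by auto
  obtain y where y: "y \<in> L I" "x \<odot> y = e" "y \<odot> x = e" using Cons.prems(4) unfolding units_def by blast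
  \<comment> \<open>The inverse has to stay in the same span: components of \<open>y\<close> at
    other indices could also contribute to the \<open>\<beta>\<close> part of the products
    below.\<close>
  have ye: "y - e \<in> L (set (\<beta> # \<beta>s))" by (rule inverse_in[OF cl Cons.prems(2,5) y])
  have eq: "set (\<beta> # \<beta>s) = {\<beta>} \<union> set \<beta>s" by simp
  obtain k r where k: "k \<in> L {\<beta>}" and r: "r \<in> L (set \<beta>s)" and x: "x - e = k + r"
    using L_split Cons.prems(5) unfolding eq by metis
  obtain k' r' where k': "k' \<in> L {\<beta>}" and r': "r' \<in> L (set \<beta>s)" and y': "y - e = k' + r'"
    using L_split ye unfolding eq by metis
  have xk: "x = e + k + r" and yk: "y = e + k' + r'" using x y' by (simp_all add: algebra_simps)
  have inI: "k \<in> L I" "r \<in> L I" "k' \<in> L I" "r' \<in> L I" using k r k' r' LI by auto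
  note us = unit_left unit_right distl distr
  have kk: "k \<odot> k' \<in> L {\<beta>}" "k' \<odot> k \<in> L {\<beta>}" using L_mul[OF _ k k'] L_mul[OF _ k' k] by auto
  have rr: "k \<odot> r' \<in> L (set \<beta>s)" "r \<odot> k' \<in> L (set \<beta>s)" "r \<odot> r' \<in> L (set \<beta>s)"
    "k' \<odot> r \<in> L (set \<beta>s)" "r' \<odot> k \<in> L (set \<beta>s)" "r' \<odot> r \<in> L (set \<beta>s)"
    using ideal by (auto intro!: L_mul[OF _ k r'] L_mul[OF _ r k'] L_mul[OF _ r r'] L_mul[OF _ k' r] L_mul[OF _ r' k] L_mul[OF _ r' r])
  have dis: "{\<beta>} \<inter> set \<beta>s = {}" using Cons.prems(1) by auto
  \<comment> \<open>Applied to \<open>x \<odot> y = e\<close> and \<open>y \<odot> x = e\<close>: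
    one summand lies over \<open>\<beta>\<close> and the other over the later indices. As these meet
    only in zero, the \<open>\<beta>\<close> part vanishes by itself and exhibits
    \<open>e + k'\<close> as the inverse of \<open>e + k\<close>.\<close>
  have neg: "a = - c" if "e = e + a + c" for a c
    using that by (simp add: add.assoc eq_neg_iff_add_eq_0)
  have "x \<odot> y = e + (k + k' + k \<odot> k') + (r + r' + k \<odot> r' + r \<odot> k' + r \<odot> r')"
    unfolding xk yk using inI unit_in by (simp add: us algebra_simps)
  then have "k + k' + k \<odot> k' = - (r + r' + k \<odot> r' + r \<odot> k' + r \<odot> r')"
    unfolding y(2) by (rule neg)
  moreover have "k + k' + k \<odot> k' \<in> L {\<beta>}" using k k' kk by (intro L_add)
  moreover have "- (r + r' + k \<odot> r' + r \<odot> k' + r \<odot> r') \<in> L (set \<beta>s)" using r r' rr by (intro L_minus L_add)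
  ultimately have z1: "k + k' + k \<odot> k' = 0" by (intro L_disjoint[OF dis]) simp_all
  have "y \<odot> x = e + (k + k' + k' \<odot> k) + (r + r' + k' \<odot> r + r' \<odot> k + r' \<odot> r)"
    unfolding xk yk using inI unit_in by (simp add: us algebra_simps)
  then have "k + k' + k' \<odot> k = - (r + r' + k' \<odot> r + r' \<odot> k + r' \<odot> r)"
    unfolding y(3) by (rule neg)
  moreover have "k + k' + k' \<odot> k \<in> L {\<beta>}" using k k' kk by (intro L_add)
  moreover have "- (r + r' + k' \<odot> r + r' \<odot> k + r' \<odot> r) \<in> L (set \<beta>s)" using r r' rr by (intro L_minus L_add)
  ultimately have z2: "k + k' + k' \<odot> k = 0" by (intro L_disjoint[OF dis]) simp_all
  have a1: "(e + k) \<odot> (e + k') = e"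
    using inI unit_in z1 by (simp add: us algebra_simps)
  have a2: "(e + k') \<odot> (e + k) = e"
    using inI unit_in z2 by (simp add: us algebra_simps)
  have eI: "e + k \<in> L I" "e + k' \<in> L I" using inI unit_in by (auto intro: L_add)
  have u: "e + k \<in> units" "e + k' \<in> units" unfolding units_def using a1 a2 eI by auto
  \<comment> \<open>Dividing \<open>x\<close> by its first factor on the left removes the
    \<open>\<beta>\<close> component, so \<open>w\<close> is covered by the induction
    hypothesis.\<close>
  define w where "w = (e + k') \<odot> x"
  have wu: "w \<in> units" unfolding w_def by (rule units_mul[OF clI u(2) Cons.prems(4)])
  have "w = e + (k + k' + k' \<odot> k) + (r + k' \<odot> r)"
    unfolding w_def xk using inI unit_in by (simp add: us algebra_simps)
  then have "w - e = r + k' \<odot> r" using z2 by simp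
  then have we: "w - e \<in> L (set \<beta>s)" using r rr by (auto intro: L_add)
  obtain b where b: "\<forall>\<gamma>\<in>set \<beta>s. b \<gamma> \<in> grp \<gamma>" "w = prd b \<beta>s"
    using Cons.IH[OF _ _ clI wu we] Cons.prems by auto
  have "x = (e + k) \<odot> w"
    unfolding w_def assoc[symmetric] a1 using Cons.prems(4) by (simp add: units_def unit_left)
  moreover have "prd (b(\<beta> := e + k)) \<beta>s = prd b \<beta>s"
    unfolding prd_def using Cons.prems(1) by (intro foldr_cong) auto
  ultimately have "x = prd (b(\<beta> := e + k)) (\<beta> # \<beta>s)" using b by (simp add: prd_simps)
  moreover have "\<forall>\<gamma>\<in>set (\<beta> # \<beta>s). (b(\<beta> := e + k)) \<gamma> \<in> grp \<gamma>"
    using b u k by (auto simp: grp_def)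
  ultimately show ?case by blast
qed

text \<open>All other contributions to a product lie over later indices, so its component at the
  head \<open>\<beta>\<close> determines the first factor. That factor is a unit and can be
  cancelled, which leaves the tail.\<close>

lemma product_unique:
  assumes "absorbing \<beta>s" "set \<beta>s \<subseteq> I" "\<forall>a\<in>I. \<forall>b\<in>I. a \<union> b \<in> I"
    "\<And>\<beta>. \<beta> \<in> set \<beta>s \<Longrightarrow> b \<beta> \<in> grp \<beta>" "\<And>\<beta>. \<beta> \<in> set \<beta>s \<Longrightarrow> b' \<beta> \<in> grp \<beta>" "prd b \<beta>s = prd b' \<beta>s"
  shows "\<forall>\<beta>\<in>set \<beta>s. b \<beta> = b' \<beta>"
  using assms
proof (induction \<beta>s)
  case (Cons \<beta> \<beta>s)
  have head: "\<exists>s\<in>L (set \<beta>s). prd c (\<beta> # \<beta>s) = c \<beta> + s" if c: "\<And>\<gamma>. \<gamma> \<in> set (\<beta> # \<beta>s) \<Longrightarrow> c \<gamma> \<in> grp \<gamma>" for c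
  proof -
    define k where "k = c \<beta> - e"
    define r where "r = prd c \<beta>s - e"
    have k: "k \<in> L {\<beta>}" using c[of \<beta>] by (simp add: grp_def k_def)
    have r: "r \<in> L (set \<beta>s)" unfolding r_def using Cons.prems c by (intro prd_minus_unit) auto
    have I: "k \<in> L I" "r \<in> L I" using L_mono[OF _ k] L_mono[OF _ r] Cons.prems(2) by auto
    have "prd c (\<beta> # \<beta>s) = (e + k) \<odot> (e + r)" by (simp add: prd_simps k_def r_def)
    also have "\<dots> = (e + k) + (r + k \<odot> r)"
      using I unit_in by (simp add: distl distr unit_left unit_right algebra_simps)
    finally have "prd c (\<beta> # \<beta>s) = c \<beta> + (r + k \<odot> r)" by (simp add: k_def)
    moreover have "k \<odot> r \<in> L (set \<beta>s)" using Cons.prems(1) by (intro L_mul[OF _ k r]) auto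
    ultimately show ?thesis using r L_add by blast
  qed
  obtain s s' where s: "s \<in> L (set \<beta>s)" "s' \<in> L (set \<beta>s)" "b \<beta> + s = b' \<beta> + s'"
    using head[of b] head[of b'] Cons.prems(4,5,6) by metis
  then have "(b \<beta> - e) - (b' \<beta> - e) = s' - s" by (simp add: algebra_simps)
  moreover have "(b \<beta> - e) - (b' \<beta> - e) \<in> L {\<beta>}" 
    using Cons.prems(4,5) by (intro L_diff[of "b \<beta> - e"]) (auto simp: grp_def)
  moreover have "s' - s \<in> L (set \<beta>s)" using s by (intro L_diff)
  moreover have "{\<beta>} \<inter> set \<beta>s = {}" using Cons.prems(1) by auto
  ultimately have "(b \<beta> - e) - (b' \<beta> - e) = 0" using L_disjoint by metis
  then have h: "b \<beta> = b' \<beta>" by simp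
  have pI: "prd c \<beta>s \<in> L I" if "\<And>\<gamma>. \<gamma> \<in> set \<beta>s \<Longrightarrow> c \<gamma> \<in> grp \<gamma>" for c
    using prd_in_units[OF Cons.prems(3), of \<beta>s c] that by (auto simp: grp_def units_def)
  have "prd b \<beta>s = prd b' \<beta>s"
    by (rule units_cancel[of "b \<beta>"]) (use Cons.prems(4,5,6) h pI in \<open>auto simp: grp_def prd_simps\<close>)
  with Cons h show ?case by auto
qed simp

text \<open>Reversing both the list and the multiplication leaves the product unchanged; the left
  side is \<open>prd\<close> of the opposite algebra.\<close>

lemma product_descending_eq:
  "foldr (\<lambda>\<beta> y. y \<odot> b \<beta>) (rev \<beta>s) e = prd b \<beta>s"
  if "\<And>\<beta>. \<beta> \<in> set \<beta>s \<Longrightarrow> b \<beta> \<in> L I" "\<forall>a\<in>I. \<forall>b\<in>I. a \<union> b \<in> I"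
  using that(1)
proof (induction \<beta>s rule: rev_induct)
  case (snoc \<beta> \<beta>s)
  then show ?case by (subst prd_append[OF _ that(2)]) (auto simp: prd_simps unit_right)
qed (simp add: prd_simps)

text \<open>The grading is by unions, which commute, so the axioms are symmetric in left and
  right.\<close>

lemma flip: "union_graded_algebra (\<lambda>x y. y \<odot> x) e L I"
proof
  fix \<A> \<B> \<C> :: "nat set set" and x y
  assume "\<forall>a\<in>\<A>. \<forall>b\<in>\<B>. a \<union> b \<in> \<C>" "x \<in> L \<A>" "y \<in> L \<B>"
  then show "y \<odot> x \<in> L \<C>" by (intro L_mul[of \<B> \<A>]) (metis Un_commute)+
next
  fix \<A> :: "nat set set" and x y
  assume "\<forall>a\<in>\<A>. \<forall>b\<in>\<A>. a \<union> b \<in> \<A>" "\<A> \<subseteq> I" "x - e \<in> L \<A>" "y \<in> L I" "y \<odot> x = e" "x \<odot> y = e"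
  then show "y - e \<in> L \<A>" using inverse_in by blast
qed (auto simp: assoc distl distr unit_in unit_left unit_right intro: L_zero L_diff L_mono L_disjoint L_split)

text \<open>A descending list is treated in the opposite algebra: there its reverse is ascending,
  and units, subgroups and the product are the same.\<close>

theorem units_product:
  assumes I: "I = Pow {..<N}" and \<alpha>s: "distinct \<alpha>s" "set \<alpha>s = I"
    and sort: "sorted (map card \<alpha>s) \<or> sorted (rev (map card \<alpha>s))"
  shows "x \<in> units \<longleftrightarrow> (\<exists>b. (\<forall>\<alpha>\<in>I. b \<alpha> \<in> grp \<alpha>) \<and> x = prd b \<alpha>s)"
    and "\<forall>\<alpha>\<in>I. b \<alpha> \<in> grp \<alpha> \<Longrightarrow> \<forall>\<alpha>\<in>I. b' \<alpha> \<in> grp \<alpha> \<Longrightarrow> prd b \<alpha>s = prd b' \<alpha>s \<Longrightarrow> \<forall>\<alpha>\<in>I. b \<alpha> = b' \<alpha>"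
proof -
  interpret op: union_graded_algebra "\<lambda>x y. y \<odot> x" e L I by (rule flip)
  have cl: "\<forall>a\<in>I. \<forall>b\<in>I. a \<union> b \<in> I" unfolding I by auto
  have u: "op.units = units" unfolding op.units_def units_def by auto
  have g: "op.grp \<alpha> = grp \<alpha>" for \<alpha> unfolding op.grp_def grp_def u ..
  have gI: "\<And>\<beta>. \<beta> \<in> set \<alpha>s \<Longrightarrow> b \<beta> \<in> L I" if "\<forall>\<alpha>\<in>I. b \<alpha> \<in> grp \<alpha>" for b
    using that \<alpha>s by (auto simp: grp_def units_def)
  have rv: "op.prd b (rev \<alpha>s) = prd b \<alpha>s" if "\<forall>\<alpha>\<in>I. b \<alpha> \<in> grp \<alpha>" for b
    unfolding op.prd_def using product_descending_eq[OF gI[OF that] cl] by simp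
  have "\<exists>b. (\<forall>\<alpha>\<in>I. b \<alpha> \<in> grp \<alpha>) \<and> x = prd b \<alpha>s" if x: "x \<in> units"
  proof -
    have xe: "x - e \<in> L (set \<alpha>s)" using x unit_in \<alpha>s by (auto simp: units_def intro: L_diff)
    from sort show ?thesis
    proof
      assume "sorted (map card \<alpha>s)"
      then have "absorbing \<alpha>s" using \<alpha>s I by (intro absorbing_sorted) auto
      then show ?thesis using product_exists[OF _ _ cl x xe] \<alpha>s by auto
    next
      assume "sorted (rev (map card \<alpha>s))"
      then have "absorbing (rev \<alpha>s)" using \<alpha>s I by (intro absorbing_sorted) (auto simp: rev_map)
      then obtain b where "\<forall>\<alpha>\<in>I. b \<alpha> \<in> grp \<alpha>" "x = op.prd b (rev \<alpha>s)"
        using op.product_exists[of "rev \<alpha>s" x] cl x xe \<alpha>s by (auto simp: u g)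
      then show ?thesis using rv by auto
    qed
  qed
  moreover have "prd b \<alpha>s \<in> units" if "\<forall>\<alpha>\<in>I. b \<alpha> \<in> grp \<alpha>" for b
    using that \<alpha>s by (intro prd_in_units cl) (auto simp: grp_def)
  ultimately show "x \<in> units \<longleftrightarrow> (\<exists>b. (\<forall>\<alpha>\<in>I. b \<alpha> \<in> grp \<alpha>) \<and> x = prd b \<alpha>s)" by blast
  assume b: "\<forall>\<alpha>\<in>I. b \<alpha> \<in> grp \<alpha>" "\<forall>\<alpha>\<in>I. b' \<alpha> \<in> grp \<alpha>" "prd b \<alpha>s = prd b' \<alpha>s"
  from sort show "\<forall>\<alpha>\<in>I. b \<alpha> = b' \<alpha>"
  proof
    assume "sorted (map card \<alpha>s)"
    then have "absorbing \<alpha>s" using \<alpha>s I by (intro absorbing_sorted) auto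
    then show ?thesis using product_unique[OF _ _ cl, of \<alpha>s b b'] b \<alpha>s by auto
  next
    assume "sorted (rev (map card \<alpha>s))"
    then have "absorbing (rev \<alpha>s)" using \<alpha>s I by (intro absorbing_sorted) (auto simp: rev_map)
    then show ?thesis using op.product_unique[of "rev \<alpha>s" b b'] cl b \<alpha>s rv by (auto simp: g)
  qed
qed

end

section \<open>Sums of integral operators\<close>

text \<open>The index set, the cell of \<open>k\<close>, the cell of the integration variables, the
  matrix row and the matrix column.\<close>

type_synonym idx = "nat set \<times> (nat \<Rightarrow> nat) \<times> (nat \<Rightarrow> nat) \<times> nat \<times> nat"

context staircase_params
begin

section \<open>Almost everywhere equality as a congruence\<close>

lemma ae_refl: "u \<doteq> u"
  by (simp add: ae_eq_def)

lemma ae_sym: "u \<doteq> v \<Longrightarrow> v \<doteq> u"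
  unfolding ae_eq_def by (auto elim!: eventually_mono)

lemma ae_trans [trans]: "u \<doteq> v \<Longrightarrow> v \<doteq> w \<Longrightarrow> u \<doteq> w"
  unfolding ae_eq_def by (auto elim: eventually_elim2)

lemma ae_add_scaled: "u \<doteq> u' \<Longrightarrow> v \<doteq> v' \<Longrightarrow> (\<lambda>k j. u k j + c * v k j) \<doteq> (\<lambda>k j. u' k j + c * v' k j)"
  unfolding ae_eq_def by (erule eventually_elim2, assumption) auto

lemma ae_sum:
  assumes "finite S" "\<And>a. a \<in> S \<Longrightarrow> f a \<doteq> g a"
  shows "(\<lambda>k j. \<Sum>a\<in>S. f a k j) \<doteq> (\<lambda>k j. \<Sum>a\<in>S. g a k j)"
proof -
  have "AE k in Q. \<forall>a\<in>S. \<forall>j<M. f a k j = g a k j"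
    using assms by (intro AE_finite_allI) (auto simp: ae_eq_def)
  then show ?thesis unfolding ae_eq_def by eventually_elim (auto intro: sum.cong)
qed

lemma ae_of_space: "(\<And>k j. k \<in> space Q \<Longrightarrow> j < M \<Longrightarrow> u k j = v k j) \<Longrightarrow> u \<doteq> v"
  unfolding ae_eq_def by (intro AE_I2) auto

lemma op_refl: "F \<triangleq> F"
  by (simp add: op_eq_def ae_refl)

lemma op_sym: "F \<triangleq> G \<Longrightarrow> G \<triangleq> F"
  by (auto simp: op_eq_def intro: ae_sym)

lemma op_trans [trans]: "F \<triangleq> G \<Longrightarrow> G \<triangleq> H \<Longrightarrow> F \<triangleq> H"
  unfolding op_eq_def using ae_trans by blast

text \<open>Exchanging the inner operator changes its output on a null set. The outer operator must
  not notice this, which is what \<open>bounded_op\<close> provides for \<open>F'\<close>.\<close>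

lemma op_comp_cong:
  assumes "F \<triangleq> F'" "G \<triangleq> G'" "bounded_op N M F'" "\<And>u. u \<in> L2 N M \<Longrightarrow> G u \<in> L2 N M" "\<And>u. u \<in> L2 N M \<Longrightarrow> G' u \<in> L2 N M"
  shows "F \<circ> G \<triangleq> F' \<circ> G'"
  unfolding op_eq_def o_def
proof
  fix u assume u: "u \<in> L2 N M"
  have "F (G u) \<doteq> F' (G u)" using assms u by (auto simp: op_eq_def)
  also have "F' (G u) \<doteq> F' (G' u)" using assms u by (auto simp: op_eq_def bounded_op_def)
  finally show "F (G u) \<doteq> F' (G' u)" .
qed

lemma L2_add_scaled:
  assumes "u \<in> L2 N M" "v \<in> L2 N M" shows "(\<lambda>k j. u k j + c * v k j) \<in> L2 N M"
proof -
  have m: "(\<lambda>k. u k j + c * v k j) \<in> borel_measurable Q" if "j < M" for j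
    using that assms by (intro borel_measurable_add borel_measurable_times borel_measurable_const L2_measurable)
  have "integrable Q (\<lambda>k. (cmod (u k j + c * v k j))\<^sup>2)" if j: "j < M" for j
  proof (rule Bochner_Integration.integrable_bound)
    show "integrable Q (\<lambda>k. 2 * (cmod (u k j))\<^sup>2 + 2 * (cmod c)\<^sup>2 * (cmod (v k j))\<^sup>2)"
      using assms j by (intro Bochner_Integration.integrable_add integrable_mult_right) (auto simp: L2_def)
    show "(\<lambda>k. (cmod (u k j + c * v k j))\<^sup>2) \<in> borel_measurable Q" using m[OF j] by simp
    have "(cmod (a + c * b))\<^sup>2 \<le> 2 * (cmod a)\<^sup>2 + 2 * (cmod c)\<^sup>2 * (cmod b)\<^sup>2" for a b
    proof -
      have "(cmod (a + c * b))\<^sup>2 \<le> (cmod a + cmod (c * b))\<^sup>2"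
        by (intro power_mono norm_triangle_ineq) auto
      also have "\<dots> \<le> 2 * (cmod a)\<^sup>2 + 2 * (cmod (c * b))\<^sup>2"
        using sum_squares_ge_zero[of "cmod a - cmod (c * b)" 0]
        by (simp add: power2_eq_square algebra_simps)
      finally show ?thesis by (simp add: norm_mult power_mult_distrib)
    qed
    then show "AE k in Q. norm ((cmod (u k j + c * v k j))\<^sup>2) \<le> norm (2 * (cmod (u k j))\<^sup>2 + 2 * (cmod c)\<^sup>2 * (cmod (v k j))\<^sup>2)"
      by (intro AE_I2) (auto intro!: order_trans[OF _ abs_ge_self])
  qed
  with m show ?thesis by (simp add: L2_def)
qed

lemma L2_zero: "(\<lambda>k j. 0) \<in> L2 N M"
  by (simp add: L2_def)

lemma L2_sum:
  assumes "finite S" "\<And>a. a \<in> S \<Longrightarrow> f a \<in> L2 N M"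
  shows "(\<lambda>k j. \<Sum>a\<in>S. f a k j) \<in> L2 N M"
  using assms
proof (induction S rule: finite_induct)
  case (insert a S)
  then show ?case using L2_add_scaled[of "f a" "\<lambda>k j. \<Sum>a\<in>S. f a k j" 1] by simp
qed (simp add: L2_zero)

lemma opA_sum:
  assumes "\<alpha> \<subseteq> {..<N}" "stair \<alpha> A" "finite S" "\<And>a. a \<in> S \<Longrightarrow> f a \<in> L2 N M"
  shows "opA N M \<alpha> A (\<lambda>k j. \<Sum>a\<in>S. f a k j) \<doteq> (\<lambda>k j. \<Sum>a\<in>S. opA N M \<alpha> A (f a) k j)"
  using assms(3,4)
proof (induction S rule: finite_induct)
  case empty
  show ?case by (rule ae_of_space) (simp add: opA_def)
next
  case (insert a S)
  have "opA N M \<alpha> A (\<lambda>k j. f a k j + 1 * (\<Sum>a\<in>S. f a k j)) \<doteq>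
      (\<lambda>k j. opA N M \<alpha> A (f a) k j + 1 * opA N M \<alpha> A (\<lambda>k j. \<Sum>a\<in>S. f a k j) k j)"
    using insert by (intro opA_linear assms(1,2) L2_sum) auto
  also have "\<dots> \<doteq> (\<lambda>k j. opA N M \<alpha> A (f a) k j + 1 * (\<Sum>a\<in>S. opA N M \<alpha> A (f a) k j))"
    using insert by (intro ae_add_scaled ae_refl) auto
  finally show ?case using insert by simp
qed

lemma stair_add_scaled:
  assumes "stair \<alpha> A" "stair \<alpha> B" "finite \<alpha>"
  shows "stair \<alpha> (\<lambda>k x i j. A k x i j + s * B k x i j)"
  unfolding staircase_mat_def
  by (intro allI impI staircase_fnI p_pos assms(3) arg_cong2[where f = "(+)"] arg_cong2[where f = "(*)"] refl)
    (rule stair_cong[OF assms(1,3)] stair_cong[OF assms(2,3)], simp_all)+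

lemma stair_zero: "finite \<alpha> \<Longrightarrow> stair \<alpha> (\<lambda>_ _ _ _. 0)"
  unfolding staircase_mat_def by (intro allI impI staircase_fnI p_pos refl)

lemma stair_sum:
  assumes "finite S" "finite \<alpha>" "\<And>a. a \<in> S \<Longrightarrow> stair \<alpha> (A a)"
  shows "stair \<alpha> (\<lambda>k x i j. \<Sum>a\<in>S. A a k x i j)"
  using assms
proof (induction S rule: finite_induct)
  case (insert a S)
  then show ?case using stair_add_scaled[of \<alpha> "A a" "\<lambda>k x i j. \<Sum>a\<in>S. A a k x i j" 1] by simp
qed (simp add: stair_zero)

lemma opA_coeff_sum:
  assumes "\<alpha> \<subseteq> {..<N}" "finite S" "\<And>a. a \<in> S \<Longrightarrow> stair \<alpha> (A a)" "u \<in> L2 N M"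
  shows "opA N M \<alpha> (\<lambda>k x i j. \<Sum>a\<in>S. A a k x i j) u \<doteq> (\<lambda>k j. \<Sum>a\<in>S. opA N M \<alpha> (A a) u k j)"
  using assms(2,3)
proof (induction S rule: finite_induct)
  case empty
  show ?case by (rule ae_of_space) (simp add: opA_def)
next
  case (insert a S)
  have "opA N M \<alpha> (\<lambda>k x i j. A a k x i j + 1 * (\<Sum>a\<in>S. A a k x i j)) u \<doteq>
      (\<lambda>k j. opA N M \<alpha> (A a) u k j + 1 * opA N M \<alpha> (\<lambda>k x i j. \<Sum>a\<in>S. A a k x i j) u k j)"
    using insert by (intro opA_coeff_linear assms(1,4) stair_sum fin_sub[OF assms(1)]) auto
  also have "\<dots> \<doteq> (\<lambda>k j. opA N M \<alpha> (A a) u k j + 1 * (\<Sum>a\<in>S. opA N M \<alpha> (A a) u k j))"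
    using insert by (intro ae_add_scaled ae_refl) auto
  finally show ?case using insert by simp
qed

section \<open>Sums over all index sets, their boundedness and composition\<close>

definition stair_fam :: "(nat set \<Rightarrow> mfun) \<Rightarrow> bool" where
  "stair_fam A \<longleftrightarrow> (\<forall>\<alpha>\<subseteq>{..<N}. stair \<alpha> (A \<alpha>))"

lemma opsum_L2:
  assumes "stair_fam A" "u \<in> L2 N M" shows "opsum N M A u \<in> L2 N M"
  unfolding opsum_def using assms by (intro L2_sum opA_L2) (auto simp: stair_fam_def)

lemma opsum_cong_box:
  assumes "\<And>\<alpha> k x i j. \<alpha> \<subseteq> {..<N} \<Longrightarrow> k \<in> box {..<N} \<Longrightarrow> x \<in> box \<alpha> \<Longrightarrow> i < M \<Longrightarrow> j < M \<Longrightarrow> A \<alpha> k x i j = B \<alpha> k x i j"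
  shows "opsum N M A \<triangleq> opsum N M B"
  unfolding op_eq_def opsum_def using assms
  by (intro ballI ae_of_space sum.cong refl opA_cong_box) auto

lemma bounded_op_opsum:
  assumes A: "stair_fam A" shows "bounded_op N M (opsum N M A)"
  unfolding bounded_op_def
proof (intro conjI ballI impI allI)
  show "opsum N M A u \<in> L2 N M" if "u \<in> L2 N M" for u by (rule opsum_L2[OF A that])
  show "opsum N M A u \<doteq> opsum N M A v" if "u \<in> L2 N M" "v \<in> L2 N M" "u \<doteq> v" for u v
    unfolding opsum_def using that A by (intro ae_sum opA_cong_AE) (auto simp: stair_fam_def)
  show "opsum N M A (\<lambda>k j. u k j + c * v k j) \<doteq> (\<lambda>k j. opsum N M A u k j + c * opsum N M A v k j)"
    if "u \<in> L2 N M" "v \<in> L2 N M" for u v c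
  proof -
    have "opsum N M A (\<lambda>k j. u k j + c * v k j) \<doteq>
      (\<lambda>k j. \<Sum>\<alpha>\<in>Pow {..<N}. opA N M \<alpha> (A \<alpha>) u k j + c * opA N M \<alpha> (A \<alpha>) v k j)"
      unfolding opsum_def using that A by (intro ae_sum opA_linear) (auto simp: stair_fam_def)
    then show ?thesis by (simp add: opsum_def sum.distrib sum_distrib_left)
  qed
  have "\<exists>K\<ge>0. \<forall>u i. u \<in> L2 N M \<longrightarrow> i < M \<longrightarrow> integrable Q (\<lambda>k. (cmod (opA N M \<alpha> (A \<alpha>) u k i))\<^sup>2) \<and>
    (\<integral>k. (cmod (opA N M \<alpha> (A \<alpha>) u k i))\<^sup>2 \<partial>Q) \<le> K * (norm2 N M u)\<^sup>2" if "\<alpha> \<subseteq> {..<N}" for \<alpha>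
    using opA_square_bound[OF that, of "A \<alpha>"] A that unfolding stair_fam_def by metis
  then obtain K where K0: "\<And>\<alpha>. \<alpha> \<subseteq> {..<N} \<Longrightarrow> K \<alpha> \<ge> 0" and
    Ki: "\<And>\<alpha> u i. \<alpha> \<subseteq> {..<N} \<Longrightarrow> u \<in> L2 N M \<Longrightarrow> i < M \<Longrightarrow> integrable Q (\<lambda>k. (cmod (opA N M \<alpha> (A \<alpha>) u k i))\<^sup>2)" and
    K: "\<And>\<alpha> u i. \<alpha> \<subseteq> {..<N} \<Longrightarrow> u \<in> L2 N M \<Longrightarrow> i < M \<Longrightarrow>
        (\<integral>k. (cmod (opA N M \<alpha> (A \<alpha>) u k i))\<^sup>2 \<partial>Q) \<le> K \<alpha> * (norm2 N M u)\<^sup>2"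
    by metis
  let ?P = "Pow {..<N}"
  \<comment> \<open>Squaring the sum over the subsets costs \<open>card ?P\<close>, and summing over
    the vector components costs \<open>M\<close>.\<close>
  define C where "C = real M * (real (card ?P) * (\<Sum>\<alpha>\<in>?P. K \<alpha>))"
  have C0: "C \<ge> 0" unfolding C_def using K0 by (auto intro!: mult_nonneg_nonneg sum_nonneg)
  have "norm2 N M (opsum N M A u) \<le> sqrt C * norm2 N M u" if u: "u \<in> L2 N M" for u
  proof -
    have each: "(\<integral>k. (cmod (opsum N M A u k i))\<^sup>2 \<partial>Q) \<le> real (card ?P) * (\<Sum>\<alpha>\<in>?P. K \<alpha>) * (norm2 N M u)\<^sup>2" if i: "i < M" for i
    proof -
      have "(\<integral>k. (cmod (opsum N M A u k i))\<^sup>2 \<partial>Q) \<le> (\<integral>k. (\<Sum>\<alpha>\<in>?P. (cmod (opA N M \<alpha> (A \<alpha>) u k i))\<^sup>2) * card ?P \<partial>Q)"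
      proof (rule integral_mono)
        show "integrable Q (\<lambda>k. (cmod (opsum N M A u k i))\<^sup>2)"
          using opsum_L2[OF A u] i by (simp add: L2_def)
        show "integrable Q (\<lambda>k. (\<Sum>\<alpha>\<in>?P. (cmod (opA N M \<alpha> (A \<alpha>) u k i))\<^sup>2) * card ?P)"
          using Ki u i by (intro integrable_mult_left Bochner_Integration.integrable_sum) auto
        fix k
        have "(cmod (opsum N M A u k i))\<^sup>2 \<le> (\<Sum>\<alpha>\<in>?P. cmod (opA N M \<alpha> (A \<alpha>) u k i))\<^sup>2"
          unfolding opsum_def by (intro power_mono norm_sum) auto
        also have "\<dots> \<le> (\<Sum>\<alpha>\<in>?P. (cmod (opA N M \<alpha> (A \<alpha>) u k i))\<^sup>2) * card ?P"
          by (rule sum_squared_le_sum_of_squares)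
        finally show "(cmod (opsum N M A u k i))\<^sup>2 \<le> (\<Sum>\<alpha>\<in>?P. (cmod (opA N M \<alpha> (A \<alpha>) u k i))\<^sup>2) * card ?P" .
      qed
      also have "\<dots> = (\<Sum>\<alpha>\<in>?P. (\<integral>k. (cmod (opA N M \<alpha> (A \<alpha>) u k i))\<^sup>2 \<partial>Q)) * card ?P"
        using Ki u i by (simp del: of_nat_power)
      also have "\<dots> \<le> (\<Sum>\<alpha>\<in>?P. K \<alpha> * (norm2 N M u)\<^sup>2) * card ?P"
        using K u i by (intro mult_right_mono sum_mono) auto
      also have "\<dots> = real (card ?P) * (\<Sum>\<alpha>\<in>?P. K \<alpha>) * (norm2 N M u)\<^sup>2"
        by (simp only: sum_distrib_right[symmetric] mult_ac)
      finally show ?thesis .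
    qed
    have "(norm2 N M (opsum N M A u))\<^sup>2 \<le> (\<Sum>i<M. real (card ?P) * (\<Sum>\<alpha>\<in>?P. K \<alpha>) * (norm2 N M u)\<^sup>2)"
      unfolding norm2_squared[of "opsum N M A u"] using each by (intro sum_mono) auto
    also have "\<dots> = C * (norm2 N M u)\<^sup>2" by (simp only: C_def sum_constant card_lessThan mult.assoc)
    also have "\<dots> = (sqrt C * norm2 N M u)\<^sup>2" using C0 by (simp add: power_mult_distrib)
    finally show ?thesis using C0 norm2_nonneg by (auto intro: power2_le_imp_le)
  qed
  then show "\<exists>C. \<forall>u\<in>L2 N M. norm2 N M (opsum N M A u) \<le> C * norm2 N M u" by blast
qed

lemma opsum_coeff_linear:
  assumes "stair_fam A" "stair_fam B"
  shows "opsum N M (\<lambda>\<alpha> k x i j. A \<alpha> k x i j + s * B \<alpha> k x i j) \<triangleq> (\<lambda>u k i. opsum N M A u k i + s * opsum N M B u k i)"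
  unfolding op_eq_def
proof
  fix u assume u: "u \<in> L2 N M"
  have "opsum N M (\<lambda>\<alpha> k x i j. A \<alpha> k x i j + s * B \<alpha> k x i j) u \<doteq>
    (\<lambda>k i. \<Sum>\<alpha>\<in>Pow {..<N}. opA N M \<alpha> (A \<alpha>) u k i + s * opA N M \<alpha> (B \<alpha>) u k i)"
    unfolding opsum_def using assms u by (intro ae_sum opA_coeff_linear) (auto simp: stair_fam_def)
  then show "opsum N M (\<lambda>\<alpha> k x i j. A \<alpha> k x i j + s * B \<alpha> k x i j) u \<doteq> (\<lambda>k i. opsum N M A u k i + s * opsum N M B u k i)"
    by (simp add: opsum_def sum.distrib sum_distrib_left)
qed

text \<open>Several pairs of index sets share the same union; their composite kernels have to be
  added to obtain one kernel per index set.\<close>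

definition prod_fam :: "(nat set \<Rightarrow> mfun) \<Rightarrow> (nat set \<Rightarrow> mfun) \<Rightarrow> nat set \<Rightarrow> mfun" where
  "prod_fam A B \<gamma> k z i l = (\<Sum>q\<in>{q \<in> Pow {..<N} \<times> Pow {..<N}. fst q \<union> snd q = \<gamma>}.
      comp_coeff (fst q) (snd q) (A (fst q)) (B (snd q)) k z i l)"

lemma stair_prod_fam:
  assumes "stair_fam A" "stair_fam B" shows "stair_fam (prod_fam A B)"
  unfolding stair_fam_def
proof (intro allI impI)
  fix \<gamma> assume "\<gamma> \<subseteq> {..<N}"
  then show "stair \<gamma> (prod_fam A B \<gamma>)"
    unfolding prod_fam_def[abs_def] using assms
    by (intro stair_sum) (auto simp: stair_fam_def fin_sub intro: stair_comp_coeff)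
qed

lemma opsum_comp:
  assumes A: "stair_fam A" and B: "stair_fam B"
  shows "opsum N M A \<circ> opsum N M B \<triangleq> opsum N M (prod_fam A B)"
  unfolding op_eq_def o_def
proof
  fix u assume u: "u \<in> L2 N M"
  let ?P = "Pow {..<N}"
  let ?c = "\<lambda>q. comp_coeff (fst q) (snd q) (A (fst q)) (B (snd q))"
  have "opsum N M A (opsum N M B u) \<doteq> (\<lambda>k i. \<Sum>\<alpha>\<in>?P. \<Sum>\<beta>\<in>?P. opA N M \<alpha> (A \<alpha>) (opA N M \<beta> (B \<beta>) u) k i)"
    unfolding opsum_def[of N M A] opsum_def[of N M B] using A B u
    by (intro ae_sum opA_sum opA_L2) (auto simp: stair_fam_def)
  also have "\<dots> \<doteq> (\<lambda>k i. \<Sum>\<alpha>\<in>?P. \<Sum>\<beta>\<in>?P. opA N M (\<alpha> \<union> \<beta>) (?c (\<alpha>, \<beta>)) u k i)"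
    using A B u by (intro ae_sum) (auto simp: stair_fam_def intro: opA_comp)
  also have "\<dots> \<doteq> (\<lambda>k i. \<Sum>\<gamma>\<in>?P. \<Sum>q\<in>{q \<in> ?P \<times> ?P. fst q \<union> snd q = \<gamma>}. opA N M \<gamma> (?c q) u k i)"
  proof (rule ae_of_space)
    fix k i
    have "(\<Sum>\<alpha>\<in>?P. \<Sum>\<beta>\<in>?P. opA N M (\<alpha> \<union> \<beta>) (?c (\<alpha>, \<beta>)) u k i) = (\<Sum>q\<in>?P \<times> ?P. opA N M (fst q \<union> snd q) (?c q) u k i)"
      by (simp add: sum.cartesian_product split_def)
    also have "\<dots> = (\<Sum>\<gamma>\<in>?P. \<Sum>q\<in>{q \<in> ?P \<times> ?P. fst q \<union> snd q = \<gamma>}. opA N M (fst q \<union> snd q) (?c q) u k i)"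
      by (rule sum.group[symmetric]) auto
    also have "\<dots> = (\<Sum>\<gamma>\<in>?P. \<Sum>q\<in>{q \<in> ?P \<times> ?P. fst q \<union> snd q = \<gamma>}. opA N M \<gamma> (?c q) u k i)"
      by (intro sum.cong) auto
    finally show "(\<Sum>\<alpha>\<in>?P. \<Sum>\<beta>\<in>?P. opA N M (\<alpha> \<union> \<beta>) (?c (\<alpha>, \<beta>)) u k i) =
        (\<Sum>\<gamma>\<in>?P. \<Sum>q\<in>{q \<in> ?P \<times> ?P. fst q \<union> snd q = \<gamma>}. opA N M \<gamma> (?c q) u k i)" .
  qed
  also have "\<dots> \<doteq> opsum N M (prod_fam A B) u"
    unfolding opsum_def prod_fam_def[abs_def] using A B u
    by (intro ae_sum ae_sym[OF opA_coeff_sum]) (auto simp: stair_fam_def intro: stair_comp_coeff)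
  finally show "opsum N M A (opsum N M B u) \<doteq> opsum N M (prod_fam A B) u" .
qed

end

section \<open>The coefficient algebra\<close>

context staircase_params
begin

definition Idx :: "nat set set \<Rightarrow> idx set" where
  "Idx \<A> = {(\<alpha>, \<kappa>, \<xi>, i, j). \<alpha> \<in> \<A> \<and> \<alpha> \<subseteq> {..<N} \<and> \<kappa> \<in> PiE {..<N} (\<lambda>_. {..<p}) \<and>
      \<xi> \<in> PiE \<alpha> (\<lambda>_. {..<p}) \<and> i < M \<and> j < M}"

definition fam :: "(idx \<Rightarrow> complex) \<Rightarrow> nat set \<Rightarrow> mfun" where
  "fam c \<alpha> k x i j = c (\<alpha>, cells p {..<N} k, cells p \<alpha> x, i, j)"

definition Phi :: "(idx \<Rightarrow> complex) \<Rightarrow> oper" where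
  "Phi c = opsum N M (fam c)"

text \<open>\<open>Phi\<close> reads only indices in \<open>Idx\<close> when applied at points of
  the box. Requiring zero elsewhere makes the coefficients of an operator unique.\<close>

definition Coef :: "nat set set \<Rightarrow> (idx \<Rightarrow> complex) set" where
  "Coef \<A> = {c. \<forall>z. z \<notin> Idx \<A> \<longrightarrow> c z = 0}"

lemma coeffsD: "c \<in> Coef \<A> \<Longrightarrow> z \<notin> Idx \<A> \<Longrightarrow> c z = 0"
  unfolding Coef_def by blast

lemma coeffsI: "(\<And>z. z \<notin> Idx \<A> \<Longrightarrow> c z = 0) \<Longrightarrow> c \<in> Coef \<A>"
  unfolding Coef_def by blast

abbreviation I\<^sub>N :: "nat set set" where "I\<^sub>N \<equiv> Pow {..<N}"

lemma Idx_iff: "z \<in> Idx \<A> \<longleftrightarrow> fst z \<in> \<A> \<and> z \<in> Idx I\<^sub>N"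
  by (cases z) (auto simp: Idx_def)

lemma finite_Idx: "finite (Idx \<A>)"
proof (rule finite_subset)
  show "Idx \<A> \<subseteq> I\<^sub>N \<times> PiE {..<N} (\<lambda>_. {..<p}) \<times> (\<Union>\<alpha>\<in>I\<^sub>N. PiE \<alpha> (\<lambda>_. {..<p})) \<times> {..<M} \<times> {..<M}"
    by (auto simp: Idx_def)
  show "finite (I\<^sub>N \<times> PiE {..<N} (\<lambda>_. {..<p}) \<times> (\<Union>\<alpha>\<in>I\<^sub>N. PiE \<alpha> (\<lambda>_. {..<p})) \<times> {..<M} \<times> {..<M})"
    by (intro finite_cartesian_product finite_UN_I finite_PiE) (auto simp: fin_sub)
qed

lemma fam_stair: "stair_fam (fam c)"
  unfolding stair_fam_def staircase_mat_def
  by (intro allI impI, subst staircase_fn_iff) (auto simp: fam_def p_pos fin_sub)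

lemma bounded_op_Phi: "bounded_op N M (Phi c)"
  unfolding Phi_def by (intro bounded_op_opsum fam_stair)

lemma Phi_L2: "u \<in> L2 N M \<Longrightarrow> Phi c u \<in> L2 N M"
  unfolding Phi_def by (intro opsum_L2 fam_stair)

text \<open>Kernel values are sampled at cell corners. The pointwise agreement in the third
  conclusion is kept because the norm is a supremum of kernel values.\<close>

lemma coeffs_exist:
  assumes A: "stair_fam A"
    and van: "\<And>\<alpha> k x i j. \<alpha> \<subseteq> {..<N} \<Longrightarrow> \<alpha> \<notin> \<A> \<Longrightarrow> k \<in> box {..<N} \<Longrightarrow> x \<in> box \<alpha> \<Longrightarrow> i < M \<Longrightarrow> j < M \<Longrightarrow> A \<alpha> k x i j = 0"
  obtains c where "c \<in> Coef \<A>" "opsum N M A \<triangleq> Phi c"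
    "\<And>\<alpha> k x i j. \<alpha> \<subseteq> {..<N} \<Longrightarrow> k \<in> box {..<N} \<Longrightarrow> x \<in> box \<alpha> \<Longrightarrow> i < M \<Longrightarrow> j < M \<Longrightarrow> fam c \<alpha> k x i j = A \<alpha> k x i j"
proof -
  define c where "c = (\<lambda>z. if z \<in> Idx \<A> then case z of (\<alpha>, \<kappa>, \<xi>, i, j) \<Rightarrow> A \<alpha> (corner p \<kappa>) (corner p \<xi>) i j else 0)"
  have eq: "fam c \<alpha> k x i j = A \<alpha> k x i j"
    if \<alpha>: "\<alpha> \<subseteq> {..<N}" and k: "k \<in> box {..<N}" and x: "x \<in> box \<alpha>" and ij: "i < M" "j < M" for \<alpha> k x i j
  proof (cases "\<alpha> \<in> \<A>")
    case True
    note kx = cells_in[OF p_pos k] cells_in[OF p_pos x]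
    have "cell p (corner p (cells p I y) n) = cell p (y n)" if "n \<in> I" for n I y
      using that p_pos by (simp add: corner_def cells_def cell_corner)
    then have "A \<alpha> (corner p (cells p {..<N} k)) (corner p (cells p \<alpha> x)) i j = A \<alpha> k x i j"
      using A \<alpha> k x ij kx p_pos
      by (intro stair_cong corner_in_box) (auto simp: stair_fam_def fin_sub)
    then show ?thesis using True \<alpha> ij kx by (simp add: fam_def c_def Idx_def)
  next
    case False
    then show ?thesis using van[OF \<alpha> False k x ij] by (simp add: fam_def c_def Idx_def)
  qed
  show ?thesis
  proof (rule that)
    show "c \<in> Coef \<A>" by (rule coeffsI) (simp add: c_def)
    show "opsum N M A \<triangleq> Phi c" unfolding Phi_def using eq by (intro opsum_cong_box) auto
  qed (rule eq)
qed

lemma Phi_add_scaled: "Phi (\<lambda>z. c z + s * d z) \<triangleq> (\<lambda>u k i. Phi c u k i + s * Phi d u k i)"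
  using opsum_coeff_linear[OF fam_stair fam_stair, of c s d] by (simp add: Phi_def fam_def[abs_def])

text \<open>Every index is realised by the corners of its cells, where the uniqueness of kernels
  forces the value to be zero.\<close>

lemma Phi_eq_zero:
  assumes "c \<in> Coef I\<^sub>N" "Phi c \<triangleq> zero_op" shows "c = 0"
proof
  fix z show "c z = 0 z"
  proof (cases "z \<in> Idx I\<^sub>N")
    case True
    obtain \<alpha> \<kappa> \<xi> i j where z: "z = (\<alpha>, \<kappa>, \<xi>, i, j)" by (cases z)
    have *: "\<alpha> \<subseteq> {..<N}" "\<kappa> \<in> PiE {..<N} (\<lambda>_. {..<p})" "\<xi> \<in> PiE \<alpha> (\<lambda>_. {..<p})" "i < M" "j < M"
      using True by (auto simp: z Idx_def)
    have "fam c \<alpha> (corner p \<kappa>) (corner p \<xi>) i j = 0"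
      using assms(2) fam_stair[of c] * p_pos unfolding Phi_def
      by (intro opsum_eq_zero_imp[of "fam c"] corner_in_box) (auto simp: stair_fam_def)
    then show ?thesis using * p_pos by (simp add: fam_def cells_corner z)
  qed (use coeffsD[OF assms(1)] in simp)
qed

lemma Phi_inj:
  assumes "c \<in> Coef I\<^sub>N" "d \<in> Coef I\<^sub>N" "Phi c \<triangleq> Phi d" shows "c = d"
proof -
  define f where "f = (\<lambda>z. c z + (-1) * d z)"
  have "Phi f \<triangleq> (\<lambda>u k i. Phi c u k i + (-1) * Phi d u k i)" unfolding f_def by (rule Phi_add_scaled)
  also have "\<dots> \<triangleq> zero_op"
    using assms(3) unfolding op_eq_def ae_eq_def zero_op_def by (auto elim!: eventually_mono ballE)
  finally have "Phi f \<triangleq> zero_op" .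
  moreover have "f \<in> Coef I\<^sub>N"
    using coeffsD[OF assms(1)] coeffsD[OF assms(2)] by (intro coeffsI) (simp add: f_def)
  ultimately have "f = 0" by (intro Phi_eq_zero)
  then have "f z = 0" for z by simp
  then show ?thesis by (auto simp: f_def fun_eq_iff)
qed

text \<open>The product is transported from composition. It is well defined by
  \<open>Phi_inj\<close>, so no explicit formula is needed: a law holds as soon as both sides lie in
  \<open>Coef\<close> and represent the same operator.\<close>

definition coeff_mult :: "(idx \<Rightarrow> complex) \<Rightarrow> (idx \<Rightarrow> complex) \<Rightarrow> idx \<Rightarrow> complex" (infixl "\<odot>" 70) where
  "c \<odot> d = (SOME f. f \<in> Coef I\<^sub>N \<and> Phi c \<circ> Phi d \<triangleq> Phi f)"

lemma coeffs_mono: "\<A> \<subseteq> \<B> \<Longrightarrow> c \<in> Coef \<A> \<Longrightarrow> c \<in> Coef \<B>"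
  by (rule coeffsI, erule coeffsD) (metis Idx_iff subsetD)

lemma coeffs_I: "c \<in> Coef \<A> \<Longrightarrow> c \<in> Coef I\<^sub>N"
  by (rule coeffsI, erule coeffsD) (metis Idx_iff)

lemma coeff_mult:
  shows "c \<odot> d \<in> Coef I\<^sub>N" and "Phi c \<circ> Phi d \<triangleq> Phi (c \<odot> d)"
proof -
  have "\<exists>f. f \<in> Coef I\<^sub>N \<and> Phi c \<circ> Phi d \<triangleq> Phi f"
    using coeffs_exist[OF stair_prod_fam[OF fam_stair fam_stair], of I\<^sub>N c d]
      op_trans[OF opsum_comp[OF fam_stair fam_stair, folded Phi_def], of c d] by (metis Pow_iff)
  from someI_ex[OF this] show "c \<odot> d \<in> Coef I\<^sub>N" and "Phi c \<circ> Phi d \<triangleq> Phi (c \<odot> d)"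
    unfolding coeff_mult_def by auto
qed

lemma coeff_mult_eqI: "f \<in> Coef I\<^sub>N \<Longrightarrow> Phi c \<circ> Phi d \<triangleq> Phi f \<Longrightarrow> c \<odot> d = f"
  using coeff_mult[of c d] by (intro Phi_inj) (auto intro: op_trans op_sym)

text \<open>The kernel of the composite vanishes at every index set outside \<open>\<C>\<close>, so
  it has coefficients supported there, and uniqueness identifies them with the product.\<close>

lemma coeff_mult_graded:
  assumes "\<forall>a\<in>\<A>. \<forall>b\<in>\<B>. a \<union> b \<in> \<C>" "c \<in> Coef \<A>" "d \<in> Coef \<B>"
  shows "c \<odot> d \<in> Coef \<C>"
proof -
  have z: "fam c \<alpha> = (\<lambda>_ _ _ _. 0)" if "\<alpha> \<notin> \<A>" "c \<in> Coef \<A>" for c \<alpha> \<A>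
    using coeffsD[OF that(2)] that(1) by (simp add: fam_def fun_eq_iff Idx_def)
  have "prod_fam (fam c) (fam d) \<gamma> k x i j = 0" if "\<gamma> \<notin> \<C>" for \<gamma> k x i j
    unfolding prod_fam_def
  proof (rule sum.neutral, clarify)
    fix \<alpha> \<beta> assume "\<gamma> = fst (\<alpha>, \<beta>) \<union> snd (\<alpha>, \<beta>)"
    then have "\<alpha> \<notin> \<A> \<or> \<beta> \<notin> \<B>" using assms(1) that by auto
    then show "comp_coeff (fst (\<alpha>, \<beta>)) (snd (\<alpha>, \<beta>)) (fam c (fst (\<alpha>, \<beta>))) (fam d (snd (\<alpha>, \<beta>))) k x i j = 0"
      using z[OF _ assms(2)] z[OF _ assms(3)] by (auto simp: comp_coeff_def)
  qed
  then obtain f where f: "f \<in> Coef \<C>" "opsum N M (prod_fam (fam c) (fam d)) \<triangleq> Phi f"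
    using coeffs_exist[OF stair_prod_fam[OF fam_stair fam_stair], of \<C> c d] by metis
  then have "c \<odot> d = f"
    using opsum_comp[OF fam_stair fam_stair, of c d]
    by (intro coeff_mult_eqI) (auto simp: Phi_def intro: op_trans coeffs_I)
  then show ?thesis using f by simp
qed

lemma coeff_mult_assoc: "(c \<odot> d) \<odot> f = c \<odot> (d \<odot> f)"
proof (rule coeff_mult_eqI)
  have "Phi (c \<odot> d) \<circ> Phi f \<triangleq> (Phi c \<circ> Phi d) \<circ> Phi f"
    by (intro op_sym[OF op_comp_cong] coeff_mult op_refl bounded_op_Phi Phi_L2)
  also have "(Phi c \<circ> Phi d) \<circ> Phi f = Phi c \<circ> (Phi d \<circ> Phi f)" by (rule comp_assoc)
  also have "\<dots> \<triangleq> Phi c \<circ> Phi (d \<odot> f)"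
    by (intro op_comp_cong coeff_mult op_refl bounded_op_Phi) (auto intro: Phi_L2)
  also have "\<dots> \<triangleq> Phi (c \<odot> (d \<odot> f))" by (rule coeff_mult)
  finally show "Phi (c \<odot> d) \<circ> Phi f \<triangleq> Phi (c \<odot> (d \<odot> f))" .
qed (rule coeff_mult)

lemma coeffs_add_scaled: "c \<in> Coef \<A> \<Longrightarrow> d \<in> Coef \<A> \<Longrightarrow> (\<lambda>z. c z + s * d z) \<in> Coef \<A>"
  by (rule coeffsI) (simp add: coeffsD)

lemma coeff_mult_linear_left: "(\<lambda>z. c z + s * d z) \<odot> f = (\<lambda>z. (c \<odot> f) z + s * (d \<odot> f) z)"
proof (rule coeff_mult_eqI)
  have "Phi (\<lambda>z. c z + s * d z) \<circ> Phi f \<triangleq> (\<lambda>u k i. (Phi c \<circ> Phi f) u k i + s * (Phi d \<circ> Phi f) u k i)"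
    using Phi_add_scaled[of c s d] Phi_L2 by (auto simp: op_eq_def)
  also have "\<dots> \<triangleq> (\<lambda>u k i. Phi (c \<odot> f) u k i + s * Phi (d \<odot> f) u k i)"
    using coeff_mult(2)[of c f] coeff_mult(2)[of d f] unfolding op_eq_def by (auto intro: ae_add_scaled)
  also have "\<dots> \<triangleq> Phi (\<lambda>z. (c \<odot> f) z + s * (d \<odot> f) z)" by (rule op_sym[OF Phi_add_scaled])
  finally show "Phi (\<lambda>z. c z + s * d z) \<circ> Phi f \<triangleq> Phi (\<lambda>z. (c \<odot> f) z + s * (d \<odot> f) z)" .
qed (intro coeffs_add_scaled coeff_mult)

text \<open>In contrast to the left factor, where sums are taken pointwise, this rests on the
  linearity of the operator \<open>Phi f\<close> itself.\<close>

lemma coeff_mult_linear_right: "f \<odot> (\<lambda>z. c z + s * d z) = (\<lambda>z. (f \<odot> c) z + s * (f \<odot> d) z)"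
proof (rule coeff_mult_eqI)
  have "Phi f \<circ> Phi (\<lambda>z. c z + s * d z) \<triangleq> (\<lambda>u. Phi f (\<lambda>k i. Phi c u k i + s * Phi d u k i))"
    using op_comp_cong[OF op_refl Phi_add_scaled[of c s d] bounded_op_Phi Phi_L2 L2_add_scaled[OF Phi_L2 Phi_L2], of f]
    by (simp add: o_def)
  also have "\<dots> \<triangleq> (\<lambda>u k i. (Phi f \<circ> Phi c) u k i + s * (Phi f \<circ> Phi d) u k i)"
    using bounded_op_Phi[of f] Phi_L2 unfolding bounded_op_def op_eq_def by auto
  also have "\<dots> \<triangleq> (\<lambda>u k i. Phi (f \<odot> c) u k i + s * Phi (f \<odot> d) u k i)"
    using coeff_mult(2)[of f c] coeff_mult(2)[of f d] unfolding op_eq_def by (auto intro: ae_add_scaled)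
  also have "\<dots> \<triangleq> Phi (\<lambda>z. (f \<odot> c) z + s * (f \<odot> d) z)" by (rule op_sym[OF Phi_add_scaled])
  finally show "Phi f \<circ> Phi (\<lambda>z. c z + s * d z) \<triangleq> Phi (\<lambda>z. (f \<odot> c) z + s * (f \<odot> d) z)" .
qed (intro coeffs_add_scaled coeff_mult)

lemma coeff_mult_add_left: "(c + d) \<odot> f = c \<odot> f + d \<odot> f"
  using coeff_mult_linear_left[of c 1 d f] by (simp add: plus_fun_def)

lemma coeff_mult_add_right: "f \<odot> (c + d) = f \<odot> c + f \<odot> d"
  using coeff_mult_linear_right[of f c 1 d] by (simp add: plus_fun_def)

text \<open>For the empty index set the integral runs over a one-point probability space, so the
  operator is multiplication, here by the identity matrix.\<close>

lemma Iop_opsum: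
  "opsum N M (\<lambda>\<alpha> k x i j. if \<alpha> = {} \<and> i = j then 1 else 0) \<triangleq> Iop" (is "opsum N M ?A \<triangleq> _")
  unfolding op_eq_def
proof (intro ballI ae_of_space)
  fix u k i assume i: "i < M"
  have "opA N M {} (?A {}) u k i = (\<integral>x. u k i \<partial>Qm {})"
  proof -
    have "(\<Sum>j<M. ?A {} k x i j * u (merge {} k x) j) = u k i" for x
      using i by (simp add: merge_def if_distrib[of "\<lambda>t. t * _"] cong: if_cong)
    then show ?thesis using i by (simp add: opA_def)
  qed
  also have "\<dots> = u k i" using measure_space_Qm[of "{}"] by simp
  finally have "opA N M {} (?A {}) u k i = u k i" .
  moreover have "opA N M \<alpha> (?A \<alpha>) u k i = 0" if "\<alpha> \<noteq> {}" for \<alpha> using that by (simp add: opA_def)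
  ultimately show "opsum N M ?A u k i = Iop u k i"
    unfolding opsum_def Iop_def by (subst sum.remove[of _ "{}"]) (auto intro: sum.neutral)
qed

definition one_coeff :: "idx \<Rightarrow> complex" where
  "one_coeff = (SOME c. c \<in> Coef {{}} \<and> Iop \<triangleq> Phi c)"

lemma one_coeff: "one_coeff \<in> Coef {{}}" "Iop \<triangleq> Phi one_coeff"
proof -
  have "stair_fam (\<lambda>\<alpha> k x i j. if \<alpha> = {} \<and> i = j then 1 else 0)"
    unfolding stair_fam_def staircase_mat_def by (intro allI impI staircase_fnI p_pos refl fin_sub)
  then obtain c where "c \<in> Coef {{}}" "opsum N M (\<lambda>\<alpha> k x i j. if \<alpha> = {} \<and> i = j then 1 else 0) \<triangleq> Phi c"
    by (rule coeffs_exist[of _ "{{}}"]) auto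
  then have "\<exists>c. c \<in> Coef {{}} \<and> Iop \<triangleq> Phi c" using Iop_opsum op_trans op_sym by blast
  from someI_ex[OF this] show "one_coeff \<in> Coef {{}}" "Iop \<triangleq> Phi one_coeff"
    unfolding one_coeff_def by auto
qed

lemma one_coeff_left: "c \<in> Coef I\<^sub>N \<Longrightarrow> one_coeff \<odot> c = c"
proof (rule coeff_mult_eqI)
  have "Phi one_coeff \<circ> Phi c \<triangleq> Iop \<circ> Phi c"
    by (rule op_sym[OF op_comp_cong[OF one_coeff(2) op_refl bounded_op_Phi]]) (auto intro: Phi_L2)
  then show "Phi one_coeff \<circ> Phi c \<triangleq> Phi c" by (simp add: Iop_def o_def)
qed

lemma one_coeff_right: "c \<in> Coef I\<^sub>N \<Longrightarrow> c \<odot> one_coeff = c"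
proof (rule coeff_mult_eqI)
  have "Phi c \<circ> Phi one_coeff \<triangleq> Phi c \<circ> Iop"
    by (rule op_comp_cong[OF op_refl op_sym[OF one_coeff(2)] bounded_op_Phi]) (auto intro: Phi_L2 simp: Iop_def)
  then show "Phi c \<circ> Phi one_coeff \<triangleq> Phi c" by (simp add: Iop_def o_def)
qed

lemma coeffs_zero: "0 \<in> Coef \<A>"
  by (rule coeffsI) simp

lemma coeffs_add: "c \<in> Coef \<A> \<Longrightarrow> d \<in> Coef \<A> \<Longrightarrow> c + d \<in> Coef \<A>"
  by (rule coeffsI) (simp add: coeffsD)

lemma coeffs_diff: "c \<in> Coef \<A> \<Longrightarrow> d \<in> Coef \<A> \<Longrightarrow> c - d \<in> Coef \<A>"
  by (rule coeffsI) (simp add: coeffsD)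

lemma coeffs_minus: "c \<in> Coef \<A> \<Longrightarrow> - c \<in> Coef \<A>"
  by (rule coeffsI) (simp add: coeffsD)

text \<open>Left multiplication by a left-cancellable \<open>x\<close> is an injective, hence surjective, endomorphism
  of the finite-dimensional space of coefficients supported on \<open>\<A>\<close>.\<close>

lemma right_inverse_exists:
  assumes cl: "\<forall>a\<in>\<A>. \<forall>b\<in>\<A>. a \<union> b \<in> \<A>" and x: "x - one_coeff \<in> Coef \<A>"
    and canc: "\<And>a. a \<in> Coef I\<^sub>N \<Longrightarrow> x \<odot> a = 0 \<Longrightarrow> a = 0"
  shows "\<exists>a\<in>Coef \<A>. x \<odot> (one_coeff + a) = one_coeff"
proof -
  define k where "k = x - one_coeff"
  have k: "k \<in> Coef \<A>" using x by (simp add: k_def)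
  have xk: "x = one_coeff + k" by (simp add: k_def)
  have xI: "x \<in> Coef I\<^sub>N" unfolding xk using k one_coeff(1) by (intro coeffs_add) (auto intro: coeffs_I)
  \<comment> \<open>Although \<open>x\<close> itself need not lie in \<open>Coef \<A>\<close>, it
    maps this space into itself, because its unit part acts trivially.\<close>
  have st: "x \<odot> a \<in> Coef \<A>" if a: "a \<in> Coef \<A>" for a
  proof -
    have "x \<odot> a = a + k \<odot> a" unfolding xk using coeffs_I[OF a] by (simp add: coeff_mult_add_left one_coeff_left)
    then show ?thesis using a coeff_mult_graded[OF cl k a] by (simp add: coeffs_add)
  qed
  \<comment> \<open>Solving \<open>x \<odot> a = - k\<close> gives
    \<open>x \<odot> (one_coeff + a) = x - k\<close>, which is the unit.\<close>
  have "\<exists>a. (\<forall>z. z \<notin> Idx \<A> \<longrightarrow> a z = 0) \<and> (\<forall>z\<in>Idx \<A>. (x \<odot> a) z = (- k) z)"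
  proof (rule finite_support_injective_imp_surjective[OF finite_Idx])
    fix a b s z
    show "(x \<odot> (\<lambda>z. a z + s * b z)) z = (x \<odot> a) z + s * (x \<odot> b) z" by (simp add: coeff_mult_linear_right)
  next
    fix a :: "idx \<Rightarrow> complex"
    assume "\<And>z. z \<notin> Idx \<A> \<Longrightarrow> a z = 0" and z: "\<And>z. z \<in> Idx \<A> \<Longrightarrow> (x \<odot> a) z = 0"
    then have a: "a \<in> Coef \<A>" by (intro coeffsI)
    have "x \<odot> a = 0"
    proof
      fix w show "(x \<odot> a) w = 0 w" using coeffsD[OF st[OF a]] z by (cases "w \<in> Idx \<A>") simp_all
    qed
    then have "a = 0" using canc coeffs_I[OF a] by blast
    then show "a = (\<lambda>_. 0)" by (simp add: zero_fun_def)
  qed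
  then obtain a where a: "a \<in> Coef \<A>" and eq: "\<And>z. z \<in> Idx \<A> \<Longrightarrow> (x \<odot> a) z = (- k) z"
    using coeffsI by blast
  have "x \<odot> a = - k"
  proof
    fix z show "(x \<odot> a) z = (- k) z"
      using eq coeffsD[OF st[OF a]] coeffsD[OF coeffs_minus[OF k]] by (cases "z \<in> Idx \<A>") simp_all
  qed
  then have "x \<odot> (one_coeff + a) = one_coeff"
    using xI by (simp add: coeff_mult_add_right one_coeff_right k_def)
  with a show ?thesis by blast
qed

lemma coeff_mult_zero: "x \<odot> 0 = 0"
  using coeff_mult_add_right[of x 0 0] by simp

text \<open>A right inverse \<open>y\<close> satisfies
  \<open>x \<odot> (y \<odot> x - one_coeff) = 0\<close>, and cancelling \<open>x\<close> makes it
  two-sided.\<close>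

lemma left_cancellable_invertible:
  assumes cl: "\<forall>a\<in>\<A>. \<forall>b\<in>\<A>. a \<union> b \<in> \<A>" and x: "x - one_coeff \<in> Coef \<A>"
    and canc: "\<And>a. a \<in> Coef I\<^sub>N \<Longrightarrow> x \<odot> a = 0 \<Longrightarrow> a = 0"
  shows "\<exists>y. y - one_coeff \<in> Coef \<A> \<and> x \<odot> y = one_coeff \<and> y \<odot> x = one_coeff"
proof -
  obtain a where a: "a \<in> Coef \<A>" and xa: "x \<odot> (one_coeff + a) = one_coeff"
    using right_inverse_exists[OF assms] by blast
  define y where "y = one_coeff + a"
  have oI: "one_coeff \<in> Coef I\<^sub>N" by (rule coeffs_I[OF one_coeff(1)])
  have xI: "x \<in> Coef I\<^sub>N" using coeffs_add[OF coeffs_I[OF x] oI] by simp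
  have xy: "x \<odot> y = one_coeff" using xa by (simp add: y_def)
  have "x \<odot> (y \<odot> x) = x \<odot> one_coeff"
    unfolding coeff_mult_assoc[symmetric] xy using xI by (simp add: one_coeff_left one_coeff_right)
  then have "x \<odot> (y \<odot> x - one_coeff) = 0"
    using coeff_mult_add_right[of x "y \<odot> x - one_coeff" one_coeff] by simp
  then have "y \<odot> x - one_coeff = 0" by (rule canc[OF coeffs_diff[OF coeff_mult(1) oI]])
  then have "y \<odot> x = one_coeff" by simp
  then show ?thesis using a xy by (intro exI[of _ y]) (simp add: y_def)
qed

text \<open>The axiom on inverses compares the given \<open>y\<close> with the inverse constructed
  inside the span of \<open>\<A>\<close>; the two agree because inverses are unique.\<close>

sublocale union_graded_algebra "(\<odot>)" one_coeff Coef I\<^sub>N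
proof
  fix \<A> \<B> and x :: "idx \<Rightarrow> complex"
  show "\<exists>y\<in>Coef \<A>. \<exists>z\<in>Coef \<B>. x = y + z" if "x \<in> Coef (\<A> \<union> \<B>)"
  proof (rule bexI, rule bexI)
    show "x = (\<lambda>z. if z \<in> Idx \<A> then x z else 0) + (\<lambda>z. if z \<in> Idx \<A> then 0 else x z)"
      by (rule ext) simp
    show "(\<lambda>z. if z \<in> Idx \<A> then 0 else x z) \<in> Coef \<B>"
      using coeffsD[OF that] by (intro coeffsI) (metis Idx_iff Un_iff)
    show "(\<lambda>z. if z \<in> Idx \<A> then x z else 0) \<in> Coef \<A>" by (rule coeffsI) simp
  qed
  show "x = 0" if "\<A> \<inter> \<B> = {}" "x \<in> Coef \<A>" "x \<in> Coef \<B>"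
  proof
    fix z show "x z = 0 z"
      using coeffsD[OF that(2)] coeffsD[OF that(3)] that(1) by (metis Idx_iff disjoint_iff zero_fun_apply)
  qed
next
  fix \<A> x y assume cl: "\<forall>a\<in>\<A>. \<forall>b\<in>\<A>. a \<union> b \<in> \<A>" and x: "x - one_coeff \<in> Coef \<A>"
    and y: "y \<in> Coef I\<^sub>N" and xy: "x \<odot> y = one_coeff" "y \<odot> x = one_coeff"
  have "a = 0" if "a \<in> Coef I\<^sub>N" "x \<odot> a = 0" for a
    using that xy coeff_mult_assoc[of y x a] by (simp add: one_coeff_left coeff_mult_zero)
  then obtain y' where y': "y' - one_coeff \<in> Coef \<A>" "x \<odot> y' = one_coeff"
    using left_cancellable_invertible[OF cl x] by blast
  have oI: "one_coeff \<in> Coef I\<^sub>N" by (rule coeffs_I[OF one_coeff(1)])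
  have y'I: "y' \<in> Coef I\<^sub>N" using coeffs_add[OF coeffs_I[OF y'(1)] oI] by simp
  have "y = y \<odot> (x \<odot> y')" using y' y by (simp add: one_coeff_right)
  also have "\<dots> = y'" unfolding coeff_mult_assoc[symmetric] xy using y'I by (simp add: one_coeff_left)
  finally show "y - one_coeff \<in> Coef \<A>" using y' by simp
qed (auto simp: coeff_mult_assoc coeff_mult_add_left coeff_mult_add_right one_coeff_left one_coeff_right coeffs_zero
    intro: coeffs_diff coeffs_mono coeff_mult_graded coeffs_I[OF one_coeff(1)])

end

section \<open>Operators and their coefficients\<close>

context staircase_params
begin

definition has_coeff :: "oper \<Rightarrow> (idx \<Rightarrow> complex) \<Rightarrow> bool" where
  "has_coeff F c \<longleftrightarrow> c \<in> Coef I\<^sub>N \<and> F \<triangleq> Phi c"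

text \<open>Kept apart from \<open>has_coeff\<close>, since altering values on a null set can
  destroy Borel measurability. It is needed for the inner operator of a composition.\<close>

definition L2_map :: "oper \<Rightarrow> bool" where
  "L2_map F \<longleftrightarrow> (\<forall>u\<in>L2 N M. F u \<in> L2 N M)"

lemma has_coeff_Phi: "c \<in> Coef \<A> \<Longrightarrow> has_coeff (Phi c) c"
  by (auto simp: has_coeff_def op_refl intro: coeffs_I)

lemma has_coeff_op_eq_iff: "has_coeff F c \<Longrightarrow> has_coeff G d \<Longrightarrow> F \<triangleq> G \<longleftrightarrow> c = d"
  unfolding has_coeff_def using Phi_inj op_trans op_sym by metis

lemma has_coeff_cong: "F \<triangleq> G \<Longrightarrow> has_coeff G c \<Longrightarrow> has_coeff F c"
  unfolding has_coeff_def using op_trans by blast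

lemma has_coeff_linear:
  assumes "has_coeff F c" "has_coeff G d"
  shows "has_coeff (\<lambda>u k i. F u k i + s * G u k i) (\<lambda>z. c z + s * d z)"
proof -
  have "(\<lambda>u k i. F u k i + s * G u k i) \<triangleq> (\<lambda>u k i. Phi c u k i + s * Phi d u k i)"
    using assms unfolding has_coeff_def op_eq_def by (auto intro: ae_add_scaled)
  also have "\<dots> \<triangleq> Phi (\<lambda>z. c z + s * d z)" by (rule op_sym[OF Phi_add_scaled])
  finally show ?thesis using assms by (auto simp: has_coeff_def intro: coeffs_add_scaled)
qed

lemma has_coeff_add: "has_coeff F c \<Longrightarrow> has_coeff G d \<Longrightarrow> has_coeff (op_add F G) (c + d)"
  using has_coeff_linear[of F c G d 1] by (simp add: op_add_def plus_fun_def)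

lemma has_coeff_sub: "has_coeff F c \<Longrightarrow> has_coeff G d \<Longrightarrow> has_coeff (op_sub F G) (c - d)"
  using has_coeff_linear[of F c G d "-1"] by (simp add: op_sub_def fun_diff_def)

lemma has_coeff_zero: "has_coeff zero_op 0"
proof -
  have "Phi 0 = zero_op"
    by (simp add: Phi_def opsum_def opA_def fam_def zero_op_def fun_eq_iff cong: if_cong)
  then show ?thesis by (simp add: has_coeff_def coeffs_zero op_refl)
qed

lemma has_coeff_scale: "has_coeff F c \<Longrightarrow> has_coeff (op_scale s F) (\<lambda>z. s * c z)"
  using has_coeff_linear[OF has_coeff_zero, of F c s] by (simp add: op_scale_def zero_op_def)

lemma has_coeff_Iop: "has_coeff Iop one_coeff"
  by (simp add: has_coeff_def one_coeff(2) coeffs_I[OF one_coeff(1)])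

lemma has_coeff_comp:
  assumes "has_coeff F c" "has_coeff G d" "L2_map G" shows "has_coeff (F \<circ> G) (c \<odot> d)"
proof -
  have "F \<circ> G \<triangleq> Phi c \<circ> Phi d"
    using assms by (intro op_comp_cong bounded_op_Phi) (auto simp: has_coeff_def L2_map_def intro: Phi_L2)
  also have "\<dots> \<triangleq> Phi (c \<odot> d)" by (rule coeff_mult)
  finally show ?thesis by (simp add: has_coeff_def coeff_mult)
qed

lemma has_coeff_sum:
  assumes "finite S" "\<And>a. a \<in> S \<Longrightarrow> has_coeff (B a) (b a)"
  shows "has_coeff (\<lambda>u k i. \<Sum>a\<in>S. B a u k i) (\<Sum>a\<in>S. b a)"
  using assms
proof (induction S rule: finite_induct)
  case empty
  then show ?case using has_coeff_zero by (simp add: zero_op_def zero_fun_def)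
next
  case (insert a S)
  then show ?case using has_coeff_add[of "B a" "b a" "\<lambda>u k i. \<Sum>a\<in>S. B a u k i"] by (simp add: op_add_def plus_fun_def)
qed

lemma opA_as_opsum:
  assumes "\<alpha> \<subseteq> {..<N}" "\<And>\<beta>. \<beta> \<subseteq> {..<N} \<Longrightarrow> \<beta> \<noteq> \<alpha> \<Longrightarrow> A \<beta> = (\<lambda>_ _ _ _. 0)"
  shows "opsum N M A = opA N M \<alpha> (A \<alpha>)"
proof (intro ext)
  fix u k i
  show "opsum N M A u k i = opA N M \<alpha> (A \<alpha>) u k i"
    unfolding opsum_def using assms
    by (subst sum.remove[of _ \<alpha>]) (auto intro!: sum.neutral simp: opA_def cong: if_cong)
qed

section \<open>Dictionary between operator classes and coefficient sets\<close>

lemma Lset_has_coeff: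
  assumes "\<alpha> \<in> I\<^sub>N" "F \<in> Lset N M p \<alpha>"
  shows "\<exists>c\<in>Coef {\<alpha>}. has_coeff F c" "L2_map F"
proof -
  obtain A where A: "F = opA N M \<alpha> A" "stair \<alpha> A" using assms by (auto simp: Lset_def)
  define B where "B \<beta> = (if \<beta> = \<alpha> then A else (\<lambda>_ _ _ _. 0))" for \<beta>
  have B: "stair_fam B" using A by (auto simp: stair_fam_def B_def stair_zero fin_sub)
  then obtain c where "c \<in> Coef {\<alpha>}" "opsum N M B \<triangleq> Phi c"
    by (rule coeffs_exist[of _ "{\<alpha>}"]) (auto simp: B_def)
  moreover have FB: "F = opsum N M B" using assms A by (subst opA_as_opsum[of \<alpha>]) (auto simp: B_def)
  ultimately show "\<exists>c\<in>Coef {\<alpha>}. has_coeff F c" by (auto simp: has_coeff_def intro: coeffs_I)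
  show "L2_map F" unfolding L2_map_def FB using opsum_L2[OF B] by blast
qed

lemma Phi_in_Lset:
  assumes "\<alpha> \<in> I\<^sub>N" "c \<in> Coef {\<alpha>}" shows "Phi c \<in> Lset N M p \<alpha>"
proof -
  have "fam c \<beta> = (\<lambda>_ _ _ _. 0)" if "\<beta> \<noteq> \<alpha>" for \<beta>
    using coeffsD[OF assms(2)] that by (simp add: fam_def fun_eq_iff Idx_def)
  then have "Phi c = opA N M \<alpha> (fam c \<alpha>)" unfolding Phi_def using assms by (intro opA_as_opsum) auto
  then show ?thesis using fam_stair[of c] assms by (auto simp: Lset_def stair_fam_def)
qed

lemma memL_Lset_iff:
  assumes "\<alpha> \<in> I\<^sub>N"
  shows "memL N M (Lset N M p \<alpha>) F \<longleftrightarrow> (\<exists>c\<in>Coef {\<alpha>}. has_coeff F c)"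
proof
  show "\<exists>c\<in>Coef {\<alpha>}. has_coeff F c" if "memL N M (Lset N M p \<alpha>) F"
    using that Lset_has_coeff(1)[OF assms] has_coeff_cong unfolding memL_def by metis
  show "memL N M (Lset N M p \<alpha>) F" if "\<exists>c\<in>Coef {\<alpha>}. has_coeff F c"
    using that Phi_in_Lset[OF assms] unfolding memL_def has_coeff_def by metis
qed

lemma Lall_has_coeff:
  assumes "F \<in> Lall N M p" shows "\<exists>c. has_coeff F c" "L2_map F"
proof -
  obtain A where A: "F = opsum N M A" "stair_fam A" using assms by (auto simp: Lall_def stair_fam_def)
  then obtain c where "c \<in> Coef I\<^sub>N" "F \<triangleq> Phi c" using coeffs_exist[of A I\<^sub>N] by (metis Pow_iff)
  then show "\<exists>c. has_coeff F c" by (auto simp: has_coeff_def)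
  show "L2_map F" using A opsum_L2 by (auto simp: L2_map_def)
qed

lemma Phi_in_Lall: "Phi c \<in> Lall N M p"
  using fam_stair[of c] by (auto simp: Lall_def Phi_def stair_fam_def)

lemma memL_Lall_iff: "memL N M (Lall N M p) F \<longleftrightarrow> (\<exists>c. has_coeff F c)"
  unfolding memL_def using Lall_has_coeff(1) has_coeff_cong Phi_in_Lall has_coeff_def by metis

lemma bounded_op_has_coeff:
  assumes "has_coeff F c" "L2_map F" shows "bounded_op N M F"
proof -
  have F: "F u \<doteq> Phi c u" if "u \<in> L2 N M" for u using assms that by (auto simp: has_coeff_def op_eq_def)
  have P: "bounded_op N M (Phi c)" by (rule bounded_op_Phi)
  have n: "norm2 N M (F u) = norm2 N M (Phi c u)" if u: "u \<in> L2 N M" for u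
  proof -
    have "(\<integral>k. (cmod (F u k j))\<^sup>2 \<partial>Q) = (\<integral>k. (cmod (Phi c u k j))\<^sup>2 \<partial>Q)" if "j < M" for j
      using F[OF u] that assms(2) Phi_L2[OF u, of c] u unfolding ae_eq_def L2_map_def
      by (intro integral_cong_AE) (auto simp: L2_def elim!: eventually_mono)
    then show ?thesis by (simp add: norm2_def)
  qed
  have lin: "F (\<lambda>k j. u k j + s * v k j) \<doteq> (\<lambda>k j. F u k j + s * F v k j)" if uv: "u \<in> L2 N M" "v \<in> L2 N M" for u v s
  proof -
    have "F (\<lambda>k j. u k j + s * v k j) \<doteq> Phi c (\<lambda>k j. u k j + s * v k j)" by (intro F L2_add_scaled uv)
    also have "\<dots> \<doteq> (\<lambda>k j. Phi c u k j + s * Phi c v k j)" using P uv by (simp add: bounded_op_def)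
    also have "\<dots> \<doteq> (\<lambda>k j. F u k j + s * F v k j)" by (intro ae_add_scaled ae_sym[OF F] uv)
    finally show ?thesis .
  qed
  have cong: "F u \<doteq> F v" if "u \<in> L2 N M" "v \<in> L2 N M" "u \<doteq> v" for u v
    using F[OF that(1)] F[OF that(2)] P that ae_trans ae_sym unfolding bounded_op_def by metis
  show ?thesis using P assms(2) n lin cong unfolding bounded_op_def L2_map_def by simp
qed

text \<open>The bounded inverse \<open>G\<close> need not be known to have a kernel. It yields that
  \<open>c \<odot> a = 0\<close> implies \<open>a = 0\<close>, and finite dimension turns this
  cancellation into an inverse among the coefficients.\<close>

lemma invertible_imp_units:
  assumes F: "has_coeff F c" and inv: "invertible_op N M F"
  shows "c \<in> units"
proof -
  obtain G where G: "bounded_op N M G" "\<And>u. u \<in> L2 N M \<Longrightarrow> G (F u) \<doteq> u" and bF: "bounded_op N M F"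
    using inv unfolding invertible_op_def by blast
  have cI: "c \<in> Coef I\<^sub>N" using F by (simp add: has_coeff_def)
  \<comment> \<open>Linearity of \<open>G\<close> at the pair of zero functions with scalar -1 gives
    \<open>G 0 = G 0 - G 0\<close>.\<close>
  have G0: "G (\<lambda>k j. 0) \<doteq> (\<lambda>k j. 0)"
    using G(1) L2_zero unfolding bounded_op_def
    by (elim conjE) (drule bspec[of _ _ "\<lambda>k j. 0"], simp, drule bspec[of _ _ "\<lambda>k j. 0"], simp,
        drule spec[of _ "-1"], simp add: ae_eq_def)
  have canc: "a = 0" if a: "a \<in> Coef I\<^sub>N" "c \<odot> a = 0" for a
  proof (rule Phi_eq_zero[OF a(1)])
    have "Phi c \<circ> Phi a \<triangleq> zero_op"
      using coeff_mult(2)[of c a] has_coeff_zero a(2) by (auto simp: has_coeff_def intro: op_trans op_sym)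
    show "Phi a \<triangleq> zero_op" unfolding op_eq_def
    proof
      fix u assume u: "u \<in> L2 N M"
      have pa: "Phi a u \<in> L2 N M" by (rule Phi_L2[OF u])
      have "F (Phi a u) \<doteq> Phi c (Phi a u)" using F pa by (auto simp: has_coeff_def op_eq_def)
      also have "\<dots> \<doteq> (\<lambda>k j. 0)" using \<open>Phi c \<circ> Phi a \<triangleq> zero_op\<close> u by (auto simp: op_eq_def zero_op_def)
      finally have "G (F (Phi a u)) \<doteq> G (\<lambda>k j. 0)"
        using G(1) bF pa L2_zero unfolding bounded_op_def by blast
      then have "Phi a u \<doteq> (\<lambda>k j. 0)" using G(2)[OF pa] G0 ae_trans ae_sym by blast
      then show "Phi a u \<doteq> zero_op u" by (simp add: zero_op_def)
    qed
  qed
  have "c - one_coeff \<in> Coef I\<^sub>N" by (intro coeffs_diff cI coeffs_I[OF one_coeff(1)])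
  then obtain y where y: "y - one_coeff \<in> Coef I\<^sub>N" "c \<odot> y = one_coeff" "y \<odot> c = one_coeff"
    using left_cancellable_invertible[of I\<^sub>N c] canc by auto
  then have "y \<in> Coef I\<^sub>N" using coeffs_add[OF y(1) coeffs_I[OF one_coeff(1)]] by simp
  with y cI show ?thesis unfolding units_def by blast
qed

lemma units_imp_invertible:
  assumes F: "has_coeff F c" "L2_map F" and c: "c \<in> units"
  shows "invertible_op N M F"
proof -
  obtain y where y: "y \<in> Coef I\<^sub>N" "c \<odot> y = one_coeff" "y \<odot> c = one_coeff"
    using c unfolding units_def by blast
  have P: "L2_map (Phi y)" by (auto simp: L2_map_def intro: Phi_L2)
  have "has_coeff (F \<circ> Phi y) one_coeff" "has_coeff (Phi y \<circ> F) one_coeff"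
    using has_coeff_comp[OF F(1) has_coeff_Phi[OF y(1)] P] has_coeff_comp[OF has_coeff_Phi[OF y(1)] F] y by auto
  then have "F \<circ> Phi y \<triangleq> Iop" "Phi y \<circ> F \<triangleq> Iop" using has_coeff_op_eq_iff[OF _ has_coeff_Iop] by auto
  then show ?thesis unfolding invertible_op_def using bounded_op_has_coeff[OF F] bounded_op_Phi[of y]
    by (auto simp: op_eq_def Iop_def)
qed

lemma L2_map_add: "L2_map F \<Longrightarrow> L2_map G \<Longrightarrow> L2_map (op_add F G)"
  unfolding L2_map_def op_add_def using L2_add_scaled[of _ _ 1] by auto

lemma L2_map_Iop: "L2_map Iop"
  by (simp add: L2_map_def Iop_def)

lemma L2_map_Phi: "L2_map (Phi c)"
  by (auto simp: L2_map_def intro: Phi_L2)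

lemma L2_map_comp: "L2_map F \<Longrightarrow> L2_map G \<Longrightarrow> L2_map (F \<circ> G)"
  by (simp add: L2_map_def)

lemma memL_InvL_iff: "memL N M (InvL N M p) F \<longleftrightarrow> (\<exists>c\<in>units. has_coeff F c)"
proof
  assume "memL N M (InvL N M p) F"
  then obtain G where G: "G \<in> Lall N M p" "invertible_op N M G" "F \<triangleq> G" by (auto simp: memL_def InvL_def)
  then show "\<exists>c\<in>units. has_coeff F c"
    using Lall_has_coeff(1)[OF G(1)] invertible_imp_units has_coeff_cong by metis
next
  assume "\<exists>c\<in>units. has_coeff F c"
  then obtain c where c: "c \<in> units" "has_coeff F c" by blast
  then have "Phi c \<in> InvL N M p"
    using Phi_in_Lall units_imp_invertible[OF has_coeff_Phi L2_map_Phi] by (auto simp: InvL_def has_coeff_def)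
  then show "memL N M (InvL N M p) F" using c by (auto simp: memL_def has_coeff_def)
qed

text \<open>For the empty index set the unit belongs to the piece itself, so lying in the piece and
  differing from the unit by an element of it mean the same. This lets \<open>grp\<close> cover both
  clauses of \<open>Gset\<close>.\<close>

lemma Gset_has_coeff:
  assumes "\<alpha> \<in> I\<^sub>N" "F \<in> Gset N M p \<alpha>"
  shows "\<exists>c\<in>grp \<alpha>. has_coeff F c" "L2_map F"
proof -
  have "(\<exists>c\<in>grp \<alpha>. has_coeff F c) \<and> L2_map F"
  proof (cases "\<alpha> = {}")
    case True
    then have F: "F \<in> Lset N M p {}" "invertible_op N M F" using assms by (auto simp: Gset_def)
    then obtain c where c: "c \<in> Coef {{}}" "has_coeff F c" using Lset_has_coeff(1)[of "{}"] by auto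
    then have "c \<in> grp {}" using invertible_imp_units[OF c(2) F(2)] one_coeff(1) by (simp add: grp_def coeffs_diff)
    then show ?thesis using c Lset_has_coeff(2)[of "{}" F] F True by auto
  next
    case False
    then obtain G where G: "F = op_add Iop G" "G \<in> Lset N M p \<alpha>" "invertible_op N M F"
      using assms by (auto simp: Gset_def)
    obtain k where k: "k \<in> Coef {\<alpha>}" "has_coeff G k" using Lset_has_coeff(1)[OF assms(1) G(2)] by blast
    have F: "has_coeff F (one_coeff + k)" unfolding G(1) by (intro has_coeff_add has_coeff_Iop k)
    have "one_coeff + k \<in> grp \<alpha>" using invertible_imp_units[OF F G(3)] k by (simp add: grp_def)
    moreover have "L2_map F" unfolding G(1) by (intro L2_map_add L2_map_Iop Lset_has_coeff(2)[OF assms(1) G(2)])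
    ultimately show ?thesis using F by blast
  qed
  then show "\<exists>c\<in>grp \<alpha>. has_coeff F c" "L2_map F" by auto
qed

lemma grp_realised:
  assumes "\<alpha> \<in> I\<^sub>N" "c \<in> grp \<alpha>"
  shows "\<exists>F\<in>Gset N M p \<alpha>. has_coeff F c"
proof (cases "\<alpha> = {}")
  case True
  have "c = (c - one_coeff) + one_coeff" by simp
  moreover have "(c - one_coeff) + one_coeff \<in> Coef {{}}"
    using assms True one_coeff(1) by (intro coeffs_add) (auto simp: grp_def)
  ultimately have c: "c \<in> Coef {{}}" by simp
  have "invertible_op N M (Phi c)"
    using assms by (intro units_imp_invertible[OF has_coeff_Phi[OF c] L2_map_Phi]) (auto simp: grp_def)
  then show ?thesis using True Phi_in_Lset[OF _ c] has_coeff_Phi[OF c] by (auto simp: Gset_def)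
next
  case False
  define k where "k = c - one_coeff"
  have k: "k \<in> Coef {\<alpha>}" using assms by (simp add: grp_def k_def)
  have F: "has_coeff (op_add Iop (Phi k)) c"
    using has_coeff_add[OF has_coeff_Iop has_coeff_Phi[OF k]] by (simp add: k_def)
  have "invertible_op N M (op_add Iop (Phi k))"
    using assms by (intro units_imp_invertible[OF F] L2_map_add L2_map_Iop L2_map_Phi) (auto simp: grp_def)
  then show ?thesis using False F Phi_in_Lset[OF assms(1) k] by (auto simp: Gset_def)
qed

lemma memL_Gset_iff:
  assumes "\<alpha> \<in> I\<^sub>N"
  shows "memL N M (Gset N M p \<alpha>) F \<longleftrightarrow> (\<exists>c\<in>grp \<alpha>. has_coeff F c)"
proof
  show "\<exists>c\<in>grp \<alpha>. has_coeff F c" if "memL N M (Gset N M p \<alpha>) F"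
    using that Gset_has_coeff(1)[OF assms] has_coeff_cong unfolding memL_def by metis
  show "memL N M (Gset N M p \<alpha>) F" if "\<exists>c\<in>grp \<alpha>. has_coeff F c"
    using that grp_realised[OF assms] has_coeff_op_eq_iff unfolding memL_def by metis
qed

text \<open>The infimum runs over representations that all have the coefficients \<open>c\<close>.
  Each dominates \<open>cmod (c z)\<close>, which is one entry in a row sum, and this row sum is
  bounded by one of the added suprema.\<close>

lemma normL_ge_coeff:
  assumes F: "has_coeff F c" and z: "z \<in> Idx I\<^sub>N"
  shows "cmod (c z) \<le> normL N M p F"
proof -
  obtain \<alpha> \<kappa> \<xi> i j where zz: "z = (\<alpha>, \<kappa>, \<xi>, i, j)" by (cases z)
  have *: "\<alpha> \<subseteq> {..<N}" "\<kappa> \<in> PiE {..<N} (\<lambda>_. {..<p})" "\<xi> \<in> PiE \<alpha> (\<lambda>_. {..<p})" "i < M" "j < M"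
    using z by (auto simp: zz Idx_def)
  define S where "S A \<beta> = {\<Sum>j<M. cmod ((A :: nat set \<Rightarrow> mfun) \<beta> k x i j) | k x i. k \<in> box {..<N} \<and> x \<in> box \<beta> \<and> i < M}" for A \<beta>
  have "cmod (c z) \<le> coef_norm N M A" if A: "stair_fam A" "F \<triangleq> opsum N M A" for A
  proof -
    obtain d where d: "d \<in> Coef I\<^sub>N" "opsum N M A \<triangleq> Phi d" and
      dA: "\<And>\<alpha> k x i j. \<alpha> \<subseteq> {..<N} \<Longrightarrow> k \<in> box {..<N} \<Longrightarrow> x \<in> box \<alpha> \<Longrightarrow> i < M \<Longrightarrow> j < M \<Longrightarrow> fam d \<alpha> k x i j = A \<alpha> k x i j"
      using coeffs_exist[OF A(1), of I\<^sub>N] by (metis Pow_iff)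
    have "has_coeff F d" using d A op_trans by (auto simp: has_coeff_def)
    then have "d = c" using has_coeff_op_eq_iff[OF F, of F d] op_refl by auto
    then have cA: "c z = A \<alpha> (corner p \<kappa>) (corner p \<xi>) i j"
      using dA[of \<alpha> "corner p \<kappa>" "corner p \<xi>" i j] * p_pos
      by (auto simp: fam_def cells_corner corner_in_box zz)
    have bdd: "bdd_above (S A \<beta>)" if \<beta>: "\<beta> \<subseteq> {..<N}" for \<beta>
    proof -
      obtain C where C: "\<And>k x i j. k \<in> box {..<N} \<Longrightarrow> x \<in> box \<beta> \<Longrightarrow> i < M \<Longrightarrow> j < M \<Longrightarrow> cmod (A \<beta> k x i j) \<le> C"
        using stair_bounded[of \<beta> "A \<beta>"] A(1) \<beta> fin_sub unfolding stair_fam_def by metis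
      have "(\<Sum>j<M. cmod (A \<beta> k x i j)) \<le> (\<Sum>j<M. C)" if "k \<in> box {..<N}" "x \<in> box \<beta>" "i < M" for k x i
        using that C by (intro sum_mono) auto
      then show ?thesis by (intro bdd_aboveI[of _ "\<Sum>j<M. C"]) (auto simp: S_def)
    qed
    have mem: "(\<Sum>j<M. cmod (A \<beta> k x i j)) \<le> Sup (S A \<beta>)"
      if "\<beta> \<subseteq> {..<N}" "k \<in> box {..<N}" "x \<in> box \<beta>" "i < M" for \<beta> k x i
      using that by (intro cSup_upper bdd) (auto simp: S_def)
    \<comment> \<open>The supremum is over a nonempty set because \<open>M > 0\<close> supplies the
      row 0 and the origin lies in every box.\<close>
    have pos: "0 \<le> Sup (S A \<beta>)" if "\<beta> \<subseteq> {..<N}" for \<beta>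
      using mem[OF that, of "\<lambda>_. 0" "\<lambda>_. 0" 0] M_pos sum_nonneg[of "{..<M}" "\<lambda>j. cmod (A \<beta> (\<lambda>_. 0) (\<lambda>_. 0) 0 j)"]
      by (simp add: box_def)
    have "cmod (c z) \<le> (\<Sum>j<M. cmod (A \<alpha> (corner p \<kappa>) (corner p \<xi>) i j))"
      unfolding cA using * by (intro member_le_sum) auto
    also have "\<dots> \<le> Sup (S A \<alpha>)" using * p_pos by (intro mem corner_in_box) auto
    also have "\<dots> \<le> (\<Sum>\<beta>\<in>I\<^sub>N. Sup (S A \<beta>))"
      using * pos by (intro member_le_sum) auto
    also have "\<dots> = coef_norm N M A" by (simp add: coef_norm_def S_def)
    finally show ?thesis .
  qed
  moreover have "stair_fam (fam c)" "F \<triangleq> opsum N M (fam c)"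
    using F fam_stair by (auto simp: has_coeff_def Phi_def)
  ultimately show ?thesis unfolding normL_def
    by (intro cInf_greatest) (auto simp: stair_fam_def)
qed

text \<open>Outside the block of \<open>\<alpha>\<close> all approximants have the same coefficients
  as \<open>b\<close>, so the distance of \<open>b z\<close> to \<open>d z\<close> is a constant
  below a null sequence. The case \<open>b = 0\<close> serves \<open>Lset\<close>, the case
  \<open>b = one_coeff\<close> serves \<open>Gset\<close>.\<close>

lemma coset_closed:
  assumes X: "\<And>n. has_coeff (X n) (c n)" "\<And>n. c n - b \<in> Coef {\<alpha>}" and F: "has_coeff F d"
    and b: "b \<in> Coef I\<^sub>N" and lim: "(\<lambda>n. normL N M p (op_sub (X n) F)) \<longlonglongrightarrow> 0"
  shows "d - b \<in> Coef {\<alpha>}"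
proof (rule coeffsI)
  fix z assume z: "z \<notin> Idx {\<alpha>}"
  show "(d - b) z = 0"
  proof (cases "z \<in> Idx I\<^sub>N")
    case True
    have cb: "c n z = b z" for n using coeffsD[OF X(2) z, of n] by simp
    have "cmod (b z - d z) \<le> normL N M p (op_sub (X n) F)" for n
      using normL_ge_coeff[OF has_coeff_sub[OF X(1) F] True, of n] cb[of n] by simp
    then have "cmod (b z - d z) \<le> 0" using lim by (intro LIMSEQ_le_const[OF lim]) auto
    then show ?thesis by simp
  next
    case False
    then show ?thesis using coeffsD[OF b False] F coeffsD[of d I\<^sub>N z] by (simp add: has_coeff_def)
  qed
qed

end

section \<open>The factorisation theorem\<close>

context staircase_params
begin

section \<open>Subalgebras, subgroups, intersections, sums and products\<close>

lemma closed_subalgebra_Lset: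
  assumes \<alpha>: "\<alpha> \<in> I\<^sub>N" shows "closed_subalgebra N M p (Lset N M p \<alpha>)"
  unfolding closed_subalgebra_def memL_Lset_iff[OF \<alpha>] memL_Lall_iff
proof (intro conjI ballI allI impI)
  note L = Lset_has_coeff[OF \<alpha>]
  show "\<exists>c. has_coeff F c" if "F \<in> Lset N M p \<alpha>" for F using L(1)[OF that] by blast
  show "\<exists>c\<in>Coef {\<alpha>}. has_coeff zero_op c" using has_coeff_zero coeffs_zero by blast
  show "\<exists>c\<in>Coef {\<alpha>}. has_coeff (op_add F G) c" if "F \<in> Lset N M p \<alpha>" "G \<in> Lset N M p \<alpha>" for F G
    using L(1)[OF that(1)] L(1)[OF that(2)] has_coeff_add coeffs_add by metis
  show "\<exists>c\<in>Coef {\<alpha>}. has_coeff (F \<circ> G) c" if F: "F \<in> Lset N M p \<alpha>" and G: "G \<in> Lset N M p \<alpha>" for F G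
  proof -
    obtain c d where c: "c \<in> Coef {\<alpha>}" "d \<in> Coef {\<alpha>}" "has_coeff F c" "has_coeff G d"
      using L(1)[OF F] L(1)[OF G] by blast
    have "c \<odot> d \<in> Coef {\<alpha>}" using c by (intro coeff_mult_graded) auto
    then show ?thesis using has_coeff_comp[OF c(3,4) L(2)[OF G]] by blast
  qed
  show "\<exists>c\<in>Coef {\<alpha>}. has_coeff (op_scale s F) c" if F: "F \<in> Lset N M p \<alpha>" for F s
  proof -
    obtain c where c: "c \<in> Coef {\<alpha>}" "has_coeff F c" using L(1)[OF F] by blast
    have "(\<lambda>z. s * c z) \<in> Coef {\<alpha>}" using coeffs_add_scaled[OF coeffs_zero c(1), of s] by simp
    then show ?thesis using has_coeff_scale[OF c(2)] by blast
  qed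
  show "\<exists>c\<in>Coef {\<alpha>}. has_coeff F c"
    if X: "\<forall>n. X n \<in> Lset N M p \<alpha>" and F: "F \<in> Lall N M p" and lim: "(\<lambda>n. normL N M p (op_sub (X n) F)) \<longlonglongrightarrow> 0" for X F
  proof -
    have "\<forall>n. \<exists>c. c \<in> Coef {\<alpha>} \<and> has_coeff (X n) c" using L(1) X by blast
    then obtain c where c: "\<And>n. c n \<in> Coef {\<alpha>}" "\<And>n. has_coeff (X n) (c n)" by metis
    obtain d where d: "has_coeff F d" using Lall_has_coeff(1)[OF F] by blast
    have "d - 0 \<in> Coef {\<alpha>}" using c by (intro coset_closed[OF c(2) _ d coeffs_zero lim]) simp
    then show ?thesis using d by auto
  qed
qed

lemma grp_mult: "c \<in> grp \<alpha> \<Longrightarrow> d \<in> grp \<alpha> \<Longrightarrow> c \<odot> d \<in> grp \<alpha>"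
proof -
  assume c: "c \<in> grp \<alpha>" and d: "d \<in> grp \<alpha>"
  define k l where "k = c - one_coeff" and "l = d - one_coeff"
  have k: "k \<in> Coef {\<alpha>}" and l: "l \<in> Coef {\<alpha>}" using c d by (auto simp: k_def l_def grp_def)
  have "c \<odot> d = (one_coeff + k) \<odot> (one_coeff + l)" by (simp add: k_def l_def)
  also have "\<dots> = one_coeff + (k + l + k \<odot> l)"
    using coeffs_I[OF k] coeffs_I[OF l] coeffs_I[OF one_coeff(1)]
    by (simp add: distl distr unit_left unit_right algebra_simps)
  finally have "c \<odot> d - one_coeff = k + l + k \<odot> l" by simp
  moreover have "k \<odot> l \<in> Coef {\<alpha>}" using k l by (intro coeff_mult_graded) auto
  moreover have "c \<odot> d \<in> units" using c d by (intro units_mul) (auto simp: grp_def)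
  ultimately show ?thesis using k l by (auto simp: grp_def intro!: coeffs_add)
qed

lemma one_coeff_grp: "one_coeff \<in> grp \<alpha>"
  by (simp add: grp_def unit_unit coeffs_zero)

text \<open>The family consisting of \<open>\<alpha>\<close> alone is closed under unions, so
  \<open>inverse_in\<close> applies to it.\<close>

lemma grp_inverse:
  assumes "\<alpha> \<in> I\<^sub>N" "c \<in> grp \<alpha>" shows "\<exists>d\<in>grp \<alpha>. c \<odot> d = one_coeff \<and> d \<odot> c = one_coeff"
proof -
  obtain d where d: "d \<in> Coef I\<^sub>N" "c \<odot> d = one_coeff" "d \<odot> c = one_coeff"
    using assms unfolding grp_def units_def by blast
  have "d - one_coeff \<in> Coef {\<alpha>}"
    using assms by (intro inverse_in[OF _ _ _ d]) (auto simp: grp_def)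
  moreover have "c \<in> Coef I\<^sub>N" using assms by (simp add: grp_def units_def)
  ultimately have "d \<in> grp \<alpha>" using d unfolding grp_def units_def by blast
  with d show ?thesis by blast
qed

lemma closed_subgroup_Gset:
  assumes \<alpha>: "\<alpha> \<in> I\<^sub>N" shows "closed_subgroup_Inv N M p (Gset N M p \<alpha>)"
  unfolding closed_subgroup_Inv_def memL_Gset_iff[OF \<alpha>] memL_InvL_iff
proof (intro conjI ballI allI impI)
  note G = Gset_has_coeff[OF \<alpha>]
  show "\<exists>c\<in>units. has_coeff F c" if "F \<in> Gset N M p \<alpha>" for F using G(1)[OF that] by (auto simp: grp_def)
  show "\<exists>c\<in>grp \<alpha>. has_coeff Iop c" using has_coeff_Iop one_coeff_grp by blast
  show "\<exists>c\<in>grp \<alpha>. has_coeff (F \<circ> H) c" if "F \<in> Gset N M p \<alpha>" "H \<in> Gset N M p \<alpha>" for F H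
    using G(1)[OF that(1)] G[OF that(2)] has_coeff_comp grp_mult by metis
  show "\<exists>H\<in>Gset N M p \<alpha>. op_eq N M (F \<circ> H) Iop \<and> op_eq N M (H \<circ> F) Iop" if F: "F \<in> Gset N M p \<alpha>" for F
  proof -
    obtain c where c: "c \<in> grp \<alpha>" "has_coeff F c" using G(1)[OF F] by blast
    obtain d where d: "d \<in> grp \<alpha>" "c \<odot> d = one_coeff" "d \<odot> c = one_coeff" using grp_inverse[OF \<alpha> c(1)] by blast
    obtain H where H: "H \<in> Gset N M p \<alpha>" "has_coeff H d" using grp_realised[OF \<alpha> d(1)] by blast
    show ?thesis
      using has_coeff_comp[OF c(2) H(2) G(2)[OF H(1)]] has_coeff_comp[OF H(2) c(2) G(2)[OF F]] d H
        has_coeff_op_eq_iff[OF _ has_coeff_Iop] by auto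
  qed
  show "\<exists>c\<in>grp \<alpha>. has_coeff F c"
    if X: "\<forall>n. X n \<in> Gset N M p \<alpha>" and F: "F \<in> InvL N M p" and lim: "(\<lambda>n. normL N M p (op_sub (X n) F)) \<longlonglongrightarrow> 0" for X F
  proof -
    have "\<forall>n. \<exists>c. c \<in> grp \<alpha> \<and> has_coeff (X n) c" using G(1) X by blast
    then obtain c where c: "\<And>n. c n \<in> grp \<alpha>" "\<And>n. has_coeff (X n) (c n)" by metis
    have "memL N M (InvL N M p) F" using F op_refl by (auto simp: memL_def)
    then obtain d where d: "d \<in> units" "has_coeff F d" unfolding memL_InvL_iff by blast
    \<comment> \<open>Invertibility of the limit is already given by
      \<open>F \<in> InvL N M p\<close>; what remains is its position in the coset of the
      unit.\<close>
    have "d - one_coeff \<in> Coef {\<alpha>}"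
      using c(1) by (intro coset_closed[OF c(2) _ d(2) coeffs_I[OF one_coeff(1)] lim]) (auto simp: grp_def)
    then show ?thesis using d by (auto simp: grp_def)
  qed
qed

lemma Lset_inter:
  assumes "\<alpha> \<in> I\<^sub>N" "\<beta> \<in> I\<^sub>N" "\<alpha> \<noteq> \<beta>"
  shows "{F. memL N M (Lset N M p \<alpha>) F \<and> memL N M (Lset N M p \<beta>) F} = {F. F \<triangleq> zero_op}"
proof (intro Collect_cong iffI)
  fix F assume "memL N M (Lset N M p \<alpha>) F \<and> memL N M (Lset N M p \<beta>) F"
  then obtain c d where c: "c \<in> Coef {\<alpha>}" "d \<in> Coef {\<beta>}" "has_coeff F c" "has_coeff F d"
    unfolding memL_Lset_iff[OF assms(1)] memL_Lset_iff[OF assms(2)] by blast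
  then have "c = d" using has_coeff_op_eq_iff op_refl by blast
  then have "c = 0" using c assms(3) by (intro L_disjoint[of "{\<alpha>}" "{\<beta>}"]) auto
  then show "F \<triangleq> zero_op" using c has_coeff_op_eq_iff[OF _ has_coeff_zero] by blast
next
  fix F assume "F \<triangleq> zero_op"
  then have "has_coeff F 0" using has_coeff_cong has_coeff_zero by blast
  then show "memL N M (Lset N M p \<alpha>) F \<and> memL N M (Lset N M p \<beta>) F"
    unfolding memL_Lset_iff[OF assms(1)] memL_Lset_iff[OF assms(2)] using coeffs_zero by blast
qed

lemma Gset_inter:
  assumes "\<alpha> \<in> I\<^sub>N" "\<beta> \<in> I\<^sub>N" "\<alpha> \<noteq> \<beta>"
  shows "{F. memL N M (Gset N M p \<alpha>) F \<and> memL N M (Gset N M p \<beta>) F} = {F. F \<triangleq> Iop}"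
proof (intro Collect_cong iffI)
  fix F assume "memL N M (Gset N M p \<alpha>) F \<and> memL N M (Gset N M p \<beta>) F"
  then obtain c d where c: "c \<in> grp \<alpha>" "d \<in> grp \<beta>" "has_coeff F c" "has_coeff F d"
    unfolding memL_Gset_iff[OF assms(1)] memL_Gset_iff[OF assms(2)] by blast
  then have "c = d" using has_coeff_op_eq_iff op_refl by blast
  then have "c - one_coeff = 0" using c assms(3) by (intro L_disjoint[of "{\<alpha>}" "{\<beta>}"]) (auto simp: grp_def)
  then show "F \<triangleq> Iop" using c has_coeff_op_eq_iff[OF _ has_coeff_Iop] by auto
next
  fix F assume "F \<triangleq> Iop"
  then have "has_coeff F one_coeff" using has_coeff_cong has_coeff_Iop by blast
  then show "memL N M (Gset N M p \<alpha>) F \<and> memL N M (Gset N M p \<beta>) F"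
    unfolding memL_Gset_iff[OF assms(1)] memL_Gset_iff[OF assms(2)] using one_coeff_grp by blast
qed

lemma Lset_comp:
  assumes "\<alpha> \<in> I\<^sub>N" "\<beta> \<in> I\<^sub>N" "F \<in> Lset N M p \<alpha>" "G \<in> Lset N M p \<beta>"
  shows "memL N M (Lset N M p (\<alpha> \<union> \<beta>)) (F \<circ> G)"
proof -
  obtain c d where c: "c \<in> Coef {\<alpha>}" "d \<in> Coef {\<beta>}" "has_coeff F c" "has_coeff G d"
    using Lset_has_coeff(1)[OF assms(1,3)] Lset_has_coeff(1)[OF assms(2,4)] by blast
  have "c \<odot> d \<in> Coef {\<alpha> \<union> \<beta>}" using c by (intro coeff_mult_graded) auto
  moreover have "has_coeff (F \<circ> G) (c \<odot> d)" by (intro has_coeff_comp c Lset_has_coeff(2)[OF assms(2,4)])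
  moreover have "\<alpha> \<union> \<beta> \<in> I\<^sub>N" using assms by auto
  ultimately show ?thesis unfolding memL_Lset_iff[OF \<open>\<alpha> \<union> \<beta> \<in> I\<^sub>N\<close>] by blast
qed

lemma Lall_iff_sum:
  "memL N M (Lall N M p) F \<longleftrightarrow>
     (\<exists>B. (\<forall>\<alpha>\<in>I\<^sub>N. B \<alpha> \<in> Lset N M p \<alpha>) \<and> F \<triangleq> (\<lambda>u k i. \<Sum>\<alpha>\<in>I\<^sub>N. B \<alpha> u k i))"
proof
  assume "memL N M (Lall N M p) F"
  then obtain A where A: "stair_fam A" "F \<triangleq> opsum N M A" by (auto simp: memL_def Lall_def stair_fam_def)
  then show "\<exists>B. (\<forall>\<alpha>\<in>I\<^sub>N. B \<alpha> \<in> Lset N M p \<alpha>) \<and> F \<triangleq> (\<lambda>u k i. \<Sum>\<alpha>\<in>I\<^sub>N. B \<alpha> u k i)"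
    by (intro exI[of _ "\<lambda>\<alpha>. opA N M \<alpha> (A \<alpha>)"]) (auto simp: Lset_def stair_fam_def opsum_def[abs_def])
next
  assume "\<exists>B. (\<forall>\<alpha>\<in>I\<^sub>N. B \<alpha> \<in> Lset N M p \<alpha>) \<and> F \<triangleq> (\<lambda>u k i. \<Sum>\<alpha>\<in>I\<^sub>N. B \<alpha> u k i)"
  then obtain B where B: "\<forall>\<alpha>\<in>I\<^sub>N. B \<alpha> \<in> Lset N M p \<alpha>" "F \<triangleq> (\<lambda>u k i. \<Sum>\<alpha>\<in>I\<^sub>N. B \<alpha> u k i)" by blast
  have "\<forall>\<alpha>\<in>I\<^sub>N. \<exists>c. has_coeff (B \<alpha>) c" using B Lset_has_coeff(1) by blast
  then obtain b where "\<forall>\<alpha>\<in>I\<^sub>N. has_coeff (B \<alpha>) (b \<alpha>)" by metis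
  then have "has_coeff (\<lambda>u k i. \<Sum>\<alpha>\<in>I\<^sub>N. B \<alpha> u k i) (\<Sum>\<alpha>\<in>I\<^sub>N. b \<alpha>)" by (intro has_coeff_sum) auto
  then show "memL N M (Lall N M p) F" unfolding memL_Lall_iff using has_coeff_cong[OF B(2)] by blast
qed

lemma sum_apply_fun: "(\<Sum>a\<in>S. f a) z = (\<Sum>a\<in>S. f a z)" for f :: "'a \<Rightarrow> 'b \<Rightarrow> complex"
  by (induction S rule: infinite_finite_induct) auto

text \<open>At an index whose first component is \<open>\<alpha>\<close> only the summand of
  \<open>\<alpha>\<close> contributes, so the total coefficients determine each summand.\<close>

lemma sum_unique:
  assumes "\<forall>\<alpha>\<in>I\<^sub>N. B \<alpha> \<in> Lset N M p \<alpha> \<and> B' \<alpha> \<in> Lset N M p \<alpha>"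
    "(\<lambda>u k i. \<Sum>\<alpha>\<in>I\<^sub>N. B \<alpha> u k i) \<triangleq> (\<lambda>u k i. \<Sum>\<alpha>\<in>I\<^sub>N. B' \<alpha> u k i)" "\<alpha> \<in> I\<^sub>N"
  shows "B \<alpha> \<triangleq> B' \<alpha>"
proof -
  have "\<forall>\<alpha>\<in>I\<^sub>N. \<exists>c. c \<in> Coef {\<alpha>} \<and> has_coeff (B \<alpha>) c" "\<forall>\<alpha>\<in>I\<^sub>N. \<exists>c. c \<in> Coef {\<alpha>} \<and> has_coeff (B' \<alpha>) c"
    using assms(1) Lset_has_coeff(1) by blast+
  then obtain b b' where b: "\<And>\<alpha>. \<alpha> \<in> I\<^sub>N \<Longrightarrow> b \<alpha> \<in> Coef {\<alpha>} \<and> has_coeff (B \<alpha>) (b \<alpha>)"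
    "\<And>\<alpha>. \<alpha> \<in> I\<^sub>N \<Longrightarrow> b' \<alpha> \<in> Coef {\<alpha>} \<and> has_coeff (B' \<alpha>) (b' \<alpha>)" by metis
  have "has_coeff (\<lambda>u k i. \<Sum>\<alpha>\<in>I\<^sub>N. B \<alpha> u k i) (\<Sum>\<alpha>\<in>I\<^sub>N. b \<alpha>)" "has_coeff (\<lambda>u k i. \<Sum>\<alpha>\<in>I\<^sub>N. B' \<alpha> u k i) (\<Sum>\<alpha>\<in>I\<^sub>N. b' \<alpha>)"
    using b by (intro has_coeff_sum; simp)+
  with assms(2) have eq: "(\<Sum>\<alpha>\<in>I\<^sub>N. b \<alpha>) = (\<Sum>\<alpha>\<in>I\<^sub>N. b' \<alpha>)" using has_coeff_op_eq_iff by blast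
  have "b \<alpha> = b' \<alpha>"
  proof
    fix z show "b \<alpha> z = b' \<alpha> z"
    proof (cases "z \<in> Idx {\<alpha>}")
      case True
      then have fz: "fst z = \<alpha>" by (simp add: Idx_iff[of _ "{\<alpha>}"])
      have s: "(\<Sum>\<beta>\<in>I\<^sub>N. f \<beta>) z = f \<alpha> z" if "\<And>\<beta>. \<beta> \<in> I\<^sub>N \<Longrightarrow> f \<beta> \<in> Coef {\<beta>}" for f
      proof -
        have "f \<beta> z = 0" if "\<beta> \<in> I\<^sub>N - {\<alpha>}" for \<beta>
          using coeffsD[OF \<open>\<And>\<beta>. \<beta> \<in> I\<^sub>N \<Longrightarrow> f \<beta> \<in> Coef {\<beta>}\<close>, of \<beta> z] that fz Idx_iff[of z "{\<beta>}"] by auto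
        then show ?thesis unfolding sum_apply_fun using assms(3) by (subst sum.remove[of _ \<alpha>]) (auto intro: sum.neutral)
      qed
      show ?thesis using s[of b] s[of b'] b eq by simp
    next
      case False
      then show ?thesis using b[OF assms(3)] coeffsD by metis
    qed
  qed
  then show ?thesis using b[OF assms(3)] has_coeff_op_eq_iff by blast
qed

text \<open>Both properties are proved together, since composing with the next factor requires that
  the product of the tail maps \<open>L2\<close> into itself.\<close>

lemma has_coeff_foldr:
  assumes "\<And>\<alpha>. \<alpha> \<in> set \<alpha>s \<Longrightarrow> has_coeff (B \<alpha>) (b \<alpha>)" "\<And>\<alpha>. \<alpha> \<in> set \<alpha>s \<Longrightarrow> L2_map (B \<alpha>)"
  shows "has_coeff (foldr (\<circ>) (map B \<alpha>s) id) (prd b \<alpha>s) \<and> L2_map (foldr (\<circ>) (map B \<alpha>s) id)"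
proof -
  define P where "P \<alpha>s \<longleftrightarrow> has_coeff (foldr (\<circ>) (map B \<alpha>s) id) (prd b \<alpha>s) \<and> L2_map (foldr (\<circ>) (map B \<alpha>s) id)" for \<alpha>s
  have P_Nil: "P []" using has_coeff_Iop L2_map_Iop by (simp add: P_def prd_simps Iop_def id_def)
  have P_Cons: "P (\<alpha> # \<alpha>s)" if "P \<alpha>s" "has_coeff (B \<alpha>) (b \<alpha>)" "L2_map (B \<alpha>)" for \<alpha> \<alpha>s
    using that unfolding P_def by (simp add: prd_simps has_coeff_comp L2_map_comp)
  have "P \<alpha>s" using assms by (induction \<alpha>s) (auto intro: P_Nil P_Cons)
  then show ?thesis by (simp add: P_def)
qed

text \<open>Transport of \<open>units_product\<close>: factors in \<open>Gset\<close> are exchanged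
  for their coefficients in \<open>grp\<close> and back, and composition along the list becomes
  \<open>prd\<close>.\<close>

lemma InvL_product:
  assumes \<alpha>s: "distinct \<alpha>s" "set \<alpha>s = I\<^sub>N" "sorted (map card \<alpha>s) \<or> sorted (rev (map card \<alpha>s))"
  shows "memL N M (InvL N M p) F \<longleftrightarrow>
      (\<exists>B. (\<forall>\<alpha>\<in>I\<^sub>N. B \<alpha> \<in> Gset N M p \<alpha>) \<and> F \<triangleq> foldr (\<circ>) (map B \<alpha>s) id)"
    and "\<forall>\<alpha>\<in>I\<^sub>N. B \<alpha> \<in> Gset N M p \<alpha> \<and> B' \<alpha> \<in> Gset N M p \<alpha> \<Longrightarrow>
      foldr (\<circ>) (map B \<alpha>s) id \<triangleq> foldr (\<circ>) (map B' \<alpha>s) id \<Longrightarrow> \<forall>\<alpha>\<in>I\<^sub>N. B \<alpha> \<triangleq> B' \<alpha>"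
proof -
  note prod = units_product[OF refl \<alpha>s]
  have coef: "\<exists>b. \<forall>\<alpha>\<in>I\<^sub>N. b \<alpha> \<in> grp \<alpha> \<and> has_coeff (B \<alpha>) (b \<alpha>)" if "\<forall>\<alpha>\<in>I\<^sub>N. B \<alpha> \<in> Gset N M p \<alpha>" for B
  proof -
    have "\<forall>\<alpha>\<in>I\<^sub>N. \<exists>c. c \<in> grp \<alpha> \<and> has_coeff (B \<alpha>) c" using that Gset_has_coeff(1) by blast
    then show ?thesis by metis
  qed
  have fold: "has_coeff (foldr (\<circ>) (map B \<alpha>s) id) (prd b \<alpha>s)"
    if "\<forall>\<alpha>\<in>I\<^sub>N. B \<alpha> \<in> Gset N M p \<alpha>" "\<forall>\<alpha>\<in>I\<^sub>N. b \<alpha> \<in> grp \<alpha> \<and> has_coeff (B \<alpha>) (b \<alpha>)" for B b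
  proof (rule has_coeff_foldr[THEN conjunct1])
    fix \<alpha> assume "\<alpha> \<in> set \<alpha>s"
    then have \<alpha>: "\<alpha> \<in> I\<^sub>N" using \<alpha>s(2) by blast
    show "has_coeff (B \<alpha>) (b \<alpha>)" using that(2) \<alpha> by blast
    show "L2_map (B \<alpha>)" using that(1) \<alpha> by (intro Gset_has_coeff(2)[OF \<alpha>]) blast
  qed
  show "memL N M (InvL N M p) F \<longleftrightarrow>
      (\<exists>B. (\<forall>\<alpha>\<in>I\<^sub>N. B \<alpha> \<in> Gset N M p \<alpha>) \<and> F \<triangleq> foldr (\<circ>) (map B \<alpha>s) id)"
  proof
    assume "memL N M (InvL N M p) F"
    then obtain c where c: "c \<in> units" "has_coeff F c" unfolding memL_InvL_iff by blast
    obtain b where b: "\<forall>\<alpha>\<in>I\<^sub>N. b \<alpha> \<in> grp \<alpha>" "c = prd b \<alpha>s"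
      using iffD1[OF prod(1) c(1)] by blast
    have "\<forall>\<alpha>\<in>I\<^sub>N. \<exists>F. F \<in> Gset N M p \<alpha> \<and> has_coeff F (b \<alpha>)" using b grp_realised by blast
    then obtain B where B: "\<forall>\<alpha>\<in>I\<^sub>N. B \<alpha> \<in> Gset N M p \<alpha> \<and> has_coeff (B \<alpha>) (b \<alpha>)" by metis
    have "has_coeff (foldr (\<circ>) (map B \<alpha>s) id) c" unfolding b(2) by (rule fold) (use B b(1) in blast)+
    then have "F \<triangleq> foldr (\<circ>) (map B \<alpha>s) id" using has_coeff_op_eq_iff[OF c(2)] by blast
    then show "\<exists>B. (\<forall>\<alpha>\<in>I\<^sub>N. B \<alpha> \<in> Gset N M p \<alpha>) \<and> F \<triangleq> foldr (\<circ>) (map B \<alpha>s) id"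
      using B by blast
  next
    assume "\<exists>B. (\<forall>\<alpha>\<in>I\<^sub>N. B \<alpha> \<in> Gset N M p \<alpha>) \<and> F \<triangleq> foldr (\<circ>) (map B \<alpha>s) id"
    then obtain B where B: "\<forall>\<alpha>\<in>I\<^sub>N. B \<alpha> \<in> Gset N M p \<alpha>" "F \<triangleq> foldr (\<circ>) (map B \<alpha>s) id" by blast
    obtain b where b: "\<forall>\<alpha>\<in>I\<^sub>N. b \<alpha> \<in> grp \<alpha> \<and> has_coeff (B \<alpha>) (b \<alpha>)" using coef[OF B(1)] by blast
    have "prd b \<alpha>s \<in> units" by (rule iffD2[OF prod(1)]) (use b in blast)
    then show "memL N M (InvL N M p) F"
      unfolding memL_InvL_iff using has_coeff_cong[OF B(2) fold[OF B(1) b]] by blast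
  qed
  assume B: "\<forall>\<alpha>\<in>I\<^sub>N. B \<alpha> \<in> Gset N M p \<alpha> \<and> B' \<alpha> \<in> Gset N M p \<alpha>"
    and eq: "foldr (\<circ>) (map B \<alpha>s) id \<triangleq> foldr (\<circ>) (map B' \<alpha>s) id"
  obtain b b' where b: "\<forall>\<alpha>\<in>I\<^sub>N. b \<alpha> \<in> grp \<alpha> \<and> has_coeff (B \<alpha>) (b \<alpha>)" "\<forall>\<alpha>\<in>I\<^sub>N. b' \<alpha> \<in> grp \<alpha> \<and> has_coeff (B' \<alpha>) (b' \<alpha>)"
    using coef[of B] coef[of B'] B by blast
  have "has_coeff (foldr (\<circ>) (map B \<alpha>s) id) (prd b \<alpha>s)" by (rule fold) (use B b in blast)+
  moreover have "has_coeff (foldr (\<circ>) (map B' \<alpha>s) id) (prd b' \<alpha>s)" by (rule fold) (use B b in blast)+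
  ultimately have "prd b \<alpha>s = prd b' \<alpha>s" using has_coeff_op_eq_iff eq by blast
  then have "\<forall>\<alpha>\<in>I\<^sub>N. b \<alpha> = b' \<alpha>" by (rule prod(2)[rotated 2]) (use b in blast)+
  then show "\<forall>\<alpha>\<in>I\<^sub>N. B \<alpha> \<triangleq> B' \<alpha>" using b has_coeff_op_eq_iff by metis
qed

end

theorem theorem3:
  fixes N M p :: nat
  assumes "N > 0" and "M > 0" and "p > 0"
  shows "(\<forall>\<alpha>\<in>Pow {..<N}. closed_subalgebra N M p (Lset N M p \<alpha>) \<and>
                          closed_subgroup_Inv N M p (Gset N M p \<alpha>))
    \<and> (\<forall>\<alpha>\<in>Pow {..<N}. \<forall>\<beta>\<in>Pow {..<N}. \<alpha> \<noteq> \<beta> \<longrightarrow>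
          {F. memL N M (Lset N M p \<alpha>) F \<and> memL N M (Lset N M p \<beta>) F} = {F. op_eq N M F zero_op} \<and>
          {F. memL N M (Gset N M p \<alpha>) F \<and> memL N M (Gset N M p \<beta>) F} = {F. op_eq N M F Iop})
    \<and> (\<forall>\<alpha>\<in>Pow {..<N}. \<forall>\<beta>\<in>Pow {..<N}. \<forall>F\<in>Lset N M p \<alpha>. \<forall>G\<in>Lset N M p \<beta>.
          memL N M (Lset N M p (\<alpha> \<union> \<beta>)) (F \<circ> G))
    \<and> (\<forall>F. memL N M (Lall N M p) F \<longleftrightarrow>
          (\<exists>B :: nat set \<Rightarrow> oper. (\<forall>\<alpha>\<in>Pow {..<N}. B \<alpha> \<in> Lset N M p \<alpha>) \<and>
              op_eq N M F (\<lambda>u k i. \<Sum>\<alpha>\<in>Pow {..<N}. B \<alpha> u k i)))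
    \<and> (\<forall>B B' :: nat set \<Rightarrow> oper.
          (\<forall>\<alpha>\<in>Pow {..<N}. B \<alpha> \<in> Lset N M p \<alpha> \<and> B' \<alpha> \<in> Lset N M p \<alpha>) \<longrightarrow>
          op_eq N M (\<lambda>u k i. \<Sum>\<alpha>\<in>Pow {..<N}. B \<alpha> u k i) (\<lambda>u k i. \<Sum>\<alpha>\<in>Pow {..<N}. B' \<alpha> u k i) \<longrightarrow>
          (\<forall>\<alpha>\<in>Pow {..<N}. op_eq N M (B \<alpha>) (B' \<alpha>)))
    \<and> (\<forall>\<alpha>s :: nat set list. distinct \<alpha>s \<and> set \<alpha>s = Pow {..<N} \<and>
          (sorted (map card \<alpha>s) \<or> sorted (rev (map card \<alpha>s))) \<longrightarrow>
          (\<forall>F. memL N M (InvL N M p) F \<longleftrightarrow>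
              (\<exists>B :: nat set \<Rightarrow> oper. (\<forall>\<alpha>\<in>Pow {..<N}. B \<alpha> \<in> Gset N M p \<alpha>) \<and>
                  op_eq N M F (foldr (\<circ>) (map B \<alpha>s) id)))
          \<and> (\<forall>B B' :: nat set \<Rightarrow> oper.
               (\<forall>\<alpha>\<in>Pow {..<N}. B \<alpha> \<in> Gset N M p \<alpha> \<and> B' \<alpha> \<in> Gset N M p \<alpha>) \<longrightarrow>
               op_eq N M (foldr (\<circ>) (map B \<alpha>s) id) (foldr (\<circ>) (map B' \<alpha>s) id) \<longrightarrow>
               (\<forall>\<alpha>\<in>Pow {..<N}. op_eq N M (B \<alpha>) (B' \<alpha>))))"
proof -
  interpret staircase_params N M p by standard (use assms in auto)
  show ?thesis
  proof (intro conjI ballI allI impI; (elim conjE)?)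
    show "closed_subalgebra N M p (Lset N M p \<alpha>)" "closed_subgroup_Inv N M p (Gset N M p \<alpha>)"
      if "\<alpha> \<in> Pow {..<N}" for \<alpha>
      using that by (rule closed_subalgebra_Lset, rule closed_subgroup_Gset)
    show "{F. memL N M (Lset N M p \<alpha>) F \<and> memL N M (Lset N M p \<beta>) F} = {F. op_eq N M F zero_op}"
      "{F. memL N M (Gset N M p \<alpha>) F \<and> memL N M (Gset N M p \<beta>) F} = {F. op_eq N M F Iop}"
      if "\<alpha> \<in> Pow {..<N}" "\<beta> \<in> Pow {..<N}" "\<alpha> \<noteq> \<beta>" for \<alpha> \<beta>
      using that by (rule Lset_inter, rule Gset_inter)
    show "memL N M (Lset N M p (\<alpha> \<union> \<beta>)) (F \<circ> G)"
      if "\<alpha> \<in> Pow {..<N}" "\<beta> \<in> Pow {..<N}" "F \<in> Lset N M p \<alpha>" "G \<in> Lset N M p \<beta>" for \<alpha> \<beta> F G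
      using that by (rule Lset_comp)
    show "memL N M (Lall N M p) F \<longleftrightarrow> (\<exists>B. (\<forall>\<alpha>\<in>Pow {..<N}. B \<alpha> \<in> Lset N M p \<alpha>) \<and>
        op_eq N M F (\<lambda>u k i. \<Sum>\<alpha>\<in>Pow {..<N}. B \<alpha> u k i))" for F
      by (rule Lall_iff_sum)
    show "op_eq N M (B \<alpha>) (B' \<alpha>)"
      if "\<forall>\<alpha>\<in>Pow {..<N}. B \<alpha> \<in> Lset N M p \<alpha> \<and> B' \<alpha> \<in> Lset N M p \<alpha>"
        "op_eq N M (\<lambda>u k i. \<Sum>\<alpha>\<in>Pow {..<N}. B \<alpha> u k i) (\<lambda>u k i. \<Sum>\<alpha>\<in>Pow {..<N}. B' \<alpha> u k i)"
        "\<alpha> \<in> Pow {..<N}" for B B' \<alpha>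
      using that by (rule sum_unique[of B B' \<alpha>])
  next
    fix \<alpha>s :: "nat set list"
    assume \<alpha>s: "distinct \<alpha>s" "set \<alpha>s = Pow {..<N}" "sorted (map card \<alpha>s) \<or> sorted (rev (map card \<alpha>s))"
    show "memL N M (InvL N M p) F \<longleftrightarrow> (\<exists>B. (\<forall>\<alpha>\<in>Pow {..<N}. B \<alpha> \<in> Gset N M p \<alpha>) \<and>
        op_eq N M F (foldr (\<circ>) (map B \<alpha>s) id))" for F
      by (rule InvL_product(1)[OF \<alpha>s])
    show "op_eq N M (B \<alpha>) (B' \<alpha>)"
      if "\<forall>\<alpha>\<in>Pow {..<N}. B \<alpha> \<in> Gset N M p \<alpha> \<and> B' \<alpha> \<in> Gset N M p \<alpha>"
        "op_eq N M (foldr (\<circ>) (map B \<alpha>s) id) (foldr (\<circ>) (map B' \<alpha>s) id)" "\<alpha> \<in> Pow {..<N}" for B B' \<alpha>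
      by (rule bspec[OF InvL_product(2)[OF \<alpha>s that(1,2)] that(3)])
  qed
qed

end
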